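(* Let $\alpha\in[0,1)$ and $\theta>-\alpha$. Let $G_n\sim\mathrm{gamma}(1-\alpha,1)$ and $U_n\sim\mathrm{beta}(a_n,1)$ with $a_n=\theta+n\alpha$, $n\ge1$, all be independent, and let $\Pi_n=\prod_{i=1}^{n-1}U_i$ (so $\Pi_1=1$). Then a random mass-partition $\sum_i\delta_{V_i}$ with distribution $\mathrm{PD}(\alpha,\theta)$ satisfies $$\sum_i\delta_{V_i}\ \stackrel{d}{=}\ \sum_{n\ge1}\delta_{\,G_n\Pi_n/\sum_{j\ge1}G_j\Pi_j}.$$ In particular each $\mathrm{PD}(\alpha,\theta)$ distribution belongs to the beta/gamma (perpetuity) family of distributions.
   Context: A random mass-partition is a random counting measure $\sum_i\delta_{V_i}$ on $(0,\infty)$ with $\sum_iV_i=1$. It belongs to the beta/gamma (perpetuity) family if it has the same law as $\sum_n\delta_{G_n\Pi_n/\sum_jG_j\Pi_j}$, where $\Pi_n=\prod_{i=1}^{n-1}U_i$ for some independent random variables $(G_i)$ and $(U_i)$ such that the $G_i$ have an identical gamma distribution and the $U_i$ are beta distributed. $\mathrm{gamma}(c,1)$ has density proportional to $x^{c-1}e^{-x}$ on $(0,\infty)$; $\mathrm{beta}(a,b)$ has density proportional to $x^{a-1}(1-x)^{b-1}$ on $(0,1)$. Definition of $\mathrm{PD}(\alpha,\theta)$, $\alpha\in[0,1)$, $\theta>-\alpha$. Case $\alpha=0$ ($\theta>0$): let $\sum_i\delta_{P_i}$ be a Poisson process on $(0,\infty)$ with intensity $\theta x^{-1}e^{-x}dx$;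 $\mathrm{PD}(0,\theta)$ is the law of $\sum_i\delta_{P_i/\sum_jP_j}$. Case $\alpha\in(0,1)$: let $N=\sum_i\delta_{(T_i,P_i)}$ be a Poisson process on $(0,\infty)^2$ with intensity $\mathrm{Leb}\times\mu_\alpha$, $\mu_\alpha(du)=\frac{\alpha}{\Gamma(1-\alpha)}u^{-\alpha-1}du$, and let $(E_i)$ be i.i.d. standard exponential marks independent of $N$. Put $\tau_1=\sum_{T_i\le1}P_i$ and $Z_1=\min_{T_i\le1}E_i/P_i$; then $\mathbb E Z_1^\theta=\Gamma(\theta/\alpha+1)<\infty$. $\mathrm{PD}(\alpha,\theta)$ is the law of $\sum_{T_i\le1}\delta_{P_i/\tau_1}$ under the probability measure with density $Z_1^\theta/\Gamma(\theta/\alpha+1)$ with respect to the original one. *)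

theory Defs
  imports "HOL-Probability.Probability"
begin

section \<open>Random measures\<close>

text \<open>The space of all measures on the measurable space \<open>S\<close>, with the \<open>\<sigma>\<close>-algebra generated by
  the evaluations \<open>m \<mapsto> m(A)\<close>. It is the analogue of \<^const>\<open>subprob_algebra\<close> for measures
  of arbitrary (possibly infinite) mass; equality in law of random measures is equality of
  distributions on this space.\<close>

definition measure_algebra :: "'s measure \<Rightarrow> 's measure measure" where
  "measure_algebra S =
     (SUP A \<in> sets S. vimage_algebra {m. sets m = sets S} (\<lambda>m. emeasure m A) borel)"

text \<open>\<open>\<Sum>\<^sub>i\<^sub>\<in>\<^sub>I \<delta>\<^bsub>x i\<^esub>\<close> is the image of the counting measure on \<open>I\<close> under \<open>x\<close>.\<close>

definition point_measure :: "'s measure \<Rightarrow> 'i set \<Rightarrow> ('i \<Rightarrow> 's) \<Rightarrow> 's measure" where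
  "point_measure S I x = distr (count_space I) S x"

text \<open>Measures on \<open>(0,\<infinity>)\<close> are represented by Borel measures on the real line that do not charge
  the complement of \<open>(0,\<infinity>)\<close>.\<close>

definition mass_partition :: "real measure \<Rightarrow> bool" where
  "mass_partition m \<longleftrightarrow>
     (\<exists>(I :: nat set) v. (\<forall>i\<in>I. 0 < v i) \<and> (v has_sum 1) I \<and> m = point_measure borel I v)"

definition random_mass_partition :: "'a measure \<Rightarrow> ('a \<Rightarrow> real measure) \<Rightarrow> bool" where
  "random_mass_partition M \<xi> \<longleftrightarrow>
     prob_space M \<and> \<xi> \<in> M \<rightarrow>\<^sub>M measure_algebra borel \<and> (AE \<omega> in M. mass_partition (\<xi> \<omega>))"

definition poisson_process :: "'a measure \<Rightarrow> 's measure \<Rightarrow> ('a \<Rightarrow> 's measure) \<Rightarrow> bool" where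
  "poisson_process M \<nu> N \<longleftrightarrow>
     prob_space M \<and> N \<in> M \<rightarrow>\<^sub>M measure_algebra \<nu> \<and>
     (\<forall>A \<in> sets \<nu>. emeasure \<nu> A < \<infinity> \<longrightarrow>
        (\<forall>k :: nat. measure M {\<omega> \<in> space M. emeasure (N \<omega>) A = of_nat k} =
           measure \<nu> A ^ k / fact k * exp (- measure \<nu> A))) \<and>
     (\<forall>(n :: nat) A. (\<forall>i<n. A i \<in> sets \<nu>) \<and> disjoint_family_on A {..<n} \<longrightarrow>
        prob_space.indep_vars M (\<lambda>_. borel) (\<lambda>i \<omega>. emeasure (N \<omega>) (A i)) {..<n})"

section \<open>The beta/gamma (perpetuity) family\<close>

definition gamma_density :: "real \<Rightarrow> real \<Rightarrow> real" where
  "gamma_density c x = (if 0 < x then x powr (c - 1) * exp (- x) / Gamma c else 0)"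

definition beta_density :: "real \<Rightarrow> real \<Rightarrow> real \<Rightarrow> real" where
  "beta_density a b x =
     (if 0 < x \<and> x < 1 then x powr (a - 1) * (1 - x) powr (b - 1) / Beta a b else 0)"

text \<open>All sequences below are indexed by \<open>n \<ge> 1\<close>; values at index \<open>0\<close> play no role. The index set
  \<open>{1..} <+> {1..}\<close> makes the whole collection of the \<open>G n\<close> and \<open>U n\<close> jointly independent.\<close>

definition gamma_beta_variables ::
  "real \<Rightarrow> (nat \<Rightarrow> real) \<Rightarrow> (nat \<Rightarrow> real) \<Rightarrow> 'a measure \<Rightarrow> (nat \<Rightarrow> 'a \<Rightarrow> real) \<Rightarrow> (nat \<Rightarrow> 'a \<Rightarrow> real) \<Rightarrow> bool"
  where
  "gamma_beta_variables c a b M G U \<longleftrightarrow>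
     prob_space M \<and>
     (\<forall>n\<ge>1. distributed M lborel (G n) (\<lambda>x. ennreal (gamma_density c x))) \<and>
     (\<forall>n\<ge>1. distributed M lborel (U n) (\<lambda>x. ennreal (beta_density (a n) (b n) x))) \<and>
     prob_space.indep_vars M (\<lambda>_. borel) (case_sum G U) ({1..} <+> {1..})"

definition Pi_prod :: "(nat \<Rightarrow> 'a \<Rightarrow> real) \<Rightarrow> nat \<Rightarrow> 'a \<Rightarrow> real" where
  "Pi_prod U n \<omega> = (\<Prod>i\<in>{1..<n}. U i \<omega>)"

definition perpetuity_sum ::
  "(nat \<Rightarrow> 'a \<Rightarrow> real) \<Rightarrow> (nat \<Rightarrow> 'a \<Rightarrow> real) \<Rightarrow> 'a \<Rightarrow> real" where
  "perpetuity_sum G U \<omega> = (\<Sum>j. G (Suc j) \<omega> * Pi_prod U (Suc j) \<omega>)"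

definition perpetuity_partition ::
  "(nat \<Rightarrow> 'a \<Rightarrow> real) \<Rightarrow> (nat \<Rightarrow> 'a \<Rightarrow> real) \<Rightarrow> 'a \<Rightarrow> real measure" where
  "perpetuity_partition G U \<omega> =
     point_measure borel {1..} (\<lambda>n. G n \<omega> * Pi_prod U n \<omega> / perpetuity_sum G U \<omega>)"

text \<open>Membership of a distribution \<open>L\<close> in the family. The underlying probability space may be taken
  to be a sequence space, since only the joint law of the \<open>G n\<close> and \<open>U n\<close> matters. Almost sure
  convergence of the normalising sum says that the right-hand side is a random mass-partition.\<close>

definition beta_gamma_family :: "real measure measure \<Rightarrow> bool" where
  "beta_gamma_family L \<longleftrightarrow>
     (\<exists>c a b (M :: (nat + nat \<Rightarrow> real) measure) G U.
        0 < c \<and> (\<forall>n\<ge>1. 0 < a n \<and> 0 < b n) \<and>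
        gamma_beta_variables c a b M G U \<and>
        (AE \<omega> in M. summable (\<lambda>j. G (Suc j) \<omega> * Pi_prod U (Suc j) \<omega>)) \<and>
        L = distr M (measure_algebra borel) (perpetuity_partition G U))"

section \<open>The Poisson-Dirichlet distributions\<close>

definition intensity0 :: "real \<Rightarrow> real measure" where
  "intensity0 \<theta> = density lborel (\<lambda>x. ennreal (\<theta> / x * exp (- x)) * indicator {0<..} x)"

definition PD0_process :: "real \<Rightarrow> 'a measure \<Rightarrow> (nat \<Rightarrow> 'a \<Rightarrow> real) \<Rightarrow> bool" where
  "PD0_process \<theta> M P \<longleftrightarrow>
     (\<forall>i. P i \<in> borel_measurable M) \<and> (\<forall>i. \<forall>\<omega>\<in>space M. 0 < P i \<omega>) \<and>
     poisson_process M (intensity0 \<theta>) (\<lambda>\<omega>. point_measure borel UNIV (\<lambda>i. P i \<omega>))"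

definition PD0_law :: "'a measure \<Rightarrow> (nat \<Rightarrow> 'a \<Rightarrow> real) \<Rightarrow> real measure measure" where
  "PD0_law M P =
     distr M (measure_algebra borel)
       (\<lambda>\<omega>. point_measure borel UNIV (\<lambda>i. P i \<omega> / (\<Sum>j. P j \<omega>)))"

definition stable_measure :: "real \<Rightarrow> real measure" where
  "stable_measure \<alpha> =
     density lborel (\<lambda>u. ennreal (\<alpha> / Gamma (1 - \<alpha>) * u powr (- \<alpha> - 1)) * indicator {0<..} u)"

text \<open>The marks are independent of the enumeration \<open>(T i, P i)\<^sub>i\<close> of the points, not merely of the point
  measure: otherwise the assignment of marks to points could depend on the marks.\<close>

definition stable_process ::
  "real \<Rightarrow> 'a measure \<Rightarrow> (nat \<Rightarrow> 'a \<Rightarrow> real) \<Rightarrow> (nat \<Rightarrow> 'a \<Rightarrow> real) \<Rightarrow> (nat \<Rightarrow> 'a \<Rightarrow> real) \<Rightarrow> bool" where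
  "stable_process \<alpha> M T P E \<longleftrightarrow>
     (\<forall>i. T i \<in> borel_measurable M \<and> P i \<in> borel_measurable M) \<and>
     (\<forall>i. \<forall>\<omega>\<in>space M. 0 < T i \<omega> \<and> 0 < P i \<omega>) \<and>
     poisson_process M (density lborel (indicator {0<..}) \<Otimes>\<^sub>M stable_measure \<alpha>)
       (\<lambda>\<omega>. point_measure (borel \<Otimes>\<^sub>M borel) UNIV (\<lambda>i. (T i \<omega>, P i \<omega>))) \<and>
     (\<forall>i. distributed M lborel (E i) (\<lambda>x. ennreal (exponential_density 1 x))) \<and>
     prob_space.indep_vars M (\<lambda>_. borel) E UNIV \<and>
     prob_space.indep_set M
       {(\<lambda>\<omega> i. (T i \<omega>, P i \<omega>)) -` X \<inter> space M | X. X \<in> sets (Pi\<^sub>M UNIV (\<lambda>_. borel \<Otimes>\<^sub>M borel))}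
       {(\<lambda>\<omega> i. E i \<omega>) -` Y \<inter> space M | Y. Y \<in> sets (Pi\<^sub>M UNIV (\<lambda>_. borel))}"

definition tau1 :: "(nat \<Rightarrow> 'a \<Rightarrow> real) \<Rightarrow> (nat \<Rightarrow> 'a \<Rightarrow> real) \<Rightarrow> 'a \<Rightarrow> real" where
  "tau1 T P \<omega> = (\<Sum>i. if T i \<omega> \<le> 1 then P i \<omega> else 0)"

text \<open>The infimum is almost surely attained.\<close>

definition Z1 ::
  "(nat \<Rightarrow> 'a \<Rightarrow> real) \<Rightarrow> (nat \<Rightarrow> 'a \<Rightarrow> real) \<Rightarrow> (nat \<Rightarrow> 'a \<Rightarrow> real) \<Rightarrow> 'a \<Rightarrow> real" where
  "Z1 T P E \<omega> = (INF i \<in> {i. T i \<omega> \<le> 1}. E i \<omega> / P i \<omega>)"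

definition PD_stable_law ::
  "real \<Rightarrow> real \<Rightarrow> 'a measure \<Rightarrow> (nat \<Rightarrow> 'a \<Rightarrow> real) \<Rightarrow> (nat \<Rightarrow> 'a \<Rightarrow> real) \<Rightarrow> (nat \<Rightarrow> 'a \<Rightarrow> real) \<Rightarrow>
   real measure measure" where
  "PD_stable_law \<alpha> \<theta> M T P E =
     distr (density M (\<lambda>\<omega>. ennreal (Z1 T P E \<omega> powr \<theta> / Gamma (\<theta> / \<alpha> + 1))))
       (measure_algebra borel)
       (\<lambda>\<omega>. point_measure borel {i. T i \<omega> \<le> 1} (\<lambda>i. P i \<omega> / tau1 T P \<omega>))"

text \<open>\<open>is_PD \<alpha> \<theta> L\<close>: the distribution \<open>L\<close> is \<open>PD(\<alpha>,\<theta>)\<close>. All the intensities have infinite total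
  mass, so the processes have infinitely many points almost surely and can be enumerated by \<open>nat\<close>.
  The laws depend only on the joint law of these enumerations and marks, so fixing the underlying
  probability space to be a sequence space is no restriction.\<close>

definition is_PD :: "real \<Rightarrow> real \<Rightarrow> real measure measure \<Rightarrow> bool" where
  "is_PD \<alpha> \<theta> L \<longleftrightarrow>
     (\<alpha> = 0 \<and> 0 < \<theta> \<and>
       (\<exists>(M :: (nat \<Rightarrow> real) measure) P. PD0_process \<theta> M P \<and> L = PD0_law M P)) \<or>
     (0 < \<alpha> \<and> \<alpha> < 1 \<and> - \<alpha> < \<theta> \<and>
       (\<exists>(M :: (nat \<Rightarrow> real \<times> real \<times> real) measure) T P E.
          stable_process \<alpha> M T P E \<and> L = PD_stable_law \<alpha> \<theta> M T P E))"

end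

theory Submission
  imports Defs
begin

text \<open>
  Both sides are normalisations of point measures of infinite total count, and these are compared,
  before normalising, by their Laplace functionals. Let \<open>f \<ge> 0\<close> vanish near \<open>0\<close> and \<open>q = exp (- f)\<close>.

  The unnormalised perpetuity \<open>X = \<Sum>\<^sub>n \<delta>(G\<^sub>n \<Pi>\<^sub>n)\<close> satisfies \<open>X = \<delta>(G\<^sub>1) + U\<^sub>1 X'\<close>, where \<open>X'\<close> is
  independent of \<open>(G\<^sub>1, U\<^sub>1)\<close> and built from the shifted sequences, so that \<open>\<theta>\<close> becomes \<open>\<theta> + \<alpha>\<close>. The recursion
  that this gives for \<open>s \<mapsto> E exp (- \<Sum>\<^sub>n f (s G\<^sub>n \<Pi>\<^sub>n))\<close> is solved explicitly: with
  \<open>k(s) = E q(s G)\<close> for \<open>G\<close> of law \<open>gamma(1 - \<alpha>, 1)\<close> and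
  \<open>\<delta>(w) = \<Gamma>(1 - \<alpha>)\<^sup>-\<^sup>1 \<integral> (1 - q(v)) exp (- w v) v powr (- \<alpha> - 1) dv\<close>, put
  \<open>g\<^sub>a(s) = (1 + \<alpha> s powr \<alpha> \<delta>(1/s)) powr (- a / \<alpha>)\<close>, or \<open>g\<^sub>a(s) = exp (- a \<delta>(1/s))\<close> if \<open>\<alpha> = 0\<close>. Since
  \<open>k(1/w) = 1 + w powr (1 - \<alpha>) \<delta>'(w)\<close>, the fundamental theorem of calculus shows that
  \<open>E k(s U) g\<^sub>a\<^sub>+\<^sub>\<alpha>(s U) = g\<^sub>a(s)\<close> for \<open>U\<close> of law \<open>beta(a,1)\<close> (\<open>gg_step\<close>). Integrating out the variables one at a
  time, the remainder being negligible because \<open>a\<^sub>n E \<Pi>\<^sub>n \<longlonglongrightarrow> 0\<close>, one finds that the Laplace functional of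
  \<open>s X\<close> is \<open>k(s) g\<^sub>\<theta>\<^sub>+\<^sub>\<alpha>(s)\<close> (\<open>laplace_X\<close>).

  For \<open>\<alpha> = 0\<close> the Poisson process has the Laplace functional \<open>exp (- \<theta> \<delta>(1)) = g\<^sub>\<theta>(1)\<close>, which by the
  recursion is that of \<open>U\<^sub>0 X\<close> with \<open>U\<^sub>0\<close> of law \<open>beta(\<theta>,1)\<close> independent of \<open>X\<close>; the factor \<open>U\<^sub>0\<close> does not
  change the normalisation (\<open>PD0_law_eq\<close>).

  For \<open>\<alpha> > 0\<close> let \<open>\<xi>\<close> be the point measure of the \<open>P\<^sub>i\<close> with \<open>T\<^sub>i \<le> 1\<close>. Given the points, the smallest ratio
  \<open>Z\<^sub>1\<close> is exponential with rate the total mass \<open>\<tau>\<close>. The law of \<open>Z\<^sub>1 \<xi>\<close> under the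
  density proportional to \<open>Z\<^sub>1 powr \<theta>\<close> therefore has a Laplace functional proportional to the integral of
  \<open>z powr \<theta> E (\<tau> exp (- z \<tau> - \<integral> f (z x) d\<xi>))\<close> over \<open>z > 0\<close>. The expectation is
  \<open>\<alpha> k(1) z powr (\<alpha> - 1) exp (- z powr \<alpha> (1 + \<alpha> \<delta>(1)))\<close> by the Campbell formula (\<open>campbell\<close>), and the
  integral is a Gamma integral. The result is again \<open>k(1) g\<^sub>\<theta>\<^sub>+\<^sub>\<alpha>(1)\<close> (\<open>weighted_laplace\<close>), so that \<open>Z\<^sub>1 \<xi>\<close>, which
  has the same normalisation as \<open>\<xi>\<close>, has the law of \<open>X\<close>.

  Laplace functionals determine laws of random measures (\<open>laplace_functional_unique\<close>), and normalising is
  a measurable operation (\<open>normalise_measurable\<close>), which gives the equality of the normalised laws.\<close>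

section \<open>Random measures and their Laplace functionals\<close>

lemma space_measure_algebra: "space (measure_algebra S) = {m. sets m = sets S}"
proof -
  have "sets S \<noteq> {}"
    by (metis empty_iff sets.empty_sets)
  then show ?thesis
    unfolding measure_algebra_def by (subst space_Sup_eq_UN) auto
qed

lemma measurable_emeasure_measure_algebra [measurable]:
  assumes "A \<in> sets S"
  shows "(\<lambda>m. emeasure m A) \<in> borel_measurable (measure_algebra S)"
  unfolding measure_algebra_def using assms
  by (intro measurable_SUP1[where i = A] measurable_vimage_algebra1) auto

lemma measurable_measure_algebra:
  assumes "\<And>\<omega>. \<omega> \<in> space M \<Longrightarrow> sets (f \<omega>) = sets S"
    and "\<And>A. A \<in> sets S \<Longrightarrow> (\<lambda>\<omega>. emeasure (f \<omega>) A) \<in> borel_measurable M"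
  shows "f \<in> M \<rightarrow>\<^sub>M measure_algebra S"
proof -
  have "sets S \<noteq> {}"
    by (metis empty_iff sets.empty_sets)
  then show ?thesis
    unfolding measure_algebra_def using assms
    by (intro measurable_SUP2 measurable_vimage_algebra2) auto
qed

lemma measurable_nn_integral_measure_algebra [measurable]:
  assumes "f \<in> borel_measurable S"
  shows "(\<lambda>m. \<integral>\<^sup>+x. f x \<partial>m) \<in> borel_measurable (measure_algebra S)" (is "_ \<in> ?B")
  using assms
proof (induct f)
  case (cong f g)
  have "(\<lambda>m. \<integral>\<^sup>+x. f x \<partial>m) \<in> ?B \<longleftrightarrow> (\<lambda>m. \<integral>\<^sup>+x. g x \<partial>m) \<in> ?B"
    by (intro measurable_cong nn_integral_cong cong)
      (auto simp: space_measure_algebra dest: sets_eq_imp_space_eq)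
  with cong show ?case by simp
next
  case (set B)
  then have "(\<lambda>m. \<integral>\<^sup>+x. indicator B x \<partial>m) \<in> ?B \<longleftrightarrow> (\<lambda>m. emeasure m B) \<in> ?B"
    by (intro measurable_cong nn_integral_indicator) (simp add: space_measure_algebra)
  with set show ?case by simp
next
  case (mult f c)
  then have "(\<lambda>m. \<integral>\<^sup>+x. c * f x \<partial>m) \<in> ?B \<longleftrightarrow> (\<lambda>m. c * \<integral>\<^sup>+x. f x \<partial>m) \<in> ?B"
    by (intro measurable_cong nn_integral_cmult)
      (simp add: space_measure_algebra cong: measurable_cong_sets)
  with mult show ?case by simp
next
  case (add f g)
  then have "(\<lambda>m. \<integral>\<^sup>+x. g x + f x \<partial>m) \<in> ?B \<longleftrightarrow>
      (\<lambda>m. (\<integral>\<^sup>+x. g x \<partial>m) + (\<integral>\<^sup>+x. f x \<partial>m)) \<in> ?B"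
    by (intro measurable_cong nn_integral_add)
      (simp_all add: space_measure_algebra cong: measurable_cong_sets)
  with add show ?case by simp
next
  case (seq F)
  then have "(\<lambda>m. \<integral>\<^sup>+x. (SUP i. F i) x \<partial>m) \<in> ?B \<longleftrightarrow> (\<lambda>m. SUP i. \<integral>\<^sup>+x. F i x \<partial>m) \<in> ?B"
    unfolding SUP_apply
    by (intro measurable_cong nn_integral_monotone_convergence_SUP)
      (simp_all add: space_measure_algebra cong: measurable_cong_sets)
  with seq show ?case by simp
qed

text \<open>The function \<open>x \<mapsto> exp (- x)\<close> on \<open>[0,\<infinity>]\<close>, with value \<open>0\<close> at \<open>\<infinity>\<close>. Laplace functionals are
  expectations of \<open>nexp (\<integral> f dm)\<close>, where the integral may be infinite.\<close>

definition nexp :: "ennreal \<Rightarrow> real" where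
  "nexp x = (if x = \<top> then 0 else exp (- enn2real x))"

lemma nexp_measurable [measurable]: "nexp \<in> borel_measurable borel"
  unfolding nexp_def[abs_def] by measurable

lemma nexp_0 [simp]: "nexp 0 = 1"
  by (simp add: nexp_def)

lemma nexp_top [simp]: "nexp \<top> = 0"
  by (simp add: nexp_def)

lemma nexp_ennreal: "0 \<le> x \<Longrightarrow> nexp (ennreal x) = exp (- x)"
  by (simp add: nexp_def)

lemma nexp_nonneg [simp]: "0 \<le> nexp x"
  by (simp add: nexp_def)

lemma nexp_le_1 [simp]: "nexp x \<le> 1"
  by (simp add: nexp_def)

lemma nexp_add: "nexp (x + y) = nexp x * nexp y"
  by (cases x; cases y) (auto simp: nexp_def simp flip: ennreal_plus exp_add)

lemma nexp_sum: "nexp (\<Sum>i\<in>I. g i) = (\<Prod>i\<in>I. nexp (g i))"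
  by (induction I rule: infinite_finite_induct) (auto simp: nexp_add)

lemma nexp_antimono: "x \<le> y \<Longrightarrow> nexp y \<le> nexp x"
  by (cases x; cases y) (auto simp: nexp_ennreal top_unique)

lemma nexp_inverse: "x = (if nexp x = 0 then \<top> else ennreal (- ln (nexp x)))"
  by (cases x) (auto simp: nexp_def)

lemma tendsto_nexp:
  assumes X: "(X \<longlongrightarrow> x) F"
  shows "((\<lambda>n. nexp (X n)) \<longlongrightarrow> nexp x) F"
proof (cases "x = \<top>")
  case False
  then have "x < \<top>" by (simp add: less_top)
  then have "eventually (\<lambda>n. X n < \<top>) F"
    using X by (rule order_tendstoD(2)[rotated])
  then have ev: "eventually (\<lambda>n. exp (- enn2real (X n)) = nexp (X n)) F"
    by eventually_elim (simp add: nexp_def)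
  have "((\<lambda>n. exp (- enn2real (X n))) \<longlongrightarrow> exp (- enn2real x)) F"
    using X False by (intro tendsto_intros tendsto_enn2real) (auto simp: less_top)
  then have "((\<lambda>n. nexp (X n)) \<longlongrightarrow> exp (- enn2real x)) F"
    by (rule Lim_transform_eventually[OF _ ev])
  then show ?thesis using False by (simp add: nexp_def)
next
  case True
  have "((\<lambda>n. nexp (X n)) \<longlongrightarrow> 0) F"
  proof (rule tendstoI)
    fix e :: real assume e: "0 < e"
    have "ennreal (max 0 (- ln e)) < x" using True by simp
    then have "eventually (\<lambda>n. ennreal (max 0 (- ln e)) < X n) F"
      using X by (rule order_tendstoD(1)[rotated])
    then show "eventually (\<lambda>n. dist (nexp (X n)) 0 < e) F"
    proof eventually_elim
      case (elim n)
      show ?case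
      proof (cases "X n")
        case (real r)
        with elim have "max 0 (- ln e) < r" by (subst (asm) real(2)) (subst (asm) ennreal_less_iff, auto)
        then have "exp (- r) < exp (ln e)" by simp
        with e real show ?thesis by (simp add: nexp_ennreal)
      qed (use e in auto)
    qed
  qed
  with True show ?thesis by simp
qed

lemma nexp_suminf: "(\<lambda>n. \<Prod>i<n. nexp (g i)) \<longlonglongrightarrow> nexp (\<Sum>i. g i)"
proof -
  have "(\<lambda>n. nexp (\<Sum>i<n. g i)) \<longlonglongrightarrow> nexp (\<Sum>i. g i)"
    by (rule tendsto_nexp, rule summable_LIMSEQ) simp
  then show ?thesis by (simp add: nexp_sum)
qed

text \<open>Polynomials in \<open>h\<close>, hence by the Weierstrass approximation theorem continuous functions of
  \<open>h\<close>, hence the indicator of \<open>{h > c}\<close>, may be multiplied to the test functions.\<close>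

lemma multiplicative_class_step:
  fixes H :: "('a \<Rightarrow> real) set"
  assumes M: "prob_space M" and N: "prob_space N" and sets_eq: "sets M = sets N"
    and meas: "\<And>h. h \<in> H \<Longrightarrow> h \<in> borel_measurable M"
    and bnd: "\<And>h x. h \<in> H \<Longrightarrow> 0 \<le> h x \<and> h x \<le> 1"
    and mult: "\<And>g h. g \<in> H \<Longrightarrow> h \<in> H \<Longrightarrow> (\<lambda>x. g x * h x) \<in> H"
    and R [measurable]: "R \<in> borel_measurable M" and R_bnd: "\<And>x. 0 \<le> R x \<and> R x \<le> (1::real)"
    and eq: "\<And>g. g \<in> H \<Longrightarrow> (\<integral>x. g x * R x \<partial>M) = (\<integral>x. g x * R x \<partial>N)"
    and h: "h \<in> H" and g: "g \<in> H"
  shows "(\<integral>x. g x * (indicator {c<..} (h x) * R x) \<partial>M) =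
    (\<integral>x. g x * (indicator {c<..} (h x) * R x) \<partial>N)"
proof -
  interpret M: prob_space M by fact
  interpret N: prob_space N by fact
  note [measurable] = meas[OF g] meas[OF h]
  have [measurable]: "g \<in> borel_measurable N" "h \<in> borel_measurable N" "R \<in> borel_measurable N"
    using meas[OF g] meas[OF h] R by (auto simp: measurable_cong_sets[OF sets_eq refl])
  have gR: "0 \<le> g x * R x \<and> g x * R x \<le> 1" for x
    using bnd[OF g, of x] R_bnd[of x] by (auto intro: mult_le_one)
  have intM: "integrable M (\<lambda>x. g x * R x * \<phi> (h x))"
    and intN: "integrable N (\<lambda>x. g x * R x * \<phi> (h x))"
    if [measurable]: "\<phi> \<in> borel_measurable borel" and K: "\<And>y. y \<in> {0..1} \<Longrightarrow> \<bar>\<phi> y\<bar> \<le> K"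
    for \<phi> :: "real \<Rightarrow> real" and K
  proof -
    have "\<bar>g x * R x * \<phi> (h x)\<bar> \<le> K" for x
    proof -
      have "\<bar>g x * R x * \<phi> (h x)\<bar> = (g x * R x) * \<bar>\<phi> (h x)\<bar>"
        using gR[of x] by (simp only: abs_mult[of "g x * R x"] abs_of_nonneg)
      also have "\<dots> \<le> 1 * \<bar>\<phi> (h x)\<bar>"
        using gR[of x] by (intro mult_right_mono) auto
      also have "\<dots> \<le> K" using K[of "h x"] bnd[OF h, of x] by simp
      finally show ?thesis .
    qed
    then show "integrable M (\<lambda>x. g x * R x * \<phi> (h x))" "integrable N (\<lambda>x. g x * R x * \<phi> (h x))"
      by (auto intro!: M.integrable_const_bound[where B = K] N.integrable_const_bound[where B = K])
  qed
  have pow: "(\<lambda>x. g x * h x ^ i) \<in> H" for i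
  proof (induction i)
    case (Suc i)
    from mult[OF this h] show ?case by (simp add: mult_ac)
  qed (simp add: g)
  have poly: "(\<integral>x. g x * R x * p (h x) \<partial>M) = (\<integral>x. g x * R x * p (h x) \<partial>N)"
    if "real_polynomial_function p" for p
  proof -
    from that obtain a n where p: "p = (\<lambda>x. \<Sum>i\<le>n. a i * x ^ i)"
      by (auto simp: real_polynomial_function_iff_sum)
    have b: "\<bar>y ^ i\<bar> \<le> 1" if "y \<in> {0..1}" for y :: real and i
      using that by (auto simp: power_le_one)
    have 1: "g x * R x * p (h x) = (\<Sum>i\<le>n. a i * (g x * R x * h x ^ i))" for x
      by (simp add: p sum_distrib_left mult_ac)
    have "(\<integral>x. g x * R x * h x ^ i \<partial>M) = (\<integral>x. g x * R x * h x ^ i \<partial>N)" for i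
      using eq[OF pow[of i]] by (simp add: mult_ac)
    then show ?thesis
      unfolding 1 using intM[of "\<lambda>y. y ^ _" 1, OF _ b] intN[of "\<lambda>y. y ^ _" 1, OF _ b]
      by (subst (1 2) Bochner_Integration.integral_sum) auto
  qed
  have cont: "(\<integral>x. g x * R x * \<phi> (h x) \<partial>M) = (\<integral>x. g x * R x * \<phi> (h x) \<partial>N)"
    if \<phi>: "continuous_on UNIV \<phi>" for \<phi> :: "real \<Rightarrow> real"
  proof -
    have [measurable]: "\<phi> \<in> borel_measurable borel"
      using \<phi> by (rule borel_measurable_continuous_onI)
    have "compact (\<phi> ` {0..1})"
      using \<phi> by (intro compact_continuous_image) (auto intro: continuous_on_subset)
    then obtain K where "\<forall>y\<in>\<phi> ` {0..1}. norm y \<le> K"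
      using compact_imp_bounded bounded_iff by metis
    then have K: "\<And>y. y \<in> {0..1} \<Longrightarrow> \<bar>\<phi> y\<bar> \<le> K" by auto
    have *: "\<bar>(\<integral>x. g x * R x * \<phi> (h x) \<partial>M) - (\<integral>x. g x * R x * \<phi> (h x) \<partial>N)\<bar> \<le> e"
      if "0 < e" for e
    proof -
      obtain p where p: "real_polynomial_function p" "\<And>y. y \<in> {0..1} \<Longrightarrow> \<bar>\<phi> y - p y\<bar> < e / 2"
        using Stone_Weierstrass_real_polynomial_function[of "{0..1::real}" \<phi> "e / 2"] \<phi> \<open>0 < e\<close>
        by (metis compact_Icc continuous_on_subset half_gt_zero subset_UNIV)
      have [measurable]: "p \<in> borel_measurable borel"
        using p(1) by (intro borel_measurable_continuous_onI continuous_on_polymonial_function)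
          (simp add: real_polynomial_function_eq)
      have Kp: "\<bar>p y\<bar> \<le> K + e / 2" if "y \<in> {0..1}" for y
        using p(2)[OF that] K[OF that] by linarith
      have int: "integrable M (\<lambda>x. g x * R x * \<phi> (h x))" "integrable M (\<lambda>x. g x * R x * p (h x))"
        "integrable N (\<lambda>x. g x * R x * \<phi> (h x))" "integrable N (\<lambda>x. g x * R x * p (h x))"
        by (rule intM[of \<phi> K], measurable, rule K, assumption)
          (rule intM[of p "K + e / 2"], measurable, rule Kp, assumption,
            rule intN[of \<phi> K], measurable, rule K, assumption,
            rule intN[of p "K + e / 2"], measurable, rule Kp, assumption)
      have close: "\<bar>g x * R x * \<phi> (h x) - g x * R x * p (h x)\<bar> \<le> e / 2" for x
      proof -
        have "\<bar>g x * R x * \<phi> (h x) - g x * R x * p (h x)\<bar> = (g x * R x) * \<bar>\<phi> (h x) - p (h x)\<bar>"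
          unfolding right_diff_distrib[symmetric] abs_mult[of "g x * R x"]
          using gR[of x] by (simp only: abs_of_nonneg)
        also have "\<dots> \<le> 1 * \<bar>\<phi> (h x) - p (h x)\<bar>"
          using gR[of x] by (intro mult_right_mono) auto
        also have "\<dots> \<le> e / 2" using p(2)[of "h x"] bnd[OF h, of x] by simp
        finally show ?thesis .
      qed
      have "\<bar>(\<integral>x. g x * R x * \<phi> (h x) \<partial>M) - (\<integral>x. g x * R x * p (h x) \<partial>M)\<bar> \<le> e / 2"
      proof -
        have "\<bar>(\<integral>x. g x * R x * \<phi> (h x) - g x * R x * p (h x) \<partial>M)\<bar>
            \<le> (\<integral>x. \<bar>g x * R x * \<phi> (h x) - g x * R x * p (h x)\<bar> \<partial>M)"
          by (rule integral_abs_bound)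
        also have "\<dots> \<le> (\<integral>x. e / 2 \<partial>M)"
          by (intro integral_mono integrable_abs Bochner_Integration.integrable_diff int close
              M.integrable_const)
        finally show ?thesis
          by (simp add: Bochner_Integration.integral_diff[OF int(1) int(2)] M.prob_space)
      qed
      moreover have "\<bar>(\<integral>x. g x * R x * \<phi> (h x) \<partial>N) - (\<integral>x. g x * R x * p (h x) \<partial>N)\<bar> \<le> e / 2"
      proof -
        have "\<bar>(\<integral>x. g x * R x * \<phi> (h x) - g x * R x * p (h x) \<partial>N)\<bar>
            \<le> (\<integral>x. \<bar>g x * R x * \<phi> (h x) - g x * R x * p (h x)\<bar> \<partial>N)"
          by (rule integral_abs_bound)
        also have "\<dots> \<le> (\<integral>x. e / 2 \<partial>N)"
          by (intro integral_mono integrable_abs Bochner_Integration.integrable_diff int close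
              N.integrable_const)
        finally show ?thesis
          by (simp add: Bochner_Integration.integral_diff[OF int(3) int(4)] N.prob_space)
      qed
      ultimately show ?thesis using poly[OF p(1)] by linarith
    qed
    have "\<bar>(\<integral>x. g x * R x * \<phi> (h x) \<partial>M) - (\<integral>x. g x * R x * \<phi> (h x) \<partial>N)\<bar> \<le> 0"
      by (rule field_le_epsilon) (simp only: add_0 *)
    then show ?thesis by simp
  qed
  define \<phi> :: "nat \<Rightarrow> real \<Rightarrow> real" where "\<phi> k y = min 1 (max 0 (real k * (y - c)))" for k y
  have [measurable]: "\<phi> k \<in> borel_measurable borel" for k
    unfolding \<phi>_def[abs_def] by measurable
  have \<phi>_bnd: "\<bar>\<phi> k y\<bar> \<le> 1" for k y by (auto simp: \<phi>_def)
  have lim: "(\<lambda>k. \<phi> k y) \<longlonglongrightarrow> indicator {c<..} y" for y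
  proof (cases "c < y")
    case True
    then obtain m where m: "1 < real m * (y - c)"
      using reals_Archimedean3[of "y - c"] by auto
    have "\<forall>\<^sub>F k in sequentially. \<phi> k y = 1"
      using eventually_ge_at_top[of m]
    proof eventually_elim
      case (elim k)
      then have "real m * (y - c) \<le> real k * (y - c)" using True by (intro mult_right_mono) auto
      with m show ?case by (simp add: \<phi>_def)
    qed
    then show ?thesis using True by (simp add: tendsto_eventually)
  next
    case False
    then have "\<phi> k y = 0" for k by (simp add: \<phi>_def mult_nonneg_nonpos)
    then show ?thesis using False by simp
  qed
  have dom: "\<bar>g x * R x * \<phi> k (h x)\<bar> \<le> 1" for x k
    unfolding abs_mult[of "g x * R x"] using gR[of x] \<phi>_bnd[of k "h x"]
    by (intro mult_le_one) (simp_all only: abs_of_nonneg abs_ge_zero)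
  have "(\<lambda>k. \<integral>x. g x * R x * \<phi> k (h x) \<partial>M) \<longlonglongrightarrow> (\<integral>x. g x * R x * indicator {c<..} (h x) \<partial>M)"
    by (rule integral_dominated_convergence[where w = "\<lambda>_. 1"])
      (auto intro!: tendsto_intros lim simp: dom)
  moreover have "(\<lambda>k. \<integral>x. g x * R x * \<phi> k (h x) \<partial>N) \<longlonglongrightarrow> (\<integral>x. g x * R x * indicator {c<..} (h x) \<partial>N)"
    by (rule integral_dominated_convergence[where w = "\<lambda>_. 1"])
      (auto intro!: tendsto_intros lim simp: dom)
  moreover have "(\<integral>x. g x * R x * \<phi> k (h x) \<partial>M) = (\<integral>x. g x * R x * \<phi> k (h x) \<partial>N)" for k
    by (rule cont) (auto simp: \<phi>_def intro!: continuous_intros)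
  ultimately have "(\<integral>x. g x * R x * indicator {c<..} (h x) \<partial>M) =
      (\<integral>x. g x * R x * indicator {c<..} (h x) \<partial>N)"
    by (simp add: LIMSEQ_unique)
  then show ?thesis by (simp add: mult_ac)
qed

text \<open>A multiplicative class of functions with values in \<open>[0,1]\<close> determines a probability measure
  on the \<open>\<sigma>\<close>-algebra that the class generates.\<close>

lemma multiplicative_class_emeasure_eq:
  fixes H :: "('a \<Rightarrow> real) set"
  assumes M: "prob_space M" and N: "prob_space N" and sets_eq: "sets M = sets N"
    and meas: "\<And>h. h \<in> H \<Longrightarrow> h \<in> borel_measurable M"
    and bnd: "\<And>h x. h \<in> H \<Longrightarrow> 0 \<le> h x \<and> h x \<le> 1"
    and mult: "\<And>g h. g \<in> H \<Longrightarrow> h \<in> H \<Longrightarrow> (\<lambda>x. g x * h x) \<in> H"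
    and one: "(\<lambda>_. 1) \<in> H"
    and eq: "\<And>h. h \<in> H \<Longrightarrow> (\<integral>x. h x \<partial>M) = (\<integral>x. h x \<partial>N)"
    and B: "B \<in> sigma_sets (space M) {{x \<in> space M. c < h x} | h c. h \<in> H}"
  shows "emeasure M B = emeasure N B"
proof -
  interpret M: prob_space M by fact
  interpret N: prob_space N by fact
  have space_eq: "space M = space N" using sets_eq by (rule sets_eq_imp_space_eq)
  define R where "R hs x = (\<Prod>p\<leftarrow>hs. indicator {snd p<..} (fst p x) :: real)"
    for hs :: "(('a \<Rightarrow> real) \<times> real) list" and x
  have R_Cons: "R (p # hs) x = indicator {snd p<..} (fst p x) * R hs x" for p hs x
    by (simp add: R_def)
  have R_bnd: "0 \<le> R hs x \<and> R hs x \<le> 1" for hs x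
    by (induction hs) (auto simp: R_def indicator_def)
  have R_meas: "R hs \<in> borel_measurable M" if "fst ` set hs \<subseteq> H" for hs
    using that
  proof (induction hs)
    case (Cons p hs)
    then have [measurable]: "R hs \<in> borel_measurable M" "fst p \<in> borel_measurable M"
      using meas by auto
    show ?case unfolding R_Cons[abs_def] by measurable
  qed (simp add: R_def[abs_def])
  have key: "(\<integral>x. g x * R hs x \<partial>M) = (\<integral>x. g x * R hs x \<partial>N)"
    if "fst ` set hs \<subseteq> H" "g \<in> H" for hs g
    using that
  proof (induction hs arbitrary: g)
    case Nil
    then show ?case using eq by (simp add: R_def)
  next
    case (Cons p hs)
    then show ?case
      unfolding R_Cons
      by (intro multiplicative_class_step[where H = H] M N sets_eq meas bnd mult R_meas R_bnd) auto
  qed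
  define P where "P = {{x \<in> space M. \<forall>p\<in>set hs. snd p < fst p x} | hs. fst ` set hs \<subseteq> H}"
  have "sigma_sets (space M) {{x \<in> space M. c < h x} | h c. h \<in> H} \<subseteq> sigma_sets (space M) P"
  proof (rule sigma_sets_mono')
    show "{{x \<in> space M. c < h x} | h c. h \<in> H} \<subseteq> P"
    proof safe
      fix h c assume "h \<in> H"
      then show "{x \<in> space M. c < h x} \<in> P"
        unfolding P_def by (intro CollectI exI[of _ "[(h, c)]"]) auto
    qed
  qed
  with B have B: "B \<in> sigma_sets (space M) P" by auto
  have P_sets: "X \<in> sets M" if "X \<in> P" for X
  proof -
    from that obtain hs where hs: "X = {x \<in> space M. \<forall>p\<in>set hs. snd p < fst p x}" "fst ` set hs \<subseteq> H"
      by (auto simp: P_def)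
    have "{x \<in> space M. \<forall>p\<in>set hs. snd p < fst p x} \<in> sets M"
    proof (rule sets.sets_Collect_finite_All)
      fix p assume "p \<in> set hs"
      then have [measurable]: "fst p \<in> borel_measurable M" using hs(2) meas by auto
      show "{x \<in> space M. snd p < fst p x} \<in> sets M" by measurable
    qed simp
    then show ?thesis by (simp add: hs)
  qed
  have sets: "X \<in> sets M" if "X \<in> sigma_sets (space M) P" for X
    using that P_sets sets.sigma_sets_subset[of P M] by auto
  have "Int_stable P"
  proof (rule Int_stableI)
    fix X Y assume "X \<in> P" "Y \<in> P"
    then obtain hs ks where "X = {x \<in> space M. \<forall>p\<in>set hs. snd p < fst p x}" "fst ` set hs \<subseteq> H"
      "Y = {x \<in> space M. \<forall>p\<in>set ks. snd p < fst p x}" "fst ` set ks \<subseteq> H"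
      by (auto simp: P_def)
    then show "X \<inter> Y \<in> P"
      unfolding P_def by (intro CollectI exI[of _ "hs @ ks"]) auto
  qed
  moreover have "P \<subseteq> Pow (space M)" by (auto simp: P_def)
  ultimately show ?thesis using B
  proof (induction rule: sigma_sets_induct_disjoint)
    case (basic X)
    then obtain hs where hs: "X = {x \<in> space M. \<forall>p\<in>set hs. snd p < fst p x}" "fst ` set hs \<subseteq> H"
      by (auto simp: P_def)
    have ind: "R hs x = indicator X x" if "x \<in> space M" for x
    proof -
      have "R hs x = indicator {x. \<forall>p\<in>set hs. snd p < fst p x} x"
        by (induction hs) (auto simp: R_def indicator_def)
      then show ?thesis using that by (simp add: hs indicator_def)
    qed
    have "measure M X = (\<integral>x. 1 * R hs x \<partial>M)"
      using P_sets[OF basic] by (subst Bochner_Integration.integral_cong[OF refl, of M _ "indicator X"])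
        (auto simp: ind sets.Int_space_eq2)
    also have "\<dots> = (\<integral>x. 1 * R hs x \<partial>N)"
      by (rule key[OF hs(2) one])
    also have "\<dots> = measure N X"
      using P_sets[OF basic] by (subst Bochner_Integration.integral_cong[OF refl, of N _ "indicator X"])
        (auto simp: ind sets.Int_space_eq2 space_eq sets_eq)
    finally show ?case by (simp add: M.emeasure_eq_measure N.emeasure_eq_measure)
  next
    case (compl A)
    then show ?case
      using sets[of A] emeasure_compl[of A M] emeasure_compl[of A N]
      by (simp add: sets_eq M.emeasure_space_1 N.emeasure_space_1 space_eq[symmetric]
          N.emeasure_space_1[folded space_eq])
  next
    case (union A)
    then show ?case
      using sets by (subst (1 2) suminf_emeasure[symmetric]) (auto simp: sets_eq)
  qed simp
qed

text \<open>The Laplace functional on functions vanishing near \<open>0\<close> determines the law of a random measure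
  on \<open>(0,\<infinity>)\<close>.\<close>

lemma laplace_functional_unique:
  assumes M: "prob_space M" and N: "prob_space N"
    and sM [measurable_cong]: "sets M = sets (measure_algebra borel)"
    and sN [measurable_cong]: "sets N = sets (measure_algebra borel)"
    and M0: "AE m in M. emeasure m {..0::real} = 0" and N0: "AE m in N. emeasure m {..0::real} = 0"
    and eq: "\<And>f \<epsilon>. f \<in> borel_measurable borel \<Longrightarrow> 0 < \<epsilon> \<Longrightarrow> (\<And>x. x \<le> \<epsilon> \<Longrightarrow> f x = 0) \<Longrightarrow>
      (\<integral>m. nexp (\<integral>\<^sup>+x. f x \<partial>m) \<partial>M) = (\<integral>m. nexp (\<integral>\<^sup>+x. f x \<partial>m) \<partial>N)"
  shows "M = N"
proof (rule measure_eqI)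
  fix X assume XM: "X \<in> sets M"
  then have X [measurable]: "X \<in> sets (measure_algebra borel)" by (simp add: sM)
  interpret M: prob_space M by fact
  interpret N: prob_space N by fact
  have spM: "space M = {m. sets m = sets (borel :: real measure)}"
    using sM sets_eq_imp_space_eq[OF sM] by (simp add: space_measure_algebra)
  have spN: "space N = {m. sets m = sets (borel :: real measure)}"
    using sN sets_eq_imp_space_eq[OF sN] by (simp add: space_measure_algebra)
  \<comment> \<open>The value \<open>1\<close> off the space of Borel measures keeps the class closed under products.\<close>
  define H where "H = {\<lambda>m. if m \<in> space M then nexp (\<integral>\<^sup>+x. f x \<partial>m) else 1 | f.
    f \<in> borel_measurable borel \<and> (\<exists>\<epsilon>>0. \<forall>x\<le>\<epsilon>::real. f x = 0)}"
  define \<Sigma> where "\<Sigma> = sigma (space M) {{x \<in> space M. c < h x} | h c. h \<in> H}"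
  have H_meas: "h \<in> borel_measurable M" if "h \<in> H" for h
  proof -
    from that obtain f where h: "h = (\<lambda>m. if m \<in> space M then nexp (\<integral>\<^sup>+x. f x \<partial>m) else 1)"
      and [measurable]: "f \<in> borel_measurable borel"
      by (auto simp: H_def)
    have "(\<lambda>m. nexp (\<integral>\<^sup>+x. f x \<partial>m)) \<in> borel_measurable M" by measurable
    then show ?thesis unfolding h by (simp cong: measurable_cong)
  qed
  have h_\<Sigma>: "h \<in> borel_measurable \<Sigma>" if "h \<in> H" for h
    using that unfolding \<Sigma>_def
    by (subst borel_measurable_iff_greater) (auto simp: space_measure_of_conv intro!: in_measure_of)
  \<comment> \<open>The restriction \<open>r m\<close> of \<open>m\<close> to \<open>(0,\<infinity>)\<close> is measurable for the \<open>\<sigma>\<close>-algebra that \<open>H\<close> generates, and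
    almost surely it is \<open>m\<close> itself.\<close>
  define r where "r m = density m (indicator {0::real<..})" for m
  have em_r: "emeasure (r m) A = emeasure m (A \<inter> {0<..})" if "m \<in> space M" "A \<in> sets borel" for m A
  proof -
    have [measurable_cong]: "sets m = sets borel" using that spM by simp
    have [measurable]: "A \<in> sets m" using that by simp
    have "emeasure (r m) A = (\<integral>\<^sup>+x. indicator {0<..} x * indicator A x \<partial>m)"
      unfolding r_def by (rule emeasure_density) measurable
    also have "\<dots> = (\<integral>\<^sup>+x. indicator (A \<inter> {0<..}) x \<partial>m)"
      by (intro nn_integral_cong) (auto split: split_indicator)
    also have "\<dots> = emeasure m (A \<inter> {0<..})"
      by (rule nn_integral_indicator) measurable
    finally show ?thesis .
  qed
  have [measurable]: "r \<in> \<Sigma> \<rightarrow>\<^sub>M measure_algebra borel"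
  proof (rule measurable_measure_algebra)
    fix m assume "m \<in> space \<Sigma>"
    then show "sets (r m) = sets borel"
      by (simp add: \<Sigma>_def space_measure_of_conv spM r_def)
  next
    fix A :: "real set" assume A: "A \<in> sets borel"
    have m: "(\<lambda>m. emeasure m (A \<inter> {1 / real (Suc k)<..})) \<in> borel_measurable \<Sigma>" for k
    proof -
      let ?A = "A \<inter> {1 / real (Suc k)<..}"
      have "(\<lambda>m. if m \<in> space M then nexp (\<integral>\<^sup>+x. indicator ?A x \<partial>m) else 1) \<in> H"
        unfolding H_def using A
        by (intro CollectI exI[of _ "indicator ?A"] conjI exI[of _ "1 / real (Suc k)"] refl) auto
      then have "(\<lambda>m. if m \<in> space M then nexp (\<integral>\<^sup>+x. indicator ?A x \<partial>m) else 1)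
          \<in> borel_measurable \<Sigma>" (is "?h \<in> _")
        by (rule h_\<Sigma>)
      moreover have "?h \<in> borel_measurable \<Sigma> \<longleftrightarrow>
          (\<lambda>m. nexp (\<integral>\<^sup>+x. indicator ?A x \<partial>m)) \<in> borel_measurable \<Sigma>"
        by (rule measurable_cong) (simp add: \<Sigma>_def space_measure_of_conv)
      ultimately have [measurable]:
        "(\<lambda>m. nexp (\<integral>\<^sup>+x. indicator ?A x \<partial>m)) \<in> borel_measurable \<Sigma>"
        by (rule iffD1[rotated])
      have "(\<lambda>m. if nexp (\<integral>\<^sup>+x. indicator ?A x \<partial>m) = 0 then \<top>
          else ennreal (- ln (nexp (\<integral>\<^sup>+x. indicator ?A x \<partial>m)))) \<in> borel_measurable \<Sigma>"
        by measurable
      moreover have "(\<lambda>m. \<integral>\<^sup>+x. indicator ?A x \<partial>m) =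
          (\<lambda>m. if nexp (\<integral>\<^sup>+x. indicator ?A x \<partial>m) = 0 then \<top>
            else ennreal (- ln (nexp (\<integral>\<^sup>+x. indicator ?A x \<partial>m))))"
        by (rule ext) (rule nexp_inverse)
      ultimately have "(\<lambda>m. \<integral>\<^sup>+x. indicator ?A x \<partial>m) \<in> borel_measurable \<Sigma>"
        by (simp only:)
      then show ?thesis
        using A by (subst measurable_cong[where g = "\<lambda>m. \<integral>\<^sup>+x. indicator ?A x \<partial>m"])
          (auto simp: \<Sigma>_def space_measure_of_conv spM)
    qed
    have "(\<lambda>m. SUP k. emeasure m (A \<inter> {1 / real (Suc k)<..})) \<in> borel_measurable \<Sigma>"
      by (intro borel_measurable_SUP m) auto
    moreover have "emeasure (r m) A = (SUP k. emeasure m (A \<inter> {1 / real (Suc k)<..}))"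
      if m: "m \<in> space \<Sigma>" for m
    proof -
      have m': "m \<in> space M" using m by (simp add: \<Sigma>_def space_measure_of_conv)
      have "incseq (\<lambda>k. A \<inter> {1 / real (Suc k)<..})"
        by (intro incseq_SucI Int_mono order_refl) (simp add: frac_le)
      then have "(SUP k. emeasure m (A \<inter> {1 / real (Suc k)<..})) =
          emeasure m (\<Union>k. A \<inter> {1 / real (Suc k)<..})"
        using m' A spM by (intro SUP_emeasure_incseq) auto
      also have "(\<Union>k. A \<inter> {1 / real (Suc k)<..}) = A \<inter> {0<..}"
      proof safe
        fix k x assume "1 / real (Suc k) < x"
        then show "0 < x" by (meson less_trans of_nat_0_less_iff zero_less_Suc zero_less_divide_1_iff)
      next
        fix x :: real assume "0 < x" "x \<in> A"
        then obtain k where "inverse (real (Suc k)) < x" using reals_Archimedean by blast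
        with \<open>x \<in> A\<close> show "x \<in> (\<Union>k. A \<inter> {1 / real (Suc k)<..})"
          by (auto simp: inverse_eq_divide)
      qed
      finally show ?thesis using em_r[OF m' A] by simp
    qed
    ultimately show "(\<lambda>m. emeasure (r m) A) \<in> borel_measurable \<Sigma>"
      by (simp cong: measurable_cong)
  qed
  have r_id: "r m = m" if m: "m \<in> space M" and "emeasure m {..0} = 0" for m
  proof (rule measure_eqI)
    show "sets (r m) = sets m" by (simp add: r_def)
    fix A assume "A \<in> sets (r m)"
    then have A: "A \<in> sets borel" using m spM by (simp add: r_def)
    have s: "sets m = sets borel" using m spM by simp
    have "AE x in m. \<not> x \<in> {..0}"
      using that s by (subst AE_iff_measurable[of "{..0}"]) (auto simp: sets_eq_imp_space_eq[OF s])
    then have "emeasure m A = emeasure m (A \<inter> {0<..})"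
      using A s by (intro emeasure_eq_AE) auto
    then show "emeasure (r m) A = emeasure m A" using em_r[OF m A] by simp
  qed
  define B where "B = r -` X \<inter> space M"
  have "B \<in> sets \<Sigma>"
    using measurable_sets[OF \<open>r \<in> \<Sigma> \<rightarrow>\<^sub>M measure_algebra borel\<close> X]
    by (simp add: B_def \<Sigma>_def space_measure_of_conv)
  then have B\<Sigma>: "B \<in> sigma_sets (space M) {{x \<in> space M. c < h x} | h c. h \<in> H}"
    unfolding \<Sigma>_def by (subst (asm) sets_measure_of) auto
  have "sigma_sets (space M) {{x \<in> space M. c < h x} | h c. h \<in> H} \<subseteq> sets M"
    using H_meas by (intro sets.sigma_sets_subset) auto
  with B\<Sigma> have B_sets: "B \<in> sets M" by auto
  have "emeasure M X = emeasure M B"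
    using M0 by (intro emeasure_eq_AE XM B_sets) (auto simp: B_def r_id)
  also have "\<dots> = emeasure N B"
  proof (rule multiplicative_class_emeasure_eq[OF M N _ H_meas _ _ _ _ B\<Sigma>])
    show "sets M = sets N" by (simp add: sM sN)
    show "0 \<le> h x \<and> h x \<le> 1" if "h \<in> H" for h x
      using that by (auto simp: H_def)
    show "(\<lambda>_. 1) \<in> H"
      unfolding H_def by (intro CollectI exI[of _ "\<lambda>_. 0"]) (auto intro: exI[of _ 1])
    show "(\<integral>x. h x \<partial>M) = (\<integral>x. h x \<partial>N)" if "h \<in> H" for h
    proof -
      from that obtain f \<epsilon> where h: "h = (\<lambda>m. if m \<in> space M then nexp (\<integral>\<^sup>+x. f x \<partial>m) else 1)"
        and f: "f \<in> borel_measurable borel" "0 < \<epsilon>" "\<And>x. x \<le> \<epsilon> \<Longrightarrow> f x = 0"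
        by (auto simp: H_def)
      have "space N = space M" by (simp add: spM spN)
      then have "(\<integral>m. nexp (\<integral>\<^sup>+x. f x \<partial>m) \<partial>N) = (\<integral>m. h m \<partial>N)"
        by (intro Bochner_Integration.integral_cong) (auto simp: h)
      moreover have "(\<integral>m. nexp (\<integral>\<^sup>+x. f x \<partial>m) \<partial>M) = (\<integral>m. h m \<partial>M)"
        by (intro Bochner_Integration.integral_cong) (auto simp: h)
      ultimately show ?thesis using eq[OF f] by simp
    qed
  next
    show "(\<lambda>x. g x * h x) \<in> H" if "g \<in> H" "h \<in> H" for g h
    proof -
      from that(1) obtain f \<epsilon> where g: "g = (\<lambda>m. if m \<in> space M then nexp (\<integral>\<^sup>+x. f x \<partial>m) else 1)"
        and f [measurable]: "f \<in> borel_measurable borel" and \<epsilon>: "0 < \<epsilon>" "\<And>x. x \<le> \<epsilon> \<Longrightarrow> f x = 0"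
        by (auto simp: H_def)
      from that(2) obtain f' \<epsilon>' where h: "h = (\<lambda>m. if m \<in> space M then nexp (\<integral>\<^sup>+x. f' x \<partial>m) else 1)"
        and f' [measurable]: "f' \<in> borel_measurable borel"
        and \<epsilon>': "0 < \<epsilon>'" "\<And>x. x \<le> \<epsilon>' \<Longrightarrow> f' x = 0"
        by (auto simp: H_def)
      have "g m * h m = (if m \<in> space M then nexp (\<integral>\<^sup>+x. f x + f' x \<partial>m) else 1)" for m
      proof (cases "m \<in> space M")
        case True
        then have [measurable_cong]: "sets m = sets borel" by (simp add: spM)
        have "(\<integral>\<^sup>+x. f x + f' x \<partial>m) = (\<integral>\<^sup>+x. f x \<partial>m) + (\<integral>\<^sup>+x. f' x \<partial>m)"
          by (rule nn_integral_add) measurable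
        then show ?thesis using True by (simp add: g h nexp_add)
      qed (simp add: g h)
      then have "(\<lambda>m. g m * h m) = (\<lambda>m. if m \<in> space M then nexp (\<integral>\<^sup>+x. f x + f' x \<partial>m) else 1)"
        by blast
      then show ?thesis
        unfolding H_def using \<epsilon> \<epsilon>'
        by (intro CollectI exI[of _ "\<lambda>x. f x + f' x"] conjI exI[of _ "min \<epsilon> \<epsilon>'"]) auto
    qed
  qed auto
  also have "emeasure N B = emeasure N X"
    using N0 B_sets XM by (intro emeasure_eq_AE) (auto simp: B_def r_id spM spN sM sN)
  finally show "emeasure M X = emeasure N X" .
qed (simp add: sM sN)

section \<open>Point measures\<close>

lemma sets_point_measure [simp, measurable_cong]: "sets (point_measure S I x) = sets S"
  by (simp add: point_measure_def)

lemma nn_integral_point_measure: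
  fixes I :: "nat set"
  assumes "f \<in> borel_measurable S" "x ` I \<subseteq> space S"
  shows "(\<integral>\<^sup>+y. f y \<partial>point_measure S I x) = (\<Sum>i. if i \<in> I then f (x i) else 0)"
proof -
  have "(\<integral>\<^sup>+y. f y \<partial>point_measure S I x) = (\<integral>\<^sup>+i. f (x i) \<partial>count_space I)"
    unfolding point_measure_def using assms by (subst nn_integral_distr) auto
  also have "\<dots> = (\<integral>\<^sup>+i. f (x i) * indicator I i \<partial>count_space UNIV)"
    by (rule nn_integral_count_space_indicator) simp
  also have "\<dots> = (\<Sum>i. f (x i) * indicator I i)"
    by (rule nn_integral_count_space_nat)
  also have "\<dots> = (\<Sum>i. if i \<in> I then f (x i) else 0)"
    by (intro suminf_cong) (auto simp: indicator_def)
  finally show ?thesis .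
qed

lemma emeasure_point_measure:
  fixes I :: "nat set"
  assumes "A \<in> sets S" "x ` I \<subseteq> space S"
  shows "emeasure (point_measure S I x) A = (\<Sum>i. if i \<in> I then indicator A (x i) else 0)"
proof -
  have "emeasure (point_measure S I x) A = (\<integral>\<^sup>+y. indicator A y \<partial>point_measure S I x)"
    using assms by simp
  also have "\<dots> = (\<Sum>i. if i \<in> I then indicator A (x i) else 0)"
    using assms by (intro nn_integral_point_measure) auto
  finally show ?thesis .
qed

lemma measurable_point_measure:
  fixes I :: "'a \<Rightarrow> nat set"
  assumes [measurable]: "\<And>i. x i \<in> M \<rightarrow>\<^sub>M S" "\<And>i. Measurable.pred M (\<lambda>\<omega>. i \<in> I \<omega>)"
  shows "(\<lambda>\<omega>. point_measure S (I \<omega>) (\<lambda>i. x i \<omega>)) \<in> M \<rightarrow>\<^sub>M measure_algebra S"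
proof (rule measurable_measure_algebra)
  fix A assume [measurable]: "A \<in> sets S"
  have "(\<lambda>\<omega>. \<Sum>i. if i \<in> I \<omega> then indicator A (x i \<omega>) else 0 :: ennreal) \<in> borel_measurable M"
    by measurable
  moreover have "emeasure (point_measure S (I \<omega>) (\<lambda>i. x i \<omega>)) A =
      (\<Sum>i. if i \<in> I \<omega> then indicator A (x i \<omega>) else 0)" if "\<omega> \<in> space M" for \<omega>
    using that by (intro emeasure_point_measure) (auto dest: measurable_space[OF assms(1)])
  ultimately show "(\<lambda>\<omega>. emeasure (point_measure S (I \<omega>) (\<lambda>i. x i \<omega>)) A) \<in> borel_measurable M"
    by (simp cong: measurable_cong)
qed simp

text \<open>The points of the perpetuity are indexed from \<open>1\<close>; this shifts the index.\<close>

lemma point_measure_shift: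
  "point_measure borel {1..} v = point_measure borel UNIV (\<lambda>n. v (Suc n) :: real)"
proof -
  have bij: "bij_betw Suc UNIV {1..}"
    by (auto simp: bij_betw_def image_iff) (metis Suc_le_D One_nat_def)
  have "point_measure borel {1..} v = distr (distr (count_space UNIV) (count_space {1..}) Suc) borel v"
    by (simp only: point_measure_def distr_bij_count_space[OF bij])
  also have "\<dots> = distr (count_space UNIV) borel (v \<circ> Suc)"
    by (rule distr_distr) auto
  finally show ?thesis by (simp add: point_measure_def comp_def)
qed

section \<open>Normalisation to total mass one\<close>

text \<open>For the point measure of a sequence of positive masses this is the sum of the masses. The integral
  ignores the part of \<open>m\<close> on \<open>(- \<infinity>, 0)\<close>.\<close>

definition first_moment :: "real measure \<Rightarrow> ennreal" where
  "first_moment m = (\<integral>\<^sup>+x. ennreal x \<partial>m)"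

text \<open>If \<open>m\<close> is the point measure of a sequence of positive masses, then \<open>normalise m\<close> is the point measure
  of the masses divided by their sum, provided that this sum is finite and not \<open>0\<close>. The value in the other
  cases is irrelevant.\<close>

definition normalisable :: "real measure \<Rightarrow> bool" where
  "normalisable m \<longleftrightarrow> first_moment m \<noteq> 0 \<and> first_moment m \<noteq> \<top> \<and> emeasure m {..0} = 0"

definition normalise :: "real measure \<Rightarrow> real measure" where
  "normalise m = (if normalisable m then distr m borel (\<lambda>x. x / enn2real (first_moment m))
     else null_measure borel)"

lemma first_moment_measurable [measurable]:
  "first_moment \<in> borel_measurable (measure_algebra borel)"
  unfolding first_moment_def[abs_def] by measurable

lemma normalisable_measurable [measurable]:
  "Measurable.pred (measure_algebra borel) normalisable"
  unfolding normalisable_def[abs_def] by measurable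

text \<open>The half-line may depend on the measure: it is exhausted by half-lines with rational end points, so
  that no finiteness of the measure is needed.\<close>

lemma measurable_emeasure_greaterThan:
  fixes r :: "real measure \<Rightarrow> real"
  assumes [measurable]: "r \<in> borel_measurable (measure_algebra borel)"
  shows "(\<lambda>m. emeasure m {r m<..}) \<in> borel_measurable (measure_algebra borel)"
proof -
  have "emeasure m {r m<..} = (SUP q\<in>\<rat>. if r m < q then emeasure m {q<..} else 0)"
    if "m \<in> space (measure_algebra borel)" for m
  proof (rule antisym)
    have s: "sets m = sets borel" using that by (simp add: space_measure_algebra)
    have inc: "incseq (\<lambda>n. {r m + 1 / real (Suc n)<..})"
      by (intro incseq_SucI) (simp add: frac_le)
    have "(SUP n. emeasure m {r m + 1 / real (Suc n)<..}) =
        emeasure m (\<Union>n. {r m + 1 / real (Suc n)<..})"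
      by (rule SUP_emeasure_incseq[OF _ inc]) (auto simp: s)
    also have "(\<Union>n. {r m + 1 / real (Suc n)<..}) = {r m<..}"
    proof safe
      fix n x assume "r m + 1 / real (Suc n) < x"
      moreover have "0 < 1 / real (Suc n)" by simp
      ultimately show "r m < x" by linarith
    next
      fix x assume "r m < x"
      then obtain n where "inverse (real (Suc n)) < x - r m" using reals_Archimedean[of "x - r m"] by auto
      then show "x \<in> (\<Union>n. {r m + 1 / real (Suc n)<..})" by (auto simp: inverse_eq_divide field_simps)
    qed
    finally have eq: "emeasure m {r m<..} = (SUP n. emeasure m {r m + 1 / real (Suc n)<..})" by simp
    show "emeasure m {r m<..} \<le> (SUP q\<in>\<rat>. if r m < q then emeasure m {q<..} else 0)"
      unfolding eq
    proof (rule SUP_least)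
      fix n
      have "r m < r m + 1 / real (Suc n)" by simp
      then obtain q where q: "q \<in> \<rat>" "r m < q" "q < r m + 1 / real (Suc n)"
        using Rats_dense_in_real by blast
      have "emeasure m {r m + 1 / real (Suc n)<..} \<le> emeasure m {q<..}"
        using q(3) by (intro emeasure_mono) (simp_all add: s)
      then have "emeasure m {r m + 1 / real (Suc n)<..} \<le> (if r m < q then emeasure m {q<..} else 0)"
        by (simp only: q(2) if_True)
      also have "\<dots> \<le> (SUP q\<in>\<rat>. if r m < q then emeasure m {q<..} else 0)"
        using q(1) by (rule SUP_upper)
      finally show "emeasure m {r m + 1 / real (Suc n)<..} \<le> \<dots>" .
    qed
    show "(SUP q\<in>\<rat>. if r m < q then emeasure m {q<..} else 0) \<le> emeasure m {r m<..}"
    proof (rule SUP_least)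
      fix q
      have "emeasure m {q<..} \<le> emeasure m {r m<..}" if "r m < q"
        using that by (intro emeasure_mono) (simp_all add: s)
      then show "(if r m < q then emeasure m {q<..} else 0) \<le> emeasure m {r m<..}"
        by simp
    qed
  qed
  moreover have "(\<lambda>m. SUP q\<in>\<rat>. if r m < q then emeasure m {q<..} else 0)
      \<in> borel_measurable (measure_algebra borel)"
    by (intro borel_measurable_SUP countable_rat) measurable
  ultimately show ?thesis by (simp cong: measurable_cong)
qed

text \<open>Let \<open>c\<close> be the total mass. A measure that can be normalised is finite on \<open>(c / k, \<infinity>)\<close> by Markov's
  inequality. Hence for fixed \<open>k\<close> the sets \<open>A\<close> for which \<open>m \<mapsto> m {x. x / c \<in> A, x / c > 1 / k}\<close> is
  measurable form a Dynkin system, which contains the half-lines; the limit \<open>k \<rightarrow> \<infinity>\<close> removes the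
  truncation.\<close>

lemma normalise_measurable [measurable]:
  "normalise \<in> measure_algebra borel \<rightarrow>\<^sub>M measure_algebra borel"
proof (rule measurable_measure_algebra)
  fix A :: "real set" assume A: "A \<in> sets borel"
  define c where "c m = enn2real (first_moment m)" for m
  have [measurable]: "c \<in> borel_measurable (measure_algebra borel)"
    unfolding c_def[abs_def] by measurable
  define E where "E k A m = (if normalisable m then emeasure m {x. x / c m \<in> A \<and> 1 / real (Suc k) < x / c m} else 0)"
    for k A m
  have c_pos: "0 < c m" if "normalisable m" for m
    using that by (auto simp: normalisable_def c_def enn2real_positive_iff less_top zero_less_iff_neq_zero)
  have set_meas: "{x. x / c m \<in> A \<and> a < x / c m} \<in> sets borel" if "A \<in> sets borel" for A a m
    using that by measurable
  have finite: "emeasure m {x. 1 / real (Suc k) < x / c m} < \<top>" 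
    if m: "sets m = sets borel" "normalisable m" for m k
  proof -
    have [measurable_cong]: "sets m = sets borel" by fact
    let ?a = "real (Suc k) / c m"
    have "{x. 1 / real (Suc k) < x / c m} \<subseteq> {x \<in> UNIV. 1 \<le> ennreal ?a * ennreal x}"
    proof (intro subsetI CollectI conjI UNIV_I)
      fix x assume "x \<in> {x. 1 / real (Suc k) < x / c m}"
      then have "1 \<le> ?a * x" using c_pos[OF m(2)] by (simp add: field_simps)
      moreover have "0 < ?a" using c_pos[OF m(2)] by simp
      ultimately show "1 \<le> ennreal ?a * ennreal x"
        by (simp only: ennreal_mult'[symmetric] less_imp_le) simp
    qed
    then have "emeasure m {x. 1 / real (Suc k) < x / c m} \<le> emeasure m ({x \<in> UNIV. 1 \<le> ennreal ?a * ennreal x} \<inter> space m)"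
      by (intro emeasure_mono) (auto simp: sets_eq_imp_space_eq[OF m(1)])
    also have "\<dots> \<le> ennreal ?a * (\<integral>\<^sup>+x. ennreal x * indicator (space m) x \<partial>m)"
      using nn_integral_Markov_inequality[where u = "\<lambda>x. ennreal x" and M = m and A = "space m" and c = "ennreal ?a"]
      by (simp add: sets_eq_imp_space_eq[OF m(1)])
    also have "\<dots> = ennreal ?a * first_moment m"
      by (auto simp: first_moment_def sets_eq_imp_space_eq[OF m(1)])
    also have "\<dots> < \<top>"
      using m(2) by (auto simp: normalisable_def less_top[symmetric] ennreal_mult_eq_top_iff)
    finally show ?thesis .
  qed
  have E_meas: "E k A \<in> borel_measurable (measure_algebra borel)" for k
  proof -
    have Int_stable: "Int_stable (range (greaterThan :: real \<Rightarrow> real set))"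
      by (rule Int_stableI) (auto simp: Int_def greaterThan_def simp flip: max_less_iff_conj)
    have sets_eq: "sets (borel :: real measure) = sigma_sets UNIV (range greaterThan)"
      by (subst borel_Ioi) (simp add: sets_measure_of)
    have A': "A \<in> sigma_sets UNIV (range greaterThan)"
      using A by (simp only: sets_eq)
    have "range (greaterThan :: real \<Rightarrow> real set) \<subseteq> Pow UNIV" by simp
    from Int_stable this show ?thesis using A'
    proof (induction rule: sigma_sets_induct_disjoint)
      case (basic A)
      then obtain a where a: "A = {a<..}" by auto
      have "emeasure m {x. x / c m \<in> A \<and> 1 / real (Suc k) < x / c m} =
          emeasure m {c m * max a (1 / real (Suc k))<..}" if "normalisable m" for m
      proof -
        have "x / c m \<in> A \<and> 1 / real (Suc k) < x / c m \<longleftrightarrow> max a (1 / real (Suc k)) < x / c m" for x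
          by (simp only: a max_less_iff_conj greaterThan_iff)
        then show ?thesis
          by (simp only: pos_less_divide_eq[OF c_pos[OF that]] mult.commute greaterThan_def)
      qed
      then have "E k A = (\<lambda>m. if normalisable m then emeasure m {c m * max a (1 / real (Suc k))<..} else 0)"
        by (auto simp: E_def fun_eq_iff)
      moreover have "\<dots> \<in> borel_measurable (measure_algebra borel)"
        using measurable_emeasure_greaterThan[of "\<lambda>m. c m * max a (1 / real (Suc k))"] by measurable
      ultimately show ?case by simp
    next
      case empty
      have "E k {} = (\<lambda>_. 0)" by (simp add: E_def fun_eq_iff)
      then show ?case by simp
    next
      case (compl A)
      then have [measurable]: "E k A \<in> borel_measurable (measure_algebra borel)" and
        A: "A \<in> sets borel"
        by (simp_all only: sets_eq)
      have "E k (UNIV - A) m =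
          (if normalisable m then emeasure m {c m * (1 / real (Suc k))<..} - E k A m else 0)"
        if "m \<in> space (measure_algebra borel)" for m
      proof (cases "normalisable m")
        case True
        have s: "sets m = sets borel" using that by (simp add: space_measure_algebra)
        have "E k (UNIV - A) m = emeasure m ({x. 1 / real (Suc k) < x / c m} -
            {x. x / c m \<in> A \<and> 1 / real (Suc k) < x / c m})"
          using True by (auto simp: E_def intro!: arg_cong[where f = "emeasure m"])
        also have "\<dots> = emeasure m {x. 1 / real (Suc k) < x / c m} -
            emeasure m {x. x / c m \<in> A \<and> 1 / real (Suc k) < x / c m}"
        proof (rule emeasure_Diff)
          show "emeasure m {x. x / c m \<in> A \<and> 1 / real (Suc k) < x / c m} \<noteq> \<infinity>"
          proof -
            have "emeasure m {x. x / c m \<in> A \<and> 1 / real (Suc k) < x / c m} \<le>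
                emeasure m {x. 1 / real (Suc k) < x / c m}"
              using set_meas[of UNIV] by (intro emeasure_mono) (auto simp: s)
            with finite[OF s True, of k] show ?thesis by auto
          qed
        qed (use set_meas[of UNIV] set_meas[OF A] s in auto)
        also have "{x. 1 / real (Suc k) < x / c m} = {c m * (1 / real (Suc k))<..}"
          by (simp only: pos_less_divide_eq[OF c_pos[OF True]] mult.commute greaterThan_def)
        finally show ?thesis using True by (simp add: E_def)
      qed (simp add: E_def)
      moreover have "(\<lambda>m. if normalisable m then emeasure m {c m * (1 / real (Suc k))<..} - E k A m else 0)
          \<in> borel_measurable (measure_algebra borel)"
        using measurable_emeasure_greaterThan[of "\<lambda>m. c m * (1 / real (Suc k))"] by measurable
      ultimately show ?case by (simp cong: measurable_cong)
    next
      case (union A)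
      then have [measurable]: "E k (A i) \<in> borel_measurable (measure_algebra borel)" for i by simp
      have A: "A i \<in> sets borel" for i
        using union(2) by (simp add: sets_eq image_subset_iff)
      have "E k (\<Union>i. A i) m = (\<Sum>i. E k (A i) m)"
        if "m \<in> space (measure_algebra borel)" for m
      proof (cases "normalisable m")
        case True
        have s: "sets m = sets borel" using that by (simp add: space_measure_algebra)
        have "(\<Sum>i. emeasure m {x. x / c m \<in> A i \<and> 1 / real (Suc k) < x / c m}) =
           emeasure m (\<Union>i. {x. x / c m \<in> A i \<and> 1 / real (Suc k) < x / c m})"
          using union(1) set_meas[OF A] s
          by (intro suminf_emeasure) (auto simp: disjoint_family_on_def)
        also have "(\<Union>i. {x. x / c m \<in> A i \<and> 1 / real (Suc k) < x / c m}) =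
            {x. x / c m \<in> (\<Union>i. A i) \<and> 1 / real (Suc k) < x / c m}" by auto
        finally show ?thesis using True by (simp add: E_def)
      qed (simp add: E_def)
      then show ?case by (simp cong: measurable_cong)
    qed
  qed
  have "emeasure (normalise m) A = (SUP k. E k A m)" if "m \<in> space (measure_algebra borel)" for m
  proof (cases "normalisable m")
    case True
    have s [measurable_cong]: "sets m = sets borel" using that by (simp add: space_measure_algebra)
    have [measurable]: "A \<in> sets borel" by fact
    let ?B = "\<lambda>k. {x. x / c m \<in> A \<and> 1 / real (Suc k) < x / c m}"
    have pos: "AE x in m. 0 < x"
      using True s by (subst AE_iff_measurable[of "{..0}"])
        (auto simp: sets_eq_imp_space_eq[OF s] normalisable_def)
    have "emeasure (normalise m) A = emeasure m ((\<lambda>x. x / c m) -` A \<inter> space m)"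
      using True by (simp add: normalise_def c_def emeasure_distr)
    also have "\<dots> = emeasure m (\<Union>k. ?B k)"
    proof (rule emeasure_eq_AE)
      show "AE x in m. (x \<in> (\<lambda>x. x / c m) -` A \<inter> space m) = (x \<in> (\<Union>k. ?B k))"
        using pos
      proof eventually_elim
        case (elim x)
        then obtain k where "inverse (real (Suc k)) < x / c m"
          using c_pos[OF True] reals_Archimedean[of "x / c m"] by auto
        then show ?case by (auto simp: sets_eq_imp_space_eq[OF s] inverse_eq_divide)
      qed
      show "(\<Union>k. ?B k) \<in> sets m"
        unfolding s by (intro sets.countable_UN' set_meas A) auto
    qed measurable
    also have "\<dots> = (SUP k. emeasure m (?B k))"
    proof (rule SUP_emeasure_incseq[symmetric])
      show "incseq ?B"
      proof (rule incseq_SucI, safe)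
        fix k x assume "1 / real (Suc k) < x / c m"
        moreover have "1 / real (Suc (Suc k)) \<le> 1 / real (Suc k)" by (simp add: frac_le)
        ultimately show "1 / real (Suc (Suc k)) < x / c m" by linarith
      qed
      show "range ?B \<subseteq> sets m"
        unfolding s using set_meas[OF A] by blast
    qed
    finally show ?thesis using True by (simp add: E_def)
  qed (simp add: E_def normalise_def)
  moreover have "(\<lambda>m. SUP k. E k A m) \<in> borel_measurable (measure_algebra borel)"
    using E_meas by (intro borel_measurable_SUP) auto
  ultimately show "(\<lambda>m. emeasure (normalise m) A) \<in> borel_measurable (measure_algebra borel)"
    by (simp cong: measurable_cong)
qed (simp add: normalise_def)

lemma normalise_point_measure:
  fixes I :: "nat set" and v :: "nat \<Rightarrow> real"
  assumes pos: "\<And>i. i \<in> I \<Longrightarrow> 0 < v i" and "I \<noteq> {}"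
    and sum: "summable (\<lambda>i. if i \<in> I then v i else 0)"
  shows "normalise (point_measure borel I v) =
    point_measure borel I (\<lambda>i. v i / (\<Sum>i. if i \<in> I then v i else 0))"
    and "normalisable (point_measure borel I v)"
proof -
  let ?s = "\<Sum>i. if i \<in> I then v i else 0"
  have nn: "0 \<le> (if i \<in> I then v i else 0)" for i using pos[of i] by auto
  obtain j where j: "j \<in> I" using \<open>I \<noteq> {}\<close> by auto
  have "0 < ?s"
    using sum nn j pos[OF j] by (intro suminf_pos2[where i = j]) auto
  have "first_moment (point_measure borel I v) = (\<Sum>i. ennreal (if i \<in> I then v i else 0))"
    unfolding first_moment_def
    by (subst nn_integral_point_measure) (auto intro!: suminf_cong)
  also have "\<dots> = ennreal ?s"
    using nn sum by (rule suminf_ennreal2)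
  finally have fm: "first_moment (point_measure borel I v) = ennreal ?s" .
  have "emeasure (point_measure borel I v) {..0} = (\<Sum>i. if i \<in> I then indicator {..0} (v i) else 0)"
    by (subst emeasure_point_measure) auto
  also have "\<dots> = (\<Sum>i. 0)"
    using pos by (intro suminf_cong) (force simp: indicator_def)
  finally show n: "normalisable (point_measure borel I v)"
    using fm \<open>0 < ?s\<close> by (simp add: normalisable_def)
  show "normalise (point_measure borel I v) = point_measure borel I (\<lambda>i. v i / ?s)"
    using n fm \<open>0 < ?s\<close>
    by (simp add: normalise_def point_measure_def distr_distr o_def)
qed

lemma normalise_point_measure_mult:
  fixes I :: "nat set" and v :: "nat \<Rightarrow> real"
  assumes "\<And>i. i \<in> I \<Longrightarrow> 0 < v i" and "I \<noteq> {}"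
    and sum: "summable (\<lambda>i. if i \<in> I then v i else 0)" and c: "0 < c"
  shows "normalise (point_measure borel I (\<lambda>i. c * v i)) =
    point_measure borel I (\<lambda>i. v i / (\<Sum>i. if i \<in> I then v i else 0))"
proof -
  have eq: "(\<lambda>i. if i \<in> I then c * v i else 0) = (\<lambda>i. c * (if i \<in> I then v i else 0))" by auto
  have "normalise (point_measure borel I (\<lambda>i. c * v i)) =
      point_measure borel I (\<lambda>i. c * v i / (\<Sum>i. if i \<in> I then c * v i else 0))"
    using assms by (intro normalise_point_measure) (auto simp: eq intro: summable_mult)
  then show ?thesis
    unfolding eq suminf_mult[OF sum, of c] using c by simp
qed

section \<open>The Laplace functional of a Poisson process\<close>

lemma poisson_process_prob_space: "poisson_process M \<nu> N \<Longrightarrow> prob_space M"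
  by (simp add: poisson_process_def)

lemma poisson_process_measurable: "poisson_process M \<nu> N \<Longrightarrow> N \<in> M \<rightarrow>\<^sub>M measure_algebra \<nu>"
  by (simp add: poisson_process_def)

lemma poisson_count_laplace:
  assumes N: "poisson_process M \<nu> N" and A: "A \<in> sets \<nu>" "emeasure \<nu> A < \<infinity>" and c: "0 \<le> c"
  shows "(\<integral>\<omega>. nexp (ennreal c * emeasure (N \<omega>) A) \<partial>M) = exp (- measure \<nu> A * (1 - exp (- c)))"
proof -
  interpret prob_space M using N by (rule poisson_process_prob_space)
  note [measurable] = A(1) poisson_process_measurable[OF N]
  define a where "a = measure \<nu> A"
  define D where "D k = {\<omega> \<in> space M. emeasure (N \<omega>) A = of_nat k}" for k
  have [measurable]: "D k \<in> sets M" for k unfolding D_def by measurable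
  have prob_D: "prob (D k) = a ^ k / fact k * exp (- a)" for k
    using N A by (simp add: poisson_process_def D_def a_def)
  have disj: "disjoint_family D" by (auto simp: disjoint_family_on_def D_def)
  have "(\<lambda>k. a ^ k / fact k * exp (- a)) sums (exp a * exp (- a))"
    using exp_converges[of a] by (intro sums_mult2) (simp add: divide_inverse mult.commute)
  then have "(\<lambda>k. prob (D k)) sums 1"
    by (simp add: prob_D exp_minus)
  moreover have "(\<lambda>k. prob (D k)) sums prob (\<Union>k. D k)"
    using disj by (intro finite_measure_UNION) auto
  ultimately have "prob (\<Union>k. D k) = 1"
    by (rule sums_unique2[symmetric])
  then have "AE \<omega> in M. \<omega> \<in> (\<Union>k. D k)"
    by (subst AE_in_set_eq_1) auto
  then have ae: "AE \<omega> in M. ennreal (nexp (ennreal c * emeasure (N \<omega>) A)) =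
      (\<Sum>k. ennreal (exp (- (c * real k))) * indicator (D k) \<omega>)"
  proof eventually_elim
    case (elim \<omega>)
    then obtain j where j: "\<omega> \<in> D j" by auto
    then have "emeasure (N \<omega>) A = ennreal (real j)" by (simp add: D_def ennreal_of_nat_eq_real_of_nat)
    then have 1: "nexp (ennreal c * emeasure (N \<omega>) A) = exp (- (c * real j))"
      using c by (simp add: ennreal_mult[symmetric] nexp_ennreal)
    have "(\<Sum>k. ennreal (exp (- (c * real k))) * indicator (D k) \<omega>) =
        (\<Sum>k\<in>{j}. ennreal (exp (- (c * real k))) * indicator (D k) \<omega>)"
      using j disj by (intro suminf_finite) (auto simp: indicator_def disjoint_family_on_def)
    with 1 j show ?case by simp
  qed
  have s: "(\<lambda>k. exp (- (c * real k)) * prob (D k)) sums (exp (a * exp (- c)) * exp (- a))"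
  proof -
    have "(\<lambda>k. (a * exp (- c)) ^ k / fact k * exp (- a)) sums (exp (a * exp (- c)) * exp (- a))"
      using exp_converges[of "a * exp (- c)"] by (intro sums_mult2) (simp add: divide_inverse mult.commute)
    moreover have "(a * exp (- c)) ^ k / fact k * exp (- a) = exp (- (c * real k)) * prob (D k)" for k
      by (simp add: prob_D power_mult_distrib exp_of_nat_mult[symmetric] mult_ac)
    ultimately show ?thesis by simp
  qed
  have "(\<integral>\<^sup>+\<omega>. ennreal (nexp (ennreal c * emeasure (N \<omega>) A)) \<partial>M) =
      (\<integral>\<^sup>+\<omega>. (\<Sum>k. ennreal (exp (- (c * real k))) * indicator (D k) \<omega>) \<partial>M)"
    using ae by (rule nn_integral_cong_AE)
  also have "\<dots> = (\<Sum>k. ennreal (exp (- (c * real k)) * prob (D k)))"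
    by (subst nn_integral_suminf)
      (auto simp: nn_integral_cmult_indicator emeasure_eq_measure ennreal_mult)
  also have "\<dots> = ennreal (exp (a * exp (- c)) * exp (- a))"
    using s by (intro suminf_ennreal_eq) auto
  finally have "(\<integral>\<omega>. nexp (ennreal c * emeasure (N \<omega>) A) \<partial>M) = exp (a * exp (- c)) * exp (- a)"
    by (subst integral_eq_nn_integral) auto
  then show ?thesis by (simp add: a_def exp_add[symmetric] algebra_simps)
qed

lemma poisson_laplace_step:
  fixes n :: nat
  assumes N: "poisson_process M \<nu> N"
    and A: "\<And>i. i < n \<Longrightarrow> A i \<in> sets \<nu>" "\<And>i. i < n \<Longrightarrow> emeasure \<nu> (A i) < \<infinity>"
    and disj: "disjoint_family_on A {..<n}" and c: "\<And>i. i < n \<Longrightarrow> 0 \<le> c i"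
  shows "(\<integral>\<omega>. nexp (\<Sum>i<n. ennreal (c i) * emeasure (N \<omega>) (A i)) \<partial>M) =
    nexp (\<Sum>i<n. ennreal (1 - exp (- c i)) * emeasure \<nu> (A i))"
proof -
  interpret prob_space M using N by (rule poisson_process_prob_space)
  note [measurable] = poisson_process_measurable[OF N]
  have ind: "indep_vars (\<lambda>_. borel) (\<lambda>i \<omega>. emeasure (N \<omega>) (A i)) {..<n}"
  proof -
    have "\<forall>(n :: nat) A. (\<forall>i<n. A i \<in> sets \<nu>) \<and> disjoint_family_on A {..<n} \<longrightarrow>
        indep_vars (\<lambda>_. borel) (\<lambda>i \<omega>. emeasure (N \<omega>) (A i)) {..<n}"
      using N unfolding poisson_process_def by (elim conjE)
    from this[rule_format, of n A] show ?thesis using A(1) disj by simp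
  qed
  have "indep_vars (\<lambda>_. borel) (\<lambda>i \<omega>. nexp (ennreal (c i) * emeasure (N \<omega>) (A i))) {..<n}"
    using indep_vars_compose2[OF ind, of "\<lambda>i x. nexp (ennreal (c i) * x)" "\<lambda>_. borel"] by simp
  then have "(\<integral>\<omega>. (\<Prod>i<n. nexp (ennreal (c i) * emeasure (N \<omega>) (A i))) \<partial>M) =
      (\<Prod>i<n. (\<integral>\<omega>. nexp (ennreal (c i) * emeasure (N \<omega>) (A i)) \<partial>M))"
    using A by (intro indep_vars_lebesgue_integral) (auto intro!: integrable_const_bound[where B = 1])
  also have "\<dots> = (\<Prod>i<n. nexp (ennreal (1 - exp (- c i)) * emeasure \<nu> (A i)))"
  proof (intro prod.cong refl)
    fix i assume "i \<in> {..<n}"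
    then have i: "i < n" by simp
    have "emeasure \<nu> (A i) = ennreal (measure \<nu> (A i))"
      using A(2)[OF i] by (simp add: emeasure_eq_ennreal_measure less_top)
    then show "(\<integral>\<omega>. nexp (ennreal (c i) * emeasure (N \<omega>) (A i)) \<partial>M) =
        nexp (ennreal (1 - exp (- c i)) * emeasure \<nu> (A i))"
      using c[OF i] poisson_count_laplace[OF N A(1)[OF i] A(2)[OF i] c[OF i]]
      by (simp add: ennreal_mult[symmetric] nexp_ennreal mult.commute)
  qed
  finally show ?thesis by (simp add: nexp_sum)
qed

text \<open>A simple function is a combination, with positive coefficients, of indicators of disjoint sets.\<close>

lemma simple_function_disjoint_rep:
  fixes G :: "'a \<Rightarrow> ennreal"
  assumes G: "simple_function \<nu> G" and fin: "\<And>x. x \<in> space \<nu> \<Longrightarrow> G x < \<top>"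
  obtains n :: nat and c :: "nat \<Rightarrow> real" and A where "\<And>i. i < n \<Longrightarrow> 0 < c i"
    and "\<And>i. i < n \<Longrightarrow> A i \<in> sets \<nu>" and "disjoint_family_on A {..<n}"
    and "\<And>i x. i < n \<Longrightarrow> x \<in> A i \<Longrightarrow> G x = ennreal (c i)"
    and "\<And>x. x \<in> space \<nu> \<Longrightarrow> x \<notin> (\<Union>i<n. A i) \<Longrightarrow> G x = 0"
proof -
  define Y where "Y = G ` space \<nu> - {0}"
  have "finite Y" using G by (auto simp: Y_def simple_function_def)
  then obtain n and g :: "nat \<Rightarrow> ennreal" where g: "bij_betw g {0..<n} Y"
    using ex_bij_betw_nat_finite by blast
  define A where "A i = G -` {g i} \<inter> space \<nu>" for i
  have gY: "g i \<in> Y" if "i < n" for i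
    using g that by (auto simp: bij_betw_def)
  have c: "0 < enn2real (g i) \<and> ennreal (enn2real (g i)) = g i" if "i < n" for i
  proof -
    have "g i \<in> Y" using that by (rule gY)
    then obtain x where "x \<in> space \<nu>" "g i = G x" "g i \<noteq> 0" by (auto simp: Y_def)
    then show ?thesis using fin[of x] by (auto simp: enn2real_positive_iff zero_less_iff_neq_zero)
  qed
  show ?thesis
  proof (rule that[of n "\<lambda>i. enn2real (g i)" A])
    show "A i \<in> sets \<nu>" if "i < n" for i
      using simple_functionD(2)[OF G] by (simp add: A_def)
    show "disjoint_family_on A {..<n}"
      using g by (auto simp: disjoint_family_on_def A_def bij_betw_def inj_on_def)
    show "G x = 0" if "x \<in> space \<nu>" "x \<notin> (\<Union>i<n. A i)" for x
    proof (rule ccontr)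
      assume "G x \<noteq> 0"
      then have "G x \<in> g ` {0..<n}" using that g by (auto simp: Y_def bij_betw_def)
      then show False using that by (auto simp: A_def)
    qed
  qed (use c in \<open>auto simp: A_def\<close>)
qed

lemma nn_integral_LIMSEQ_space:
  fixes f :: "nat \<Rightarrow> 'a \<Rightarrow> ennreal"
  assumes "incseq f" and [measurable]: "\<And>i. f i \<in> borel_measurable M"
    and "\<And>x. x \<in> space M \<Longrightarrow> (\<lambda>i. f i x) \<longlonglongrightarrow> u x"
  shows "(\<lambda>n. \<integral>\<^sup>+x. f n x \<partial>M) \<longlonglongrightarrow> (\<integral>\<^sup>+x. u x \<partial>M)"
proof -
  have "(\<lambda>n. \<integral>\<^sup>+x. (if x \<in> space M then f n x else 0) \<partial>M) \<longlonglongrightarrow>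
      (\<integral>\<^sup>+x. (if x \<in> space M then u x else 0) \<partial>M)"
    using assms by (intro nn_integral_LIMSEQ) (auto simp: incseq_def le_fun_def)
  then show ?thesis by (simp cong: nn_integral_cong)
qed

lemma poisson_laplace_simple:
  assumes N: "poisson_process M \<nu> N"
    and G: "simple_function \<nu> G" and fin: "\<And>x. x \<in> space \<nu> \<Longrightarrow> G x < \<top>"
    and B: "B \<in> sets \<nu>" "emeasure \<nu> B < \<infinity>" "\<And>x. x \<in> space \<nu> \<Longrightarrow> x \<notin> B \<Longrightarrow> G x = 0"
  shows "(\<integral>\<omega>. nexp (\<integral>\<^sup>+x. G x \<partial>N \<omega>) \<partial>M) = nexp (\<integral>\<^sup>+x. ennreal (1 - nexp (G x)) \<partial>\<nu>)"
proof -
  obtain n and c :: "nat \<Rightarrow> real" and A where c: "\<And>i. i < n \<Longrightarrow> 0 < c i"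
    and A: "\<And>i. i < n \<Longrightarrow> A i \<in> sets \<nu>" and disj: "disjoint_family_on A {..<n}"
    and GA: "\<And>i x. i < n \<Longrightarrow> x \<in> A i \<Longrightarrow> G x = ennreal (c i)"
    and G0: "\<And>x. x \<in> space \<nu> \<Longrightarrow> x \<notin> (\<Union>i<n. A i) \<Longrightarrow> G x = 0"
    using simple_function_disjoint_rep[OF G fin] by metis
  have rep: "\<phi> (G x) = (\<Sum>i<n. \<phi> (ennreal (c i)) * indicator (A i) x)"
    if x: "x \<in> space \<nu>" and "\<phi> 0 = 0" for \<phi> :: "ennreal \<Rightarrow> ennreal" and x
  proof (cases "x \<in> (\<Union>i<n. A i)")
    case True
    then obtain j where j: "j < n" "x \<in> A j" by auto
    have "(\<Sum>i<n. \<phi> (ennreal (c i)) * indicator (A i) x) = (\<Sum>i<n. if i = j then \<phi> (ennreal (c i)) else 0)"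
      using j disj by (intro sum.cong) (auto simp: indicator_def disjoint_family_on_def)
    then show ?thesis using j GA[OF j] by simp
  next
    case False
    then have "(\<Sum>i<n. \<phi> (ennreal (c i)) * indicator (A i) x) = 0"
      by (intro sum.neutral) auto
    then show ?thesis using G0[OF x False] \<open>\<phi> 0 = 0\<close> by simp
  qed
  have fin_A: "emeasure \<nu> (A i) < \<infinity>" if i: "i < n" for i
  proof -
    have "A i \<subseteq> B"
    proof
      fix x assume x: "x \<in> A i"
      then have "G x = ennreal (c i)" using GA i by blast
      then have "G x \<noteq> 0" using c[OF i] by simp
      moreover have "x \<in> space \<nu>" using x A[OF i] sets.sets_into_space by blast
      ultimately show "x \<in> B" using B(3) by blast
    qed
    then have "emeasure \<nu> (A i) \<le> emeasure \<nu> B" by (rule emeasure_mono) (rule B)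
    with B(2) show ?thesis by (rule le_less_trans[rotated])
  qed
  have "(\<integral>\<^sup>+x. ennreal (1 - nexp (G x)) \<partial>\<nu>) =
      (\<integral>\<^sup>+x. (\<Sum>i<n. ennreal (1 - exp (- c i)) * indicator (A i) x) \<partial>\<nu>)"
  proof (intro nn_integral_cong)
    fix x assume "x \<in> space \<nu>"
    then have "ennreal (1 - nexp (G x)) =
        (\<Sum>i<n. ennreal (1 - nexp (ennreal (c i))) * indicator (A i) x)"
      by (rule rep) simp
    also have "\<dots> = (\<Sum>i<n. ennreal (1 - exp (- c i)) * indicator (A i) x)"
      using c by (intro sum.cong refl) (simp add: nexp_ennreal less_imp_le)
    finally show "ennreal (1 - nexp (G x)) = (\<Sum>i<n. ennreal (1 - exp (- c i)) * indicator (A i) x)" .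
  qed
  also have "\<dots> = (\<Sum>i<n. ennreal (1 - exp (- c i)) * emeasure \<nu> (A i))"
    using A by (subst nn_integral_sum) (auto simp: nn_integral_cmult_indicator)
  finally have rhs: "(\<integral>\<^sup>+x. ennreal (1 - nexp (G x)) \<partial>\<nu>) =
      (\<Sum>i<n. ennreal (1 - exp (- c i)) * emeasure \<nu> (A i))" .
  have lhs: "(\<integral>\<^sup>+x. G x \<partial>N \<omega>) = (\<Sum>i<n. ennreal (c i) * emeasure (N \<omega>) (A i))"
    if "\<omega> \<in> space M" for \<omega>
  proof -
    have s: "sets (N \<omega>) = sets \<nu>"
      using measurable_space[OF poisson_process_measurable[OF N] that] by (simp add: space_measure_algebra)
    have "(\<integral>\<^sup>+x. G x \<partial>N \<omega>) = (\<integral>\<^sup>+x. (\<Sum>i<n. ennreal (c i) * indicator (A i) x) \<partial>N \<omega>)"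
      using rep[of _ "\<lambda>y. y"] by (intro nn_integral_cong) (simp add: sets_eq_imp_space_eq[OF s])
    also have "\<dots> = (\<Sum>i<n. ennreal (c i) * emeasure (N \<omega>) (A i))"
      using A s by (subst nn_integral_sum) (auto simp: nn_integral_cmult_indicator)
    finally show ?thesis .
  qed
  have "(\<integral>\<omega>. nexp (\<integral>\<^sup>+x. G x \<partial>N \<omega>) \<partial>M) =
      (\<integral>\<omega>. nexp (\<Sum>i<n. ennreal (c i) * emeasure (N \<omega>) (A i)) \<partial>M)"
    by (intro Bochner_Integration.integral_cong) (auto simp: lhs)
  also have "\<dots> = nexp (\<Sum>i<n. ennreal (1 - exp (- c i)) * emeasure \<nu> (A i))"
    using c by (intro poisson_laplace_step[OF N A fin_A disj]) (auto intro: less_imp_le)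
  finally show ?thesis by (simp add: rhs)
qed

text \<open>By monotone approximation this holds for all \<open>f \<ge> 0\<close>, both sides being \<open>0\<close> if the integral on the
  right is infinite.\<close>

lemma poisson_laplace:
  assumes N: "poisson_process M \<nu> N" and \<nu>: "sigma_finite_measure \<nu>"
    and f [measurable]: "f \<in> borel_measurable \<nu>"
  shows "(\<integral>\<omega>. nexp (\<integral>\<^sup>+x. f x \<partial>N \<omega>) \<partial>M) = nexp (\<integral>\<^sup>+x. ennreal (1 - nexp (f x)) \<partial>\<nu>)"
proof -
  interpret prob_space M using N by (rule poisson_process_prob_space)
  interpret \<nu>: sigma_finite_measure \<nu> by fact
  note N_meas [measurable] = poisson_process_measurable[OF N]
  obtain F where F: "\<And>i. simple_function \<nu> (F i)" "incseq F" "\<And>i x. F i x < \<top>"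
    "\<And>x. (SUP i. F i x) = f x"
    using borel_measurable_implies_simple_function_sequence'[OF f] by blast
  obtain B where B: "range B \<subseteq> sets \<nu>" "(\<Union>i. B i) = space \<nu>" "\<And>i. emeasure \<nu> (B i) \<noteq> \<infinity>" "incseq B"
    using \<nu>.sigma_finite_incseq by blast
  define G where "G k x = F k x * indicator (B k) x" for k x
  have [measurable]: "B k \<in> sets \<nu>" for k using B(1) by auto
  have G_simple: "simple_function \<nu> (G k)" for k
    unfolding G_def[abs_def] by (intro simple_function_mult F simple_function_indicator) simp
  then have [measurable]: "G k \<in> borel_measurable \<nu>" for k
    by (rule borel_measurable_simple_function)
  have G_mono: "incseq G"
  proof (intro incseq_SucI le_funI)
    fix k x
    show "G k x \<le> G (Suc k) x"
      unfolding G_def using incseq_SucD[OF F(2)] incseq_SucD[OF B(4), of k]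
      by (intro mult_mono) (auto simp: le_fun_def split: split_indicator)
  qed
  have G_lim: "(\<lambda>k. G k x) \<longlonglongrightarrow> f x" if x: "x \<in> space \<nu>" for x
  proof -
    obtain j where j: "x \<in> B j" using x B(2) by auto
    have "\<forall>\<^sub>F k in sequentially. F k x = G k x"
      using eventually_ge_at_top[of j]
    proof eventually_elim
      case (elim k)
      then have "x \<in> B k" using j B(4) by (auto simp: incseq_def)
      then show ?case by (simp add: G_def)
    qed
    moreover have "(\<lambda>k. F k x) \<longlonglongrightarrow> f x"
      using LIMSEQ_SUP[of "\<lambda>k. F k x"] F(2,4) by (simp add: incseq_def le_fun_def)
    ultimately show ?thesis by (rule Lim_transform_eventually[rotated])
  qed
  have step: "(\<integral>\<omega>. nexp (\<integral>\<^sup>+x. G k x \<partial>N \<omega>) \<partial>M) = nexp (\<integral>\<^sup>+x. ennreal (1 - nexp (G k x)) \<partial>\<nu>)" for k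
    using B(3)[of k] F(3)[of k]
    by (intro poisson_laplace_simple[OF N G_simple, where B = "B k"])
      (auto simp: G_def less_top split: split_indicator)
  have "(\<lambda>k. \<integral>\<omega>. nexp (\<integral>\<^sup>+x. G k x \<partial>N \<omega>) \<partial>M) \<longlonglongrightarrow> (\<integral>\<omega>. nexp (\<integral>\<^sup>+x. f x \<partial>N \<omega>) \<partial>M)"
  proof (rule integral_dominated_convergence[where w = "\<lambda>_. 1"])
    show "AE \<omega> in M. (\<lambda>k. nexp (\<integral>\<^sup>+x. G k x \<partial>N \<omega>)) \<longlonglongrightarrow> nexp (\<integral>\<^sup>+x. f x \<partial>N \<omega>)"
    proof (rule AE_I2)
      fix \<omega> assume "\<omega> \<in> space M"
      then have s [measurable_cong]: "sets (N \<omega>) = sets \<nu>"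
        using measurable_space[OF N_meas] by (simp add: space_measure_algebra)
      have "(\<lambda>k. \<integral>\<^sup>+x. G k x \<partial>N \<omega>) \<longlonglongrightarrow> (\<integral>\<^sup>+x. f x \<partial>N \<omega>)"
        using G_mono G_lim
        by (intro nn_integral_LIMSEQ_space) (auto simp: sets_eq_imp_space_eq[OF s])
      then show "(\<lambda>k. nexp (\<integral>\<^sup>+x. G k x \<partial>N \<omega>)) \<longlonglongrightarrow> nexp (\<integral>\<^sup>+x. f x \<partial>N \<omega>)"
        by (rule tendsto_nexp)
    qed
  qed auto
  moreover have "(\<lambda>k. nexp (\<integral>\<^sup>+x. ennreal (1 - nexp (G k x)) \<partial>\<nu>)) \<longlonglongrightarrow>
      nexp (\<integral>\<^sup>+x. ennreal (1 - nexp (f x)) \<partial>\<nu>)"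
  proof (intro tendsto_nexp nn_integral_LIMSEQ_space)
    show "incseq (\<lambda>k x. ennreal (1 - nexp (G k x)))"
      using G_mono by (auto simp: incseq_def le_fun_def intro!: ennreal_leI nexp_antimono)
    show "(\<lambda>k. ennreal (1 - nexp (G k x))) \<longlonglongrightarrow> ennreal (1 - nexp (f x))" if "x \<in> space \<nu>" for x
      by (intro tendsto_ennrealI tendsto_diff tendsto_const tendsto_nexp G_lim that)
  qed auto
  ultimately show ?thesis
    unfolding step by (rule LIMSEQ_unique)
qed

section \<open>Laplace transforms of bounded functions\<close>

lemma nn_integral_exp_neg:
  assumes "0 < (w::real)"
  shows "(\<integral>\<^sup>+v. ennreal (indicator {0<..} v * exp (- w * v)) \<partial>lborel) = ennreal (1 / w)"
proof -
  interpret prob_space "density lborel (exponential_density w)"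
    using assms by (rule prob_space_exponential_density)
  have "1 = (\<integral>\<^sup>+v. ennreal (exponential_density w v) \<partial>lborel)"
    using emeasure_space_1 by (subst (asm) emeasure_density) auto
  also have "\<dots> = (\<integral>\<^sup>+v. ennreal w * ennreal (indicator {0<..} v * exp (- w * v)) \<partial>lborel)"
    using AE_lborel_singleton[of "0::real"] assms
    by (intro nn_integral_cong_AE)
      (auto elim!: eventually_mono simp: exponential_density_def ennreal_mult[symmetric] mult_ac
        split: split_indicator)
  also have "\<dots> = ennreal w * (\<integral>\<^sup>+v. ennreal (indicator {0<..} v * exp (- w * v)) \<partial>lborel)"
    by (rule nn_integral_cmult) simp
  finally have *: "ennreal w * (\<integral>\<^sup>+v. ennreal (indicator {0<..} v * exp (- w * v)) \<partial>lborel) = 1" ..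
  have "(\<integral>\<^sup>+v. ennreal (indicator {0<..} v * exp (- w * v)) \<partial>lborel) =
      ennreal (1 / w) * (ennreal w * (\<integral>\<^sup>+v. ennreal (indicator {0<..} v * exp (- w * v)) \<partial>lborel))"
    using assms by (simp add: mult.assoc[symmetric] ennreal_mult[symmetric])
  then show ?thesis unfolding * by simp
qed

lemma integrable_exp_neg:
  assumes "0 < (w::real)"
  shows "integrable lborel (\<lambda>v. indicator {0<..} v * exp (- w * v))"
    and "(\<integral>v. indicator {0<..} v * exp (- w * v) \<partial>lborel) = 1 / w"
proof -
  show "integrable lborel (\<lambda>v. indicator {0<..} v * exp (- w * v))"
    using nn_integral_exp_neg[OF assms] by (intro integrableI_nonneg) auto
  show "(\<integral>v. indicator {0<..} v * exp (- w * v) \<partial>lborel) = 1 / w"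
    using assms nn_integral_exp_neg[OF assms] by (subst integral_eq_nn_integral) auto
qed

lemma exp_neg_quadratic_bound:
  fixes x :: real
  shows "\<bar>exp (- x) - 1 + x\<bar> \<le> x\<^sup>2 * exp \<bar>x\<bar>"
proof -
  have 0: "0 \<le> exp (- x) - 1 + x" using exp_ge_add_one_self[of "- x"] by simp
  have "(1 + x) * exp (- x) \<le> exp x * exp (- x)"
    using exp_ge_add_one_self[of x] by (intro mult_right_mono) auto
  then have 1: "exp (- x) - 1 + x \<le> x * (1 - exp (- x))"
    by (simp add: exp_minus algebra_simps)
  have 2: "x * (1 - exp (- x)) \<le> x\<^sup>2 * exp \<bar>x\<bar>"
  proof (cases "0 \<le> x")
    case True
    then have "x * (1 - exp (- x)) \<le> x * x"
      using exp_ge_add_one_self[of "- x"] by (intro mult_left_mono) auto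
    also have "\<dots> \<le> x * x * exp \<bar>x\<bar>"
      using True by (simp add: mult_left_le mult_le_cancel_left1)
    finally show ?thesis by (simp add: power2_eq_square)
  next
    case False
    define y where "y = - x"
    have y: "0 < y" using False by (simp add: y_def)
    have "exp y * (1 - y) \<le> exp y * exp (- y)"
      using exp_ge_add_one_self[of "- y"] by (intro mult_left_mono) auto
    then have "exp y - 1 \<le> y * exp y" by (simp add: exp_minus algebra_simps)
    then have "y * (exp y - 1) \<le> y * (y * exp y)" using y by (intro mult_left_mono) auto
    then show ?thesis using y by (simp add: y_def power2_eq_square algebra_simps)
  qed
  from 0 1 2 show ?thesis by simp
qed

lemma power_mult_exp_bound:
  fixes v w :: real
  assumes "0 \<le> v" "0 < w"
  shows "v ^ n * exp (- w * v) \<le> (2 * real n / w) ^ n * exp (- (w / 2) * v)"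
proof (cases "n = 0")
  case False
  define c where "c = w / (2 * real n)"
  have c: "0 < c" using assms False by (simp add: c_def)
  have "c * v \<le> exp (c * v)" using exp_ge_add_one_self[of "c * v"] by linarith
  then have "(c * v) ^ n \<le> exp (c * v) ^ n"
    using assms c by (intro power_mono) auto
  also have "\<dots> = exp ((w / 2) * v)"
    using False by (simp add: exp_of_nat_mult[symmetric] c_def)
  finally have "v ^ n \<le> exp ((w / 2) * v) / c ^ n"
    using c by (simp add: power_mult_distrib field_simps)
  then have "v ^ n * exp (- w * v) \<le> exp ((w / 2) * v) / c ^ n * exp (- w * v)"
    by (rule mult_right_mono) simp
  also have "\<dots> = (1 / c) ^ n * exp (- (w / 2) * v)"
    by (simp add: power_one_over field_simps exp_add[symmetric])
  finally show ?thesis by (simp add: c_def)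
qed (use assms in auto)

lemma laplace_transform_integrable:
  fixes \<rho> :: "real \<Rightarrow> real"
  assumes [measurable]: "\<rho> \<in> borel_measurable borel" and K: "\<And>v. 0 \<le> \<rho> v" "\<And>v. \<rho> v \<le> K"
    and 0: "\<And>v. v \<le> 0 \<Longrightarrow> \<rho> v = 0" and w: "0 < w"
  shows "integrable lborel (\<lambda>v. \<rho> v * (v ^ n * exp (- w * v)))"
proof (rule Bochner_Integration.integrable_bound)
  show "integrable lborel (\<lambda>v. K * (2 * real n / w) ^ n * (indicator {0<..} v * exp (- (w / 2) * v)))"
    using integrable_exp_neg(1)[of "w / 2"] w by (intro integrable_mult_right) auto
  show "AE v in lborel. norm (\<rho> v * (v ^ n * exp (- w * v))) \<le>
      norm (K * (2 * real n / w) ^ n * (indicator {0<..} v * exp (- (w / 2) * v)))"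
  proof (rule AE_I2)
    fix v :: real
    show "norm (\<rho> v * (v ^ n * exp (- w * v))) \<le>
      norm (K * (2 * real n / w) ^ n * (indicator {0<..} v * exp (- (w / 2) * v)))"
    proof (cases "0 < v")
      case True
      have "\<rho> v * (v ^ n * exp (- w * v)) \<le> K * ((2 * real n / w) ^ n * exp (- (w / 2) * v))"
        using K[of v] True w by (intro mult_mono power_mult_exp_bound) auto
      moreover have "0 \<le> K" using K[of 0] by linarith
      ultimately show ?thesis using True K(1)[of v] w by (simp add: abs_mult mult_ac)
    qed (simp add: 0)
  qed
qed simp

lemma laplace_transform_le:
  fixes \<rho> :: "real \<Rightarrow> real"
  assumes [measurable]: "\<rho> \<in> borel_measurable borel" and K: "\<And>v. 0 \<le> \<rho> v" "\<And>v. \<rho> v \<le> K"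
    and 0: "\<And>v. v \<le> 0 \<Longrightarrow> \<rho> v = 0" and w: "0 < w"
  shows "(\<integral>v. \<rho> v * exp (- w * v) \<partial>lborel) \<le> K / w"
proof -
  have "(\<integral>v. \<rho> v * exp (- w * v) \<partial>lborel) \<le> (\<integral>v. K * (indicator {0<..} v * exp (- w * v)) \<partial>lborel)"
  proof (rule integral_mono)
    show "integrable lborel (\<lambda>v. \<rho> v * exp (- w * v))"
      using laplace_transform_integrable[OF assms(1) K 0 w, of 0] by simp
    show "integrable lborel (\<lambda>v. K * (indicator {0<..} v * exp (- w * v)))"
      using integrable_exp_neg(1)[OF w] by (rule integrable_mult_right)
    show "\<rho> v * exp (- w * v) \<le> K * (indicator {0<..} v * exp (- w * v))" for v
      using K[of v] 0[of v] by (cases "0 < v") (auto intro!: mult_right_mono)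
  qed
  also have "\<dots> = K / w" using integrable_exp_neg(2)[OF w] by simp
  finally show ?thesis .
qed

text \<open>The difference quotient minus its limit is at most \<open>\<bar>h\<bar>\<close> times an integral that does not depend on
  \<open>h\<close>, by \<open>exp_neg_quadratic_bound\<close>.\<close>

lemma laplace_transform_deriv:
  fixes \<rho> :: "real \<Rightarrow> real"
  assumes [measurable]: "\<rho> \<in> borel_measurable borel" and K: "\<And>v. 0 \<le> \<rho> v" "\<And>v. \<rho> v \<le> K"
    and 0: "\<And>v. v \<le> 0 \<Longrightarrow> \<rho> v = 0" and w: "0 < w"
  shows "((\<lambda>w. \<integral>v. \<rho> v * exp (- w * v) \<partial>lborel) has_real_derivative
    - (\<integral>v. \<rho> v * (v * exp (- w * v)) \<partial>lborel)) (at w)"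
proof -
  have int: "integrable lborel (\<lambda>v. \<rho> v * (v ^ n * exp (- w * v)))" if "0 < w" for w n
    by (rule laplace_transform_integrable[OF _ K]) (use 0 that in auto)
  let ?F = "\<lambda>w. \<integral>v. \<rho> v * exp (- w * v) \<partial>lborel"
  let ?D = "\<integral>v. \<rho> v * (v * exp (- w * v)) \<partial>lborel"
  define C where "C = (\<integral>v. \<rho> v * (v ^ 2 * exp (- (w / 2) * v)) \<partial>lborel)"
  have bound: "\<bar>(?F (w + h) - ?F w) / h + ?D\<bar> \<le> C * \<bar>h\<bar>" if h: "h \<noteq> 0" "\<bar>h\<bar> < w / 2" for h
  proof -
    have wh: "0 < w + h" using h w by linarith
    have ints: "integrable lborel (\<lambda>v. \<rho> v * exp (- (w + h) * v))"
      "integrable lborel (\<lambda>v. \<rho> v * exp (- w * v))"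
      "integrable lborel (\<lambda>v. \<rho> v * (v * exp (- w * v)))"
      "integrable lborel (\<lambda>v. \<rho> v * (v ^ 2 * exp (- (w / 2) * v)))"
      using int[OF wh, of 0] int[OF w, of 0] int[OF w, of 1] int[of "w / 2" 2] w by simp_all
    define g where "g v = \<rho> v * exp (- (w + h) * v) - \<rho> v * exp (- w * v) + h * (\<rho> v * (v * exp (- w * v)))" for v
    have g_int: "integrable lborel g"
      unfolding g_def[abs_def]
      by (intro Bochner_Integration.integrable_add Bochner_Integration.integrable_diff
          integrable_mult_right ints)
    have "?F (w + h) - ?F w + h * ?D = (\<integral>v. g v \<partial>lborel)"
      unfolding g_def
      by (simp only: Bochner_Integration.integral_add[OF Bochner_Integration.integrable_diff[OF ints(1,2)]
            integrable_mult_right[OF ints(3)]] Bochner_Integration.integral_diff[OF ints(1,2)]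
          integral_mult_right_zero)
    also have "\<bar>\<dots>\<bar> \<le> (\<integral>v. \<bar>g v\<bar> \<partial>lborel)"
      by (rule integral_abs_bound)
    also have "\<dots> \<le> (\<integral>v. h\<^sup>2 * (\<rho> v * (v ^ 2 * exp (- (w / 2) * v))) \<partial>lborel)"
    proof (rule integral_mono[OF integrable_abs[OF g_int] integrable_mult_right[OF ints(4)]])
      fix v :: real
      show "\<bar>g v\<bar> \<le> h\<^sup>2 * (\<rho> v * (v ^ 2 * exp (- (w / 2) * v)))"
      proof (cases "0 < v")
        case True
        have "exp (- (w + h) * v) = exp (- w * v) * exp (- (h * v))"
          by (simp add: exp_add[symmetric] algebra_simps)
        then have "g v = \<rho> v * exp (- w * v) * (exp (- (h * v)) - 1 + h * v)"
          unfolding g_def by (simp only: right_diff_distrib distrib_left mult_1_right mult_ac)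
        then have "\<bar>g v\<bar> = \<rho> v * exp (- w * v) * \<bar>exp (- (h * v)) - 1 + h * v\<bar>"
          using K(1)[of v] by (simp add: abs_mult)
        also have "\<dots> \<le> \<rho> v * exp (- w * v) * ((h * v)\<^sup>2 * exp \<bar>h * v\<bar>)"
          using K(1)[of v] by (intro mult_left_mono exp_neg_quadratic_bound) auto
        also have "\<dots> = \<rho> v * (h * v)\<^sup>2 * exp (- w * v + \<bar>h * v\<bar>)"
          by (simp only: exp_add mult_ac)
        also have "\<dots> \<le> \<rho> v * (h * v)\<^sup>2 * exp (- (w / 2) * v)"
        proof -
          have "\<bar>h * v\<bar> \<le> w / 2 * v"
            using h(2) True by (simp add: abs_mult mult_right_mono)
          then have "exp (- w * v + \<bar>h * v\<bar>) \<le> exp (- (w / 2) * v)" by simp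
          then show ?thesis using K(1)[of v] by (intro mult_left_mono) auto
        qed
        finally show ?thesis by (simp only: power_mult_distrib mult_ac)
      qed (simp add: 0 g_def)
    qed
    also have "\<dots> = h\<^sup>2 * C" by (simp only: C_def integral_mult_right_zero)
    finally have "\<bar>?F (w + h) - ?F w + h * ?D\<bar> \<le> h\<^sup>2 * C" .
    moreover have "(?F (w + h) - ?F w) / h + ?D = (?F (w + h) - ?F w + h * ?D) / h"
      using h(1) by (simp add: field_simps)
    ultimately show ?thesis
      using h(1) by (simp add: abs_divide divide_le_eq power2_eq_square mult_ac)
  qed
  have "((\<lambda>h. (?F (w + h) - ?F w) / h - - ?D) \<longlongrightarrow> 0) (at 0)"
  proof (rule Lim_null_comparison)
    show "\<forall>\<^sub>F h in at 0. norm ((?F (w + h) - ?F w) / h - - ?D) \<le> C * \<bar>h\<bar>"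
      using bound w by (auto simp: eventually_at dist_real_def intro!: exI[of _ "w / 2"])
    show "((\<lambda>h. C * \<bar>h\<bar>) \<longlongrightarrow> 0) (at 0)"
      by (auto intro!: tendsto_eq_intros)
  qed
  then show ?thesis unfolding DERIV_def by (rule LIM_zero_cancel)
qed

section \<open>Gamma and beta densities\<close>

lemma gamma_density_measurable [measurable]: "gamma_density c \<in> borel_measurable borel"
  unfolding gamma_density_def[abs_def] by measurable

lemma beta_density_measurable [measurable]: "beta_density a b \<in> borel_measurable borel"
  unfolding beta_density_def[abs_def] by measurable

lemma Gamma_add_1: "0 < c \<Longrightarrow> Gamma (c + 1) = c * Gamma (c::real)"
  using nonpos_Ints_nonpos[of c] by (intro Gamma_plus1) auto

lemma gamma_density_nonneg: "0 < c \<Longrightarrow> 0 \<le> gamma_density c x"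
  by (simp add: gamma_density_def Gamma_real_pos less_imp_le)

lemma nn_integral_gamma_density:
  assumes "0 < c"
  shows "(\<integral>\<^sup>+x. ennreal (gamma_density c x) \<partial>lborel) = 1"
proof -
  have "ennreal (Gamma c) = (\<integral>\<^sup>+x. ennreal (indicator {0..} x * x powr (c - 1) / exp x) \<partial>lborel)"
    by (rule Gamma_conv_nn_integral_real[OF assms])
  also have "\<dots> = (\<integral>\<^sup>+x. ennreal (Gamma c) * ennreal (gamma_density c x) \<partial>lborel)"
    using AE_lborel_singleton[of "0::real"] Gamma_real_pos[OF assms]
    by (intro nn_integral_cong_AE)
      (auto elim!: eventually_mono simp: gamma_density_def ennreal_mult[symmetric] exp_minus divide_inverse)
  also have "\<dots> = ennreal (Gamma c) * (\<integral>\<^sup>+x. ennreal (gamma_density c x) \<partial>lborel)"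
    by (rule nn_integral_cmult) simp
  finally have "ennreal (inverse (Gamma c)) * ennreal (Gamma c) =
      ennreal (inverse (Gamma c)) * ennreal (Gamma c) * (\<integral>\<^sup>+x. ennreal (gamma_density c x) \<partial>lborel)"
    by (simp add: mult.assoc)
  moreover have "ennreal (inverse (Gamma c)) * ennreal (Gamma c) = 1"
    using Gamma_real_pos[OF assms] by (simp add: ennreal_mult[symmetric])
  ultimately show ?thesis by simp
qed

lemma integrable_gamma_density:
  assumes "0 < c"
  shows "integrable lborel (gamma_density c)" and "(\<integral>x. gamma_density c x \<partial>lborel) = 1"
proof -
  show "integrable lborel (gamma_density c)"
    using nn_integral_gamma_density[OF assms] gamma_density_nonneg[OF assms]
    by (intro integrableI_nonneg) auto
  show "(\<integral>x. gamma_density c x \<partial>lborel) = 1"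
    using nn_integral_gamma_density[OF assms] gamma_density_nonneg[OF assms]
    by (subst integral_eq_nn_integral) auto
qed

lemma nn_integral_gamma_density_mean:
  assumes "0 < c"
  shows "(\<integral>\<^sup>+x. ennreal x * ennreal (gamma_density c x) \<partial>lborel) = ennreal c"
proof -
  have "ennreal x * ennreal (gamma_density c x) = ennreal c * ennreal (gamma_density (c + 1) x)" for x
  proof (cases "0 < x")
    case True
    have "x * gamma_density c x = c * gamma_density (c + 1) x"
      using True assms Gamma_add_1[OF assms] Gamma_real_pos[OF assms]
      by (simp add: gamma_density_def powr_diff field_simps)
    then show ?thesis using True assms gamma_density_nonneg[of c x] gamma_density_nonneg[of "c + 1" x]
      by (simp add: ennreal_mult[symmetric])
  qed (simp add: gamma_density_def)
  then show ?thesis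
    using nn_integral_gamma_density[of "c + 1"] assms by (simp add: nn_integral_cmult)
qed

lemma Beta_1_right: "0 < a \<Longrightarrow> Beta a 1 = 1 / (a::real)"
  using less_imp_neq[OF Gamma_real_pos[of a]] by (simp add: Beta_def Gamma_add_1)

lemma beta_density_1: "0 < a \<Longrightarrow> beta_density a 1 x = indicator {0<..<1} x * (a * x powr (a - 1))"
  by (auto simp: beta_density_def Beta_1_right)

lemma nn_integral_beta_density_power:
  assumes "0 < a" "0 \<le> b"
  shows "(\<integral>\<^sup>+x. ennreal (x powr b) * ennreal (beta_density a 1 x) \<partial>lborel) = ennreal (a / (a + b))"
proof -
  have "((\<lambda>x. a * x powr (a + b - 1)) has_integral (a / (a + b) * 1 powr (a + b) - a / (a + b) * 0 powr (a + b))) {0..1}"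
  proof (rule fundamental_theorem_of_calculus_interior)
    show "continuous_on {0..1} (\<lambda>x. a / (a + b) * x powr (a + b))"
      using assms by (intro continuous_intros continuous_on_powr') auto
    show "((\<lambda>x. a / (a + b) * x powr (a + b)) has_vector_derivative a * x powr (a + b - 1)) (at x)"
      if "x \<in> {0<..<1}" for x
      unfolding has_real_derivative_iff_has_vector_derivative[symmetric] using that assms
      by (auto intro!: derivative_eq_intros)
  qed simp
  then have "(\<integral>\<^sup>+x. ennreal (a * x powr (a + b - 1)) * indicator {0..1} x \<partial>lborel) = ennreal (a / (a + b))"
    using assms by (subst nn_integral_has_integral_lebesgue') auto
  moreover have "(\<integral>\<^sup>+x. ennreal (a * x powr (a + b - 1)) * indicator {0..1} x \<partial>lborel) =
      (\<integral>\<^sup>+x. ennreal (x powr b) * ennreal (beta_density a 1 x) \<partial>lborel)"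
    using AE_lborel_singleton[of "0::real"] AE_lborel_singleton[of "1::real"]
  proof (intro nn_integral_cong_AE, eventually_elim)
    case (elim x)
    show ?case
    proof (cases "0 < x \<and> x < 1")
      case True
      then have "x powr b * (a * x powr (a - 1)) = a * x powr (a + b - 1)"
        by (simp add: powr_add[symmetric] algebra_simps)
      with True assms show ?thesis by (simp add: beta_density_1 ennreal_mult[symmetric])
    qed (use elim assms in \<open>auto simp: beta_density_1 indicator_def\<close>)
  qed
  ultimately show ?thesis by simp
qed

lemma nn_integral_beta_density:
  assumes "0 < a"
  shows "(\<integral>\<^sup>+x. ennreal (beta_density a 1 x) \<partial>lborel) = 1"
proof -
  have "(\<integral>\<^sup>+x. ennreal (beta_density a 1 x) \<partial>lborel) =
      (\<integral>\<^sup>+x. ennreal (x powr 0) * ennreal (beta_density a 1 x) \<partial>lborel)"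
    by (intro nn_integral_cong) (auto simp: beta_density_def)
  then show ?thesis using nn_integral_beta_density_power[OF assms, of 0] assms by simp
qed

section \<open>The functions solving the beta/gamma recursion\<close>

text \<open>A test function \<open>q = exp (- f)\<close> for the Laplace functional, where \<open>f \<ge> 0\<close> vanishes on \<open>(- \<infinity>, \<epsilon>]\<close>.\<close>

locale laplace_test =
  fixes \<alpha> \<epsilon> :: real and q :: "real \<Rightarrow> real"
  assumes \<alpha>: "0 \<le> \<alpha>" "\<alpha> < 1" and \<epsilon>: "0 < \<epsilon>"
    and q_measurable [measurable]: "q \<in> borel_measurable borel"
    and q_nonneg: "\<And>x. 0 \<le> q x" and q_le_1: "\<And>x. q x \<le> 1"
    and q_eq_1: "\<And>x. x \<le> \<epsilon> \<Longrightarrow> q x = 1"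
begin

text \<open>\<open>dl\<close> is the Laplace transform of the bounded function \<open>rho\<close>, and \<open>- dl1\<close> is its derivative.\<close>

definition rho :: "real \<Rightarrow> real" where
  "rho v = (1 - q v) * v powr (- \<alpha> - 1) / Gamma (1 - \<alpha>)"

definition dl :: "real \<Rightarrow> real" where
  "dl w = (\<integral>v. rho v * exp (- w * v) \<partial>lborel)"

definition dl1 :: "real \<Rightarrow> real" where
  "dl1 w = (\<integral>v. rho v * (v * exp (- w * v)) \<partial>lborel)"

text \<open>The upper bound for \<open>rho\<close>, which makes \<open>dl w \<le> K / w\<close>.\<close>

definition K :: real where
  "K = \<epsilon> powr (- \<alpha> - 1) / Gamma (1 - \<alpha>)"

text \<open>\<open>kk s\<close> is the expectation of \<open>q (s G)\<close> for \<open>G\<close> of law \<open>gamma(1 - \<alpha>, 1)\<close>.\<close>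

definition kk :: "real \<Rightarrow> real" where
  "kk s = (\<integral>x. gamma_density (1 - \<alpha>) x * q (s * x) \<partial>lborel)"

text \<open>\<open>gg a\<close> solves the recursion \<open>gg_step\<close>. In terms of \<open>w = 1 / s\<close> it is the function
  \<open>w powr a * hfun a w\<close>, and the recursion amounts to the differential equation \<open>hfun_deriv\<close>. The two formulas for
  \<open>hfun\<close> are consistent: the first one is the limit of the second one as \<open>\<alpha> \<rightarrow> 0\<close>.\<close>

definition hfun :: "real \<Rightarrow> real \<Rightarrow> real" where
  "hfun a w = (if \<alpha> = 0 then w powr (- a) * exp (- a * dl w)
     else (w powr \<alpha> + \<alpha> * dl w) powr (- (a / \<alpha>)))"

definition gg :: "real \<Rightarrow> real \<Rightarrow> real" where
  "gg a s = s powr (- a) * hfun a (1 / s)"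

lemma Gamma_pos: "0 < Gamma (1 - \<alpha>)"
  using \<alpha> by (intro Gamma_real_pos) auto

lemma rho_measurable [measurable]: "rho \<in> borel_measurable borel"
  unfolding rho_def[abs_def] by measurable

lemma rho_0: "v \<le> \<epsilon> \<Longrightarrow> rho v = 0"
  by (simp add: rho_def q_eq_1)

lemma rho_nonneg: "0 \<le> rho v"
  using q_le_1[of v] Gamma_pos by (simp add: rho_def)

lemma rho_le: "rho v \<le> K"
proof (cases "v \<le> \<epsilon>")
  case True
  then show ?thesis using Gamma_pos by (simp add: rho_0 K_def)
next
  case False
  have "(1 - q v) * v powr (- \<alpha> - 1) \<le> 1 * \<epsilon> powr (- \<alpha> - 1)"
    using False \<epsilon> \<alpha> q_nonneg[of v] q_le_1[of v] by (intro mult_mono powr_mono2') auto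
  then show ?thesis using Gamma_pos unfolding rho_def K_def by (intro divide_right_mono) auto
qed

lemma K_nonneg: "0 \<le> K"
  using Gamma_pos by (simp add: K_def)

lemma rho_integrable: "0 < w \<Longrightarrow> integrable lborel (\<lambda>v. rho v * (v ^ n * exp (- w * v)))"
  by (rule laplace_transform_integrable[OF rho_measurable rho_nonneg rho_le]) (use \<epsilon> rho_0 in auto)

lemma dl_nonneg: "0 \<le> dl w"
  unfolding dl_def by (intro integral_nonneg_AE) (auto simp: rho_nonneg)

lemma dl_le: "0 < w \<Longrightarrow> dl w \<le> K / w"
  unfolding dl_def by (rule laplace_transform_le[OF rho_measurable rho_nonneg rho_le]) (use \<epsilon> rho_0 in auto)

lemma dl_deriv: "0 < w \<Longrightarrow> (dl has_real_derivative - dl1 w) (at w)"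
  unfolding dl_def[abs_def] dl1_def
  by (rule laplace_transform_deriv[OF rho_measurable rho_nonneg rho_le]) (use \<epsilon> rho_0 in auto)

lemma gamma_q_integrable: "integrable lborel (\<lambda>x. gamma_density (1 - \<alpha>) x * q (s * x))"
proof (rule Bochner_Integration.integrable_bound)
  show "integrable lborel (gamma_density (1 - \<alpha>))"
    using \<alpha> by (intro integrable_gamma_density) auto
  show "AE x in lborel. norm (gamma_density (1 - \<alpha>) x * q (s * x)) \<le> norm (gamma_density (1 - \<alpha>) x)"
    using q_nonneg q_le_1 by (auto simp: abs_mult mult_left_le)
qed simp

lemma kk_nonneg: "0 \<le> kk s"
  unfolding kk_def using gamma_density_nonneg[of "1 - \<alpha>"] \<alpha>
  by (intro integral_nonneg_AE) (auto simp: q_nonneg)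

lemma nn_integral_kk:
  "(\<integral>\<^sup>+x. ennreal (q (s * x)) * ennreal (gamma_density (1 - \<alpha>) x) \<partial>lborel) = ennreal (kk s)"
proof -
  have gd: "0 \<le> gamma_density (1 - \<alpha>) x" for x
    using \<alpha> by (intro gamma_density_nonneg) simp
  have "(\<integral>\<^sup>+x. ennreal (q (s * x)) * ennreal (gamma_density (1 - \<alpha>) x) \<partial>lborel) =
      (\<integral>\<^sup>+x. ennreal (gamma_density (1 - \<alpha>) x * q (s * x)) \<partial>lborel)"
    using gd q_nonneg by (intro nn_integral_cong) (simp add: ennreal_mult mult.commute)
  also have "\<dots> = ennreal (kk s)"
    unfolding kk_def using gd q_nonneg by (intro nn_integral_eq_integral gamma_q_integrable) auto
  finally show ?thesis .
qed

lemma kk_eq: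
  assumes s: "0 < s"
  shows "kk s = 1 - (1 / s) powr (1 - \<alpha>) * dl1 (1 / s)"
proof -
  have "dl1 (1 / s) = s * (\<integral>x. rho (s * x) * ((s * x) * exp (- (1 / s) * (s * x))) \<partial>lborel)"
    unfolding dl1_def using s by (subst lborel_integral_real_affine[of s _ 0]) auto
  then have "(1 / s) powr (1 - \<alpha>) * dl1 (1 / s) =
      (\<integral>x. (1 / s) powr (1 - \<alpha>) * s * (rho (s * x) * ((s * x) * exp (- (1 / s) * (s * x)))) \<partial>lborel)"
    by simp
  also have "\<dots> = (\<integral>x. gamma_density (1 - \<alpha>) x - gamma_density (1 - \<alpha>) x * q (s * x) \<partial>lborel)"
  proof (intro Bochner_Integration.integral_cong refl)
    fix x :: real
    show "(1 / s) powr (1 - \<alpha>) * s * (rho (s * x) * ((s * x) * exp (- (1 / s) * (s * x)))) =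
        gamma_density (1 - \<alpha>) x - gamma_density (1 - \<alpha>) x * q (s * x)"
    proof (cases "0 < x")
      case True
      have P: "(1 / s) powr (1 - \<alpha>) * s * ((s * x) powr (- \<alpha> - 1) * (s * x)) = x powr (- \<alpha>)"
        using True s by (simp add: powr_mult powr_divide powr_diff powr_minus field_simps)
      have "- (1 / s) * (s * x) = - x" using s by simp
      then have "(1 / s) powr (1 - \<alpha>) * s * (rho (s * x) * ((s * x) * exp (- (1 / s) * (s * x)))) =
          (1 - q (s * x)) * ((1 / s) powr (1 - \<alpha>) * s * ((s * x) powr (- \<alpha> - 1) * (s * x))) *
            exp (- x) / Gamma (1 - \<alpha>)"
        by (simp only: rho_def times_divide_eq_left times_divide_eq_right mult_ac)
      also have "\<dots> = gamma_density (1 - \<alpha>) x - gamma_density (1 - \<alpha>) x * q (s * x)"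
        unfolding P using True by (simp add: gamma_density_def diff_divide_distrib algebra_simps)
      finally show ?thesis .
    next
      case False
      then have "s * x \<le> \<epsilon>" using s \<epsilon> by (meson less_imp_le mult_nonneg_nonpos not_less order_trans)
      with False show ?thesis by (simp add: rho_0 gamma_density_def)
    qed
  qed
  also have "\<dots> = 1 - kk s"
    unfolding kk_def using gamma_q_integrable integrable_gamma_density[of "1 - \<alpha>"] \<alpha>
    by (subst Bochner_Integration.integral_diff) auto
  finally show ?thesis by simp
qed

lemma theta_pos: "0 < w \<Longrightarrow> 0 < w powr \<alpha> + \<alpha> * dl w"
  using \<alpha> dl_nonneg[of w] by (intro add_pos_nonneg) auto

lemma hfun_nonneg: "0 \<le> hfun a w"
  by (simp add: hfun_def)

lemma hfun_0: "\<alpha> = 0 \<Longrightarrow> hfun a w = w powr (- a) * exp (- a * dl w)"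
  unfolding hfun_def by (rule if_P)

lemma hfun_le:
  assumes "0 < a" "0 < w"
  shows "hfun a w \<le> w powr (- a)"
proof (cases "\<alpha> = 0")
  case True
  then show ?thesis using dl_nonneg[of w] assms unfolding hfun_0[OF True] by (intro mult_left_le) auto
next
  case False
  then have "0 < \<alpha>" using \<alpha> by simp
  then have "(w powr \<alpha> + \<alpha> * dl w) powr (- (a / \<alpha>)) \<le> (w powr \<alpha>) powr (- (a / \<alpha>))"
    using assms dl_nonneg[of w] by (intro powr_mono2') auto
  also have "\<dots> = w powr (- a)" using \<open>0 < \<alpha>\<close> by (simp add: powr_powr)
  finally show ?thesis using False by (simp add: hfun_def)
qed

lemma hfun_ge:
  assumes a: "0 < a" and w: "0 < w"
  shows "1 - a * dl w * w powr (- \<alpha>) \<le> w powr a * hfun a w"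
proof (cases "\<alpha> = 0")
  case True
  have "1 - a * dl w \<le> exp (- a * dl w)" using exp_ge_add_one_self[of "- a * dl w"] by simp
  also have "\<dots> = w powr a * hfun a w"
    using w unfolding hfun_0[OF True] by (simp add: powr_minus)
  finally have "1 - a * dl w \<le> w powr a * hfun a w" .
  moreover have "w powr (- \<alpha>) = 1" using w True by simp
  ultimately show ?thesis by (simp only: mult_1_right)
next
  case False
  then have \<alpha>0: "0 < \<alpha>" using \<alpha> by simp
  define x where "x = \<alpha> * dl w * w powr (- \<alpha>)"
  have x: "0 \<le> x" using \<alpha>0 dl_nonneg[of w] by (simp add: x_def)
  have "w powr \<alpha> + \<alpha> * dl w = w powr \<alpha> * (1 + x)"
    using w by (simp add: x_def powr_minus field_simps)
  then have "hfun a w = (w powr \<alpha>) powr (- (a / \<alpha>)) * (1 + x) powr (- (a / \<alpha>))"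
    using False x by (simp add: hfun_def powr_mult)
  also have "(w powr \<alpha>) powr (- (a / \<alpha>)) = w powr (- a)" using \<alpha>0 by (simp add: powr_powr)
  finally have h: "w powr a * hfun a w = (1 + x) powr (- (a / \<alpha>))"
    using w by (simp add: powr_minus)
  have "1 - (a / \<alpha>) * x \<le> exp (- (a / \<alpha>) * x)"
    using exp_ge_add_one_self[of "- (a / \<alpha>) * x"] by simp
  also have "\<dots> \<le> exp (- (a / \<alpha>) * ln (1 + x))"
    using ln_add_one_self_le_self[OF x] a \<alpha>0 by (simp add: divide_right_mono mult_left_mono)
  also have "\<dots> = (1 + x) powr (- (a / \<alpha>))"
    using x by (simp add: powr_def)
  finally show ?thesis using h \<alpha>0 by (simp add: x_def mult_ac)
qed

lemma hfun_deriv: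
  assumes a: "0 < a" and w: "0 < w"
  shows "(hfun a has_real_derivative - (a * w powr (\<alpha> - 1) * kk (1 / w) * hfun (a + \<alpha>) w)) (at w)"
proof (cases "\<alpha> = 0")
  case True
  have "1 - \<alpha> = 1" using True by simp
  then have k: "kk (1 / w) = 1 - w * dl1 w" using kk_eq[of "1 / w"] w by simp
  have "((\<lambda>w. w powr (- a) * exp (- a * dl w)) has_real_derivative
      (- a * w powr (- a - 1)) * exp (- a * dl w) + (exp (- a * dl w) * (- a * - dl1 w)) * w powr (- a)) (at w)"
    by (intro DERIV_mult has_real_derivative_powr w DERIV_chain2[OF DERIV_exp] DERIV_cmult dl_deriv)
  moreover have "(- a * w powr (- a - 1)) * exp (- a * dl w) + (exp (- a * dl w) * (- a * - dl1 w)) * w powr (- a) =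
      - (a * w powr (- 1) * (1 - w * dl1 w) * (w powr (- a) * exp (- a * dl w)))"
    using w by (simp add: powr_diff powr_minus field_simps)
  moreover have "hfun a = (\<lambda>w. w powr (- a) * exp (- a * dl w))"
    using hfun_0[OF True] by blast
  moreover have "a * w powr (\<alpha> - 1) * kk (1 / w) * hfun (a + \<alpha>) w =
      a * w powr (- 1) * (1 - w * dl1 w) * (w powr (- a) * exp (- a * dl w))"
  proof -
    have "\<alpha> - 1 = - 1" "a + \<alpha> = a" using True by simp_all
    then show ?thesis by (simp only: k hfun_0[OF True])
  qed
  ultimately show ?thesis by (simp only:)
next
  case False
  then have \<alpha>0: "0 < \<alpha>" using \<alpha> by simp
  have k: "kk (1 / w) = 1 - w powr (1 - \<alpha>) * dl1 w" using kk_eq[of "1 / w"] w by simp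
  define b where "b = - (a / \<alpha>)"
  define \<Theta> where "\<Theta> w = w powr \<alpha> + \<alpha> * dl w" for w
  have \<Theta>_pos: "0 < \<Theta> w" using theta_pos[OF w] by (simp add: \<Theta>_def)
  have d\<Theta>: "(\<Theta> has_real_derivative \<alpha> * w powr (\<alpha> - 1) + \<alpha> * - dl1 w) (at w)"
    unfolding \<Theta>_def[abs_def]
    by (intro DERIV_add DERIV_cmult dl_deriv w has_real_derivative_powr)
  have "((\<lambda>w. \<Theta> w powr b) has_real_derivative
      (b * \<Theta> w powr (b - 1)) * (\<alpha> * w powr (\<alpha> - 1) + \<alpha> * - dl1 w)) (at w)"
    by (rule DERIV_chain2[OF has_real_derivative_powr[OF \<Theta>_pos] d\<Theta>])
  moreover have "(b * \<Theta> w powr (b - 1)) * (\<alpha> * w powr (\<alpha> - 1) + \<alpha> * - dl1 w) =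
      - (a * w powr (\<alpha> - 1) * kk (1 / w) * \<Theta> w powr (- ((a + \<alpha>) / \<alpha>)))"
  proof -
    have 1: "\<alpha> * w powr (\<alpha> - 1) + \<alpha> * - dl1 w = \<alpha> * w powr (\<alpha> - 1) * kk (1 / w)"
      using w by (simp add: k powr_diff field_simps)
    have 2: "b - 1 = - ((a + \<alpha>) / \<alpha>)" using \<alpha>0 by (simp add: b_def field_simps)
    show ?thesis unfolding 1 2 using \<alpha>0 by (simp add: b_def)
  qed
  ultimately show ?thesis using False by (simp add: hfun_def[abs_def] \<Theta>_def[abs_def] b_def)
qed

lemma gg_nonneg: "0 \<le> gg a s"
  by (simp add: gg_def hfun_nonneg)

lemma gg_le_1:
  assumes "0 < a" "0 < s"
  shows "gg a s \<le> 1"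
proof -
  have "gg a s \<le> s powr (- a) * (1 / s) powr (- a)"
    unfolding gg_def using assms by (intro mult_left_mono hfun_le) auto
  also have "\<dots> = 1" using assms by (simp add: powr_mult[symmetric])
  finally show ?thesis .
qed

text \<open>This bound controls the remainder when the recursion is iterated.\<close>

lemma gg_ge:
  assumes "0 < a" "0 < s" "s \<le> 1"
  shows "1 - a * K * s \<le> gg a s"
proof -
  have "dl (1 / s) * (1 / s) powr (- \<alpha>) \<le> (K * s) * 1"
  proof (rule mult_mono)
    show "dl (1 / s) \<le> K * s" using dl_le[of "1 / s"] assms by simp
    show "(1 / s) powr (- \<alpha>) \<le> 1"
    proof -
      have "(1 / s) powr (- \<alpha>) = s powr \<alpha>"
        using assms by (simp add: powr_minus powr_divide)
      then show ?thesis using assms \<alpha> by (simp add: powr_le1)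
    qed
  qed (use K_nonneg assms in auto)
  then have "a * (dl (1 / s) * (1 / s) powr (- \<alpha>)) \<le> a * (K * s * 1)"
    using assms by (intro mult_left_mono) auto
  then have "1 - a * K * s \<le> 1 - a * dl (1 / s) * (1 / s) powr (- \<alpha>)" by (simp add: mult.assoc)
  also have "\<dots> \<le> (1 / s) powr a * hfun a (1 / s)" using assms by (intro hfun_ge) auto
  also have "\<dots> = gg a s" using assms by (simp add: gg_def powr_minus_divide powr_divide)
  finally show ?thesis .
qed

lemma gg_step:
  assumes a: "0 < a" and s: "0 < s"
  shows "(\<integral>\<^sup>+u. ennreal (kk (s * u) * gg (a + \<alpha>) (s * u)) * ennreal (beta_density a 1 u) \<partial>lborel) =
    ennreal (gg a s)"
proof -
  \<comment> \<open>\<open>F\<close> is a primitive of the integrand on \<open>(0,1)\<close>, extended continuously by \<open>0\<close> at \<open>0\<close>.\<close>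
  define F where "F u = (if u \<le> 0 then 0 else s powr (- a) * hfun a (1 / (s * u)))" for u
  define f where "f u = a * u powr (a - 1) * (kk (s * u) * gg (a + \<alpha>) (s * u))" for u
  have F_deriv: "(F has_real_derivative f u) (at u)" if u: "0 < u" for u
  proof -
    let ?w = "1 / (s * u)"
    have w: "0 < ?w" using s u by simp
    have "((\<lambda>u. 1 / (s * u)) has_real_derivative - (1 / (s * u\<^sup>2))) (at u)"
      using s u by (auto intro!: derivative_eq_intros simp: power2_eq_square field_simps)
    from DERIV_chain2[OF hfun_deriv[OF a w] this]
    have "((\<lambda>u. s powr (- a) * hfun a (1 / (s * u))) has_real_derivative
        s powr (- a) * (- (a * ?w powr (\<alpha> - 1) * kk (1 / ?w) * hfun (a + \<alpha>) ?w) * - (1 / (s * u\<^sup>2)))) (at u)"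
      by (rule DERIV_cmult)
    moreover have "s powr (- a) * (- (a * ?w powr (\<alpha> - 1) * kk (1 / ?w) * hfun (a + \<alpha>) ?w) * - (1 / (s * u\<^sup>2))) = f u"
    proof -
      have P: "s powr (- a) * (?w powr (\<alpha> - 1) * (1 / (s * u\<^sup>2))) = u powr (a - 1) * (s * u) powr (- (a + \<alpha>))"
      proof -
        have "s = exp (ln s)" "u = exp (ln u)" using s u by simp_all
        then obtain x y where xy: "s = exp x" "u = exp y" by metis
        have w: "?w = exp (- (x + y))" by (simp only: xy exp_add[symmetric] exp_minus inverse_eq_divide)
        have 2: "1 / (s * u\<^sup>2) = exp (- (x + 2 * y))"
          by (simp only: xy exp_double[symmetric] exp_add[symmetric] exp_minus inverse_eq_divide)
        have 3: "s * u = exp (x + y)" by (simp add: xy exp_add)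
        show ?thesis
          unfolding w 2 3 unfolding xy by (simp add: powr_def exp_add[symmetric] ln_div algebra_simps)
      qed
      have k: "kk (1 / ?w) = kk (s * u)" by simp
      have "s powr (- a) * (- (a * ?w powr (\<alpha> - 1) * kk (1 / ?w) * hfun (a + \<alpha>) ?w) * - (1 / (s * u\<^sup>2))) =
          (s powr (- a) * (?w powr (\<alpha> - 1) * (1 / (s * u\<^sup>2)))) * (a * kk (s * u) * hfun (a + \<alpha>) ?w)"
        by (simp only: k mult_minus_left mult_minus_right minus_minus mult_ac)
      also have "\<dots> = f u"
        unfolding P f_def gg_def by (simp only: mult_ac)
      finally show ?thesis .
    qed
    ultimately have "((\<lambda>u. s powr (- a) * hfun a (1 / (s * u))) has_real_derivative f u) (at u)" by simp
    then show ?thesis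
      by (rule has_field_derivative_transform_within_open[where S = "{0<..}"]) (use u in \<open>auto simp: F_def\<close>)
  qed
  have F_nonneg: "0 \<le> F u" for u by (simp add: F_def hfun_nonneg)
  have F_le: "F u \<le> u powr a" if "0 < u" for u
  proof -
    have "F u \<le> s powr (- a) * (1 / (s * u)) powr (- a)"
      using that s a unfolding F_def by (auto intro!: mult_left_mono hfun_le)
    also have "\<dots> = u powr a"
      using that s by (simp add: powr_minus_divide powr_divide powr_mult)
    finally show ?thesis .
  qed
  have cont: "continuous_on {0..1} F"
  proof (intro continuous_at_imp_continuous_on ballI)
    fix u :: real assume "u \<in> {0..1}"
    show "isCont F u"
    proof (cases "u = 0")
      case False
      then show ?thesis using \<open>u \<in> {0..1}\<close> F_deriv[of u] DERIV_isCont by auto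
    next
      case True
      have "((\<lambda>x. \<bar>x\<bar> powr a) \<longlongrightarrow> 0) (at 0)"
        using tendsto_powr'[of "\<lambda>x. \<bar>x\<bar>" 0 "at 0" "\<lambda>_. a" a] a
        by (auto intro!: tendsto_eq_intros)
      moreover have "\<forall>\<^sub>F x in at 0. norm (F x) \<le> \<bar>x\<bar> powr a"
        using F_le F_nonneg by (intro always_eventually) (auto simp: F_def)
      ultimately have "(F \<longlongrightarrow> 0) (at 0)" by (rule Lim_null_comparison[rotated])
      then show ?thesis by (simp add: True isCont_def F_def)
    qed
  qed
  have "(f has_integral (F 1 - F 0)) {0..1}"
    using cont F_deriv
    by (intro fundamental_theorem_of_calculus_interior)
      (auto simp: has_real_derivative_iff_has_vector_derivative[symmetric])
  moreover have "F 1 - F 0 = gg a s" by (simp add: F_def gg_def)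
  ultimately have I: "(f has_integral gg a s) {0..1}" by simp
  have "(\<integral>\<^sup>+u. ennreal (f u) * indicator {0..1} u \<partial>lborel) = ennreal (gg a s)"
    by (rule nn_integral_has_integral_lebesgue'[OF _ I])
      (use a in \<open>simp add: f_def kk_nonneg gg_nonneg\<close>)
  moreover have "(\<integral>\<^sup>+u. ennreal (kk (s * u) * gg (a + \<alpha>) (s * u)) * ennreal (beta_density a 1 u) \<partial>lborel) =
      (\<integral>\<^sup>+u. ennreal (f u) * indicator {0..1} u \<partial>lborel)"
    using AE_lborel_singleton[of "0::real"] AE_lborel_singleton[of "1::real"]
  proof (intro nn_integral_cong_AE, eventually_elim)
    case (elim u)
    show ?case
    proof (cases "0 < u \<and> u < 1")
      case True
      with a show ?thesis
        by (simp add: beta_density_1 f_def ennreal_mult[symmetric] kk_nonneg gg_nonneg mult_ac)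
    qed (use elim a in \<open>auto simp: beta_density_1 indicator_def\<close>)
  qed
  ultimately show ?thesis by simp
qed

lemma kk_measurable [measurable]: "kk \<in> borel_measurable borel"
  unfolding kk_def[abs_def] by measurable

lemma gg_measurable [measurable]: "gg a \<in> borel_measurable borel"
proof -
  have [measurable]: "dl \<in> borel_measurable borel" unfolding dl_def[abs_def] by measurable
  show ?thesis unfolding gg_def[abs_def] hfun_def[abs_def] by measurable
qed

end

section \<open>The unnormalised perpetuity\<close>

text \<open>The real random variable is given as a function \<open>\<pi> \<circ> Z\<close> because both variables of an \<^const>\<open>prob_space.indep_var\<close>
  pair have values in the same type.\<close>

lemma (in prob_space) nn_integral_indep_density:
  assumes ind: "indep_var S Y T Z" and \<pi> [measurable]: "\<pi> \<in> borel_measurable T"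
    and X: "distributed M lborel (\<lambda>\<omega>. \<pi> (Z \<omega>)) D"
    and F [measurable]: "F \<in> borel_measurable (S \<Otimes>\<^sub>M borel)"
  shows "(\<integral>\<^sup>+\<omega>. F (Y \<omega>, \<pi> (Z \<omega>)) \<partial>M) = (\<integral>\<^sup>+\<omega>. (\<integral>\<^sup>+x. F (Y \<omega>, x) * D x \<partial>lborel) \<partial>M)"
proof -
  have [measurable]: "Y \<in> M \<rightarrow>\<^sub>M S" "Z \<in> M \<rightarrow>\<^sub>M T"
    using ind by (auto dest: indep_var_rv1 indep_var_rv2)
  have D [measurable]: "D \<in> borel_measurable borel"
    using distributed_borel_measurable[OF X] by simp
  interpret Z: prob_space "distr M T Z" by (rule prob_space_distr) simp
  have inner: "(\<integral>\<^sup>+z. F (y, \<pi> z) \<partial>distr M T Z) = (\<integral>\<^sup>+x. F (y, x) * D x \<partial>lborel)"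
    if [measurable]: "y \<in> space S" for y
  proof -
    have "(\<integral>\<^sup>+z. F (y, \<pi> z) \<partial>distr M T Z) = (\<integral>\<^sup>+\<omega>. F (y, \<pi> (Z \<omega>)) \<partial>M)"
      by (subst nn_integral_distr) measurable
    also have "\<dots> = (\<integral>\<^sup>+x. D x * F (y, x) \<partial>lborel)"
      by (rule distributed_nn_integral[OF X, symmetric]) measurable
    finally show ?thesis by (simp add: mult.commute)
  qed
  have "(\<integral>\<^sup>+\<omega>. F (Y \<omega>, \<pi> (Z \<omega>)) \<partial>M) =
      (\<integral>\<^sup>+z. F (fst z, \<pi> (snd z)) \<partial>distr M (S \<Otimes>\<^sub>M T) (\<lambda>\<omega>. (Y \<omega>, Z \<omega>)))"
    by (subst nn_integral_distr) auto
  also have "\<dots> = (\<integral>\<^sup>+z. F (fst z, \<pi> (snd z)) \<partial>(distr M S Y \<Otimes>\<^sub>M distr M T Z))"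
    using ind by (simp add: indep_var_distribution_eq)
  also have "\<dots> = (\<integral>\<^sup>+y. (\<integral>\<^sup>+z. F (y, \<pi> z) \<partial>distr M T Z) \<partial>distr M S Y)"
    by (subst Z.nn_integral_fst[symmetric]) (auto cong: measurable_cong_sets)
  also have "\<dots> = (\<integral>\<^sup>+\<omega>. (\<integral>\<^sup>+z. F (Y \<omega>, \<pi> z) \<partial>distr M T Z) \<partial>M)"
    by (subst nn_integral_distr) auto
  also have "\<dots> = (\<integral>\<^sup>+\<omega>. (\<integral>\<^sup>+x. F (Y \<omega>, x) * D x \<partial>lborel) \<partial>M)"
    by (intro nn_integral_cong inner measurable_space[of Y M S]) auto
  finally show ?thesis .
qed

lemma (in prob_space) indep_vars_reindex_inj:
  assumes X: "indep_vars (\<lambda>_. N) X J" and h: "inj_on h I" "h ` I \<subseteq> J"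
  shows "indep_vars (\<lambda>_. N) (\<lambda>i. X (h i)) I"
  unfolding indep_vars_def2
proof (intro conjI ballI indep_setsI)
  fix i assume "i \<in> I"
  then have hi: "h i \<in> J" using h by auto
  then show "X (h i) \<in> M \<rightarrow>\<^sub>M N" using X by (auto simp: indep_vars_def2)
  show "{X (h i) -` A \<inter> space M | A. A \<in> sets N} \<subseteq> events"
    using X hi by (auto simp: indep_vars_def2 indep_sets_def)
next
  fix A K assume K: "K \<noteq> {}" "K \<subseteq> I" "finite K"
    and A: "\<forall>j\<in>K. A j \<in> {X (h j) -` A \<inter> space M | A. A \<in> sets N}"
  have inj: "inj_on h K" using h K by (auto intro: inj_on_subset)
  have inv: "inv_into K h (h j) = j" if "j \<in> K" for j using inj that by simp
  have "prob (\<Inter>j\<in>h ` K. A (inv_into K h j)) = (\<Prod>j\<in>h ` K. prob (A (inv_into K h j)))"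
  proof (rule indep_setsD)
    show "indep_sets (\<lambda>i. {X i -` A \<inter> space M | A. A \<in> sets N}) J"
      using X by (simp add: indep_vars_def2)
  qed (use K h A inv in auto)
  then show "prob (\<Inter>j\<in>K. A j) = (\<Prod>j\<in>K. prob (A j))"
    using inv inj by (simp add: prod.reindex)
qed

text \<open>The variables of the perpetuity and their products, indexed from \<open>0\<close>: \<open>g n\<close>, \<open>u n\<close>, \<open>P n\<close> and \<open>a n\<close>
  are \<open>G\<^sub>n\<^sub>+\<^sub>1\<close>, \<open>U\<^sub>n\<^sub>+\<^sub>1\<close>, \<open>\<Pi>\<^sub>n\<^sub>+\<^sub>1\<close> and \<open>\<theta> + (n + 1) \<alpha>\<close>.\<close>

locale perpetuity = prob_space B for B :: "'b measure" +
  fixes \<alpha> \<theta> :: real and G U :: "nat \<Rightarrow> 'b \<Rightarrow> real"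
  assumes \<alpha>: "0 \<le> \<alpha>" "\<alpha> < 1" and \<theta>: "- \<alpha> < \<theta>"
    and gbv: "gamma_beta_variables (1 - \<alpha>) (\<lambda>n. \<theta> + real n * \<alpha>) (\<lambda>_. 1) B G U"
begin

definition a :: "nat \<Rightarrow> real" where
  "a n = \<theta> + real (Suc n) * \<alpha>"

definition g :: "nat \<Rightarrow> 'b \<Rightarrow> real" where "g n = G (Suc n)"

definition u :: "nat \<Rightarrow> 'b \<Rightarrow> real" where "u n = U (Suc n)"

definition P :: "nat \<Rightarrow> 'b \<Rightarrow> real" where "P n \<omega> = (\<Prod>i<n. u i \<omega>)"

lemma a_pos: "0 < a n"
proof -
  have "0 \<le> real n * \<alpha>" using \<alpha> by simp
  then show ?thesis using \<theta> by (simp add: a_def algebra_simps)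
qed

lemma a_Suc: "a (Suc n) = a n + \<alpha>"
  by (simp add: a_def algebra_simps)

lemma g_distributed: "distributed B lborel (g n) (\<lambda>x. ennreal (gamma_density (1 - \<alpha>) x))"
  using gbv by (simp add: gamma_beta_variables_def g_def)

lemma u_distributed: "distributed B lborel (u n) (\<lambda>x. ennreal (beta_density (a n) 1 x))"
proof -
  have "\<forall>n\<ge>1. distributed B lborel (U n) (\<lambda>x. ennreal (beta_density (\<theta> + real n * \<alpha>) 1 x))"
    using gbv unfolding gamma_beta_variables_def by (elim conjE)
  from this[rule_format, of "Suc n"] show ?thesis by (simp add: u_def a_def)
qed

lemma g_measurable [measurable]: "g n \<in> borel_measurable B"
  using distributed_measurable[OF g_distributed] by simp

lemma u_measurable [measurable]: "u n \<in> borel_measurable B"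
  using distributed_measurable[OF u_distributed] by simp

lemma P_measurable [measurable]: "P n \<in> borel_measurable B"
  unfolding P_def[abs_def] by measurable

lemma Pi_prod_eq: "Pi_prod U (Suc n) \<omega> = P n \<omega>"
proof -
  have "{1..<Suc n} = Suc ` {..<n}" unfolding image_Suc_lessThan by auto
  then show ?thesis by (simp add: Pi_prod_def P_def u_def prod.reindex)
qed

lemma indep: "indep_vars (\<lambda>_. borel) (case_sum g u) UNIV"
proof -
  have "indep_vars (\<lambda>_. borel) (case_sum G U) ({1..} <+> {1..})"
    using gbv by (simp add: gamma_beta_variables_def)
  then have "indep_vars (\<lambda>i. borel) (\<lambda>i. case_sum G U (map_sum Suc Suc i)) UNIV"
  proof (rule indep_vars_reindex_inj)
    show "inj (map_sum Suc Suc)" by (intro sum.inj_map inj_Suc)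
    show "range (map_sum Suc Suc) \<subseteq> {1..} <+> {1..}"
    proof (rule image_subsetI)
      fix x :: "nat + nat"
      show "map_sum Suc Suc x \<in> {1..} <+> {1..}" by (cases x) auto
    qed
  qed
  moreover have "(\<lambda>i. case_sum G U (map_sum Suc Suc i)) = case_sum g u"
    by (auto simp: fun_eq_iff g_def u_def split: sum.split)
  ultimately show ?thesis by simp
qed

lemma g_pos: "AE \<omega> in B. \<forall>n. 0 < g n \<omega>"
proof -
  have "AE \<omega> in B. 0 < g n \<omega>" for n
  proof (rule distributed_AE2[OF g_distributed, THEN iffD2])
    show "AE x in lborel. 0 < ennreal (gamma_density (1 - \<alpha>) x) \<longrightarrow> 0 < x"
      by (auto simp: gamma_density_def)
  qed measurable
  then show ?thesis by (simp add: AE_all_countable)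
qed

lemma u_bounds: "AE \<omega> in B. \<forall>n. 0 < u n \<omega> \<and> u n \<omega> < 1"
proof -
  have "AE \<omega> in B. 0 < u n \<omega> \<and> u n \<omega> < 1" for n
  proof (rule distributed_AE2[OF u_distributed, THEN iffD2])
    show "AE x in lborel. 0 < ennreal (beta_density (a n) 1 x) \<longrightarrow> 0 < x \<and> x < 1"
      by (auto simp: beta_density_def)
  qed measurable
  then show ?thesis by (simp add: AE_all_countable)
qed

lemma P_bounds: "AE \<omega> in B. \<forall>n. 0 < P n \<omega> \<and> P n \<omega> \<le> 1"
  using u_bounds
proof eventually_elim
  case (elim \<omega>)
  have "0 < P n \<omega>" for n unfolding P_def by (rule prod_pos) (use elim in auto)
  moreover have "P n \<omega> \<le> 1" for n
    unfolding P_def by (rule prod_le_1) (use elim in \<open>auto intro: less_imp_le\<close>)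
  ultimately show ?case by simp
qed

text \<open>A variable outside of the index set \<open>J\<close> may be integrated out against its density.\<close>

lemma integrate_out:
  assumes X: "distributed B lborel (case_sum g u i) D" and i: "i \<notin> J"
    and F: "F \<in> borel_measurable (Pi\<^sub>M J (\<lambda>_. borel) \<Otimes>\<^sub>M borel)"
  shows "(\<integral>\<^sup>+\<omega>. F (restrict (\<lambda>i. case_sum g u i \<omega>) J, case_sum g u i \<omega>) \<partial>B) =
    (\<integral>\<^sup>+\<omega>. (\<integral>\<^sup>+x. F (restrict (\<lambda>i. case_sum g u i \<omega>) J, x) * D x \<partial>lborel) \<partial>B)"
proof -
  have "indep_var (Pi\<^sub>M J (\<lambda>_. borel)) (\<lambda>\<omega>. restrict (\<lambda>i. case_sum g u i \<omega>) J)
      (Pi\<^sub>M {i} (\<lambda>_. borel)) (\<lambda>\<omega>. restrict (\<lambda>i. case_sum g u i \<omega>) {i})"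
    using i by (intro indep_var_restrict[OF indep]) auto
  from nn_integral_indep_density[OF this, of "\<lambda>x. x i" D F] X F show ?thesis
    by simp
qed

subsection \<open>Means and convergence\<close>

text \<open>\<open>p n\<close> is the mean of \<open>P n\<close>.\<close>

definition p :: "nat \<Rightarrow> real" where "p n = (\<Prod>i<n. a i / (a i + 1))"

lemma p_pos: "0 < p n"
  using a_pos by (auto simp: p_def intro!: prod_pos divide_pos_pos add_pos_pos)

lemma mean_P: "(\<integral>\<^sup>+\<omega>. ennreal (P n \<omega>) \<partial>B) = ennreal (p n)"
proof (induction n)
  case 0
  then show ?case by (simp add: P_def p_def emeasure_space_1)
next
  case (Suc n)
  let ?J = "{} <+> {..<n} :: (nat + nat) set"
  have "(\<integral>\<^sup>+\<omega>. ennreal (P (Suc n) \<omega>) \<partial>B) = (\<integral>\<^sup>+\<omega>. ennreal (P n \<omega>) * ennreal (u n \<omega>) \<partial>B)"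
    using P_bounds u_bounds
    by (intro nn_integral_cong_AE) (auto elim!: eventually_elim2 simp: P_def ennreal_mult' less_imp_le)
  also have "\<dots> = (\<integral>\<^sup>+\<omega>. (\<integral>\<^sup>+x. ennreal (P n \<omega>) * ennreal x * ennreal (beta_density (a n) 1 x) \<partial>lborel) \<partial>B)"
  proof -
    let ?F = "\<lambda>(y, x). ennreal (\<Prod>i<n. y (Inr i)) * ennreal x"
    have "(\<lambda>x. fst x (Inr i)) \<in> borel_measurable (Pi\<^sub>M ?J (\<lambda>_. borel) \<Otimes>\<^sub>M (borel :: real measure))"
      if "i \<in> {..<n}" for i
      by (rule measurable_compose[OF measurable_fst measurable_component_singleton]) (use that in auto)
    note c = this
    have "?F \<in> borel_measurable (Pi\<^sub>M ?J (\<lambda>_. borel) \<Otimes>\<^sub>M borel)"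
      unfolding case_prod_beta
      by (intro borel_measurable_times_ennreal measurable_compose[OF _ measurable_ennreal]
          borel_measurable_prod measurable_snd c)
    moreover have "?F (restrict (\<lambda>i. case_sum g u i \<omega>) ?J, x) = ennreal (P n \<omega>) * ennreal x" for \<omega> x
    proof -
      have "(\<Prod>i<n. restrict (\<lambda>i. case_sum g u i \<omega>) ?J (Inr i)) = P n \<omega>"
        unfolding P_def by (rule prod.cong) auto
      then show ?thesis by (simp only: prod.case)
    qed
    moreover have "distributed B lborel (case_sum g u (Inr n)) (\<lambda>x. ennreal (beta_density (a n) 1 x))"
      using u_distributed by simp
    moreover have "Inr n \<notin> ?J" by auto
    ultimately show ?thesis
      using integrate_out[of "Inr n" "\<lambda>x. ennreal (beta_density (a n) 1 x)" ?J ?F] by simp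
  qed
  also have "\<dots> = (\<integral>\<^sup>+\<omega>. ennreal (P n \<omega>) * ennreal (a n / (a n + 1)) \<partial>B)"
  proof (intro nn_integral_cong)
    fix \<omega>
    have "(\<integral>\<^sup>+x. ennreal (P n \<omega>) * ennreal x * ennreal (beta_density (a n) 1 x) \<partial>lborel) =
        (\<integral>\<^sup>+x. ennreal (P n \<omega>) * (ennreal (x powr 1) * ennreal (beta_density (a n) 1 x)) \<partial>lborel)"
      by (intro nn_integral_cong) (auto simp: beta_density_def mult.assoc)
    then show "(\<integral>\<^sup>+x. ennreal (P n \<omega>) * ennreal x * ennreal (beta_density (a n) 1 x) \<partial>lborel) =
        ennreal (P n \<omega>) * ennreal (a n / (a n + 1))"
      using nn_integral_beta_density_power[OF a_pos, of 1 n] by (simp add: nn_integral_cmult)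
  qed
  also have "\<dots> = ennreal (p n) * ennreal (a n / (a n + 1))"
    using Suc by (simp add: nn_integral_multc)
  also have "\<dots> = ennreal (p (Suc n))"
    using p_pos[of n] a_pos[of n] by (simp add: p_def ennreal_mult[symmetric])
  finally show ?case .
qed

lemma mean_gP: "(\<integral>\<^sup>+\<omega>. ennreal (g n \<omega> * P n \<omega>) \<partial>B) = ennreal ((1 - \<alpha>) * p n)"
proof -
  let ?J = "{} <+> {..<n} :: (nat + nat) set"
  have "(\<integral>\<^sup>+\<omega>. ennreal (g n \<omega> * P n \<omega>) \<partial>B) = (\<integral>\<^sup>+\<omega>. ennreal (P n \<omega>) * ennreal (g n \<omega>) \<partial>B)"
    using P_bounds g_pos
    by (intro nn_integral_cong_AE) (auto elim!: eventually_elim2 simp: ennreal_mult' less_imp_le mult.commute)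
  also have "\<dots> = (\<integral>\<^sup>+\<omega>. (\<integral>\<^sup>+x. ennreal (P n \<omega>) * ennreal x * ennreal (gamma_density (1 - \<alpha>) x) \<partial>lborel) \<partial>B)"
  proof -
    let ?F = "\<lambda>(y, x). ennreal (\<Prod>i<n. y (Inr i)) * ennreal x"
    have "(\<lambda>x. fst x (Inr i)) \<in> borel_measurable (Pi\<^sub>M ?J (\<lambda>_. borel) \<Otimes>\<^sub>M (borel :: real measure))"
      if "i \<in> {..<n}" for i
      by (rule measurable_compose[OF measurable_fst measurable_component_singleton]) (use that in auto)
    note c = this
    have "?F \<in> borel_measurable (Pi\<^sub>M ?J (\<lambda>_. borel) \<Otimes>\<^sub>M borel)"
      unfolding case_prod_beta
      by (intro borel_measurable_times_ennreal measurable_compose[OF _ measurable_ennreal]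
          borel_measurable_prod measurable_snd c)
    moreover have "?F (restrict (\<lambda>i. case_sum g u i \<omega>) ?J, x) = ennreal (P n \<omega>) * ennreal x" for \<omega> x
    proof -
      have "(\<Prod>i<n. restrict (\<lambda>i. case_sum g u i \<omega>) ?J (Inr i)) = P n \<omega>"
        unfolding P_def by (rule prod.cong) auto
      then show ?thesis by (simp only: prod.case)
    qed
    moreover have "distributed B lborel (case_sum g u (Inl n)) (\<lambda>x. ennreal (gamma_density (1 - \<alpha>) x))"
      using g_distributed by simp
    moreover have "Inl n \<notin> ?J" by auto
    ultimately show ?thesis
      using integrate_out[of "Inl n" "\<lambda>x. ennreal (gamma_density (1 - \<alpha>) x)" ?J ?F] by simp
  qed
  also have "\<dots> = (\<integral>\<^sup>+\<omega>. ennreal (P n \<omega>) * ennreal (1 - \<alpha>) \<partial>B)"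
    using nn_integral_gamma_density_mean[of "1 - \<alpha>"] \<alpha>
    by (simp add: nn_integral_cmult mult.assoc)
  also have "\<dots> = ennreal ((1 - \<alpha>) * p n)"
    using p_pos[of n] \<alpha>
    by (subst nn_integral_multc) (auto simp: mean_P ennreal_mult[symmetric] mult.commute)
  finally show ?thesis .
qed

text \<open>With \<open>x n = a n + 1 - \<alpha>\<close>, one has \<open>x n p n - x (n + 1) p (n + 1) = (1 - \<alpha>) p n\<close>, since
  \<open>x (n + 1) p (n + 1) = a n p n\<close>; hence the means are summable.\<close>

lemma p_step: "(a (Suc n) + 1 - \<alpha>) * p (Suc n) = a n * p n"
  using a_pos[of n] by (simp add: p_def a_Suc field_simps)

lemma p_telescope: "(\<Sum>i<n. (1 - \<alpha>) * p i) = (a 0 + 1 - \<alpha>) - (a n + 1 - \<alpha>) * p n"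
proof (induction n)
  case (Suc n)
  then show ?case using p_step[of n] by (simp add: algebra_simps)
qed (simp add: p_def)

lemma summable_p: "summable p"
proof -
  have "(\<Sum>i<n. (1 - \<alpha>) * p i) \<le> a 0 + 1 - \<alpha>" for n
    using p_telescope[of n] a_pos[of n] p_pos[of n] \<alpha> by simp
  then have "summable (\<lambda>i. (1 - \<alpha>) * p i)"
    using p_pos \<alpha> by (intro summableI_nonneg_bounded) (auto intro: less_imp_le)
  then show ?thesis using \<alpha> by (simp add: summable_cmult_iff)
qed

text \<open>The sequence is decreasing, and a positive limit would make \<open>p n\<close> at least of order \<open>1 / n\<close>, which
  is not summable.\<close>

lemma a_p_tendsto: "(\<lambda>n. a n * p n) \<longlonglongrightarrow> 0"
proof -
  have dec: "decseq (\<lambda>n. a n * p n)"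
  proof (rule decseq_SucI)
    fix n
    have "a (Suc n) * p (Suc n) \<le> (a (Suc n) + 1 - \<alpha>) * p (Suc n)"
      using \<alpha> p_pos[of "Suc n"] by (intro mult_right_mono) auto
    then show "a (Suc n) * p (Suc n) \<le> a n * p n" by (simp add: p_step)
  qed
  have nn: "0 \<le> a n * p n" for n using a_pos[of n] p_pos[of n] by simp
  obtain l where l: "(\<lambda>n. a n * p n) \<longlonglongrightarrow> l" "\<And>n. l \<le> a n * p n"
    using decseq_convergent[OF dec, of 0] nn by blast
  have "0 \<le> l" using l(1) nn by (intro LIMSEQ_le_const) auto
  moreover have "\<not> 0 < l"
  proof
    assume "0 < l"
    define A where "A = \<bar>\<theta>\<bar> + 1"
    have A: "0 < A" by (simp add: A_def)
    have bound: "norm (l / A * (1 / real (Suc n))) \<le> p n" for n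
    proof -
      have "real (Suc n) * \<alpha> \<le> real (Suc n) * 1" using \<alpha> by (intro mult_left_mono) auto
      moreover have "\<bar>\<theta>\<bar> * 1 \<le> \<bar>\<theta>\<bar> * real (Suc n)" by (intro mult_left_mono) auto
      then have "\<theta> \<le> \<bar>\<theta>\<bar> * real (Suc n)" by linarith
      ultimately have "\<theta> + real (Suc n) * \<alpha> \<le> \<bar>\<theta>\<bar> * real (Suc n) + real (Suc n) * 1"
        by (rule add_mono[rotated])
      then have "a n \<le> A * real (Suc n)"
        by (simp only: a_def A_def distrib_right mult_1_left mult_1_right)
      then have "l \<le> A * real (Suc n) * p n"
        using l(2)[of n] p_pos[of n] by (meson less_imp_le mult_right_mono order_trans)
      then have "l / (A * real (Suc n)) \<le> p n"
        using A by (subst pos_divide_le_eq) (auto simp: mult_ac)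
      then show ?thesis using A \<open>0 < l\<close> by simp
    qed
    have "summable (\<lambda>n. l / A * (1 / real (Suc n)))"
      by (rule summable_comparison_test'[OF summable_p bound])
    then have "summable (\<lambda>n. 1 / real (Suc n))"
      by (rule summable_mult_D) (use A \<open>0 < l\<close> in simp)
    then have "summable (\<lambda>n. real n powr (- 1))"
      by (subst summable_Suc_iff[symmetric]) (simp add: powr_minus_divide)
    then have "(- 1 :: real) < - 1" by (simp only: summable_real_powr_iff)
    then show False by simp
  qed
  ultimately show ?thesis using l(1) by simp
qed

lemma summable_gP: "AE \<omega> in B. summable (\<lambda>n. g n \<omega> * P n \<omega>)"
proof -
  have "(\<integral>\<^sup>+\<omega>. (\<Sum>n. ennreal (g n \<omega> * P n \<omega>)) \<partial>B) = (\<Sum>n. ennreal ((1 - \<alpha>) * p n))"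
    by (subst nn_integral_suminf) (auto simp: mean_gP)
  also have "\<dots> \<noteq> \<infinity>"
    using summable_p p_pos \<alpha> by (subst suminf_ennreal2) (auto intro: summable_mult less_imp_le)
  finally have "AE \<omega> in B. (\<Sum>n. ennreal (g n \<omega> * P n \<omega>)) \<noteq> \<infinity>"
    by (intro nn_integral_noteq_infinite) auto
  then show ?thesis
    using g_pos P_bounds
  proof eventually_elim
    case (elim \<omega>)
    then show ?case by (intro summable_suminf_not_top) (auto intro: less_imp_le)
  qed
qed

text \<open>The point measure of the perpetuity before normalisation.\<close>

definition X :: "'b \<Rightarrow> real measure" where
  "X \<omega> = point_measure borel UNIV (\<lambda>n. g n \<omega> * P n \<omega>)"

lemma X_measurable [measurable]: "X \<in> B \<rightarrow>\<^sub>M measure_algebra borel"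
  unfolding X_def[abs_def] by (rule measurable_point_measure) measurable

lemma normalise_X: "AE \<omega> in B. normalisable (X \<omega>) \<and> normalise (X \<omega>) = perpetuity_partition G U \<omega>"
  using summable_gP g_pos P_bounds
proof eventually_elim
  case (elim \<omega>)
  have "perpetuity_partition G U \<omega> =
      point_measure borel UNIV (\<lambda>n. g n \<omega> * P n \<omega> / (\<Sum>n. g n \<omega> * P n \<omega>))"
    unfolding perpetuity_partition_def point_measure_shift perpetuity_sum_def
    by (simp add: Pi_prod_eq g_def)
  moreover have "normalise (X \<omega>) =
      point_measure borel UNIV (\<lambda>n. g n \<omega> * P n \<omega> / (\<Sum>n. if n \<in> UNIV then g n \<omega> * P n \<omega> else 0))"
    unfolding X_def using elim by (intro normalise_point_measure) auto
  moreover have "normalisable (X \<omega>)"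
    unfolding X_def using elim by (intro normalise_point_measure) auto
  ultimately show ?case by simp
qed

end

context perpetuity
begin

subsection \<open>The Laplace functional of the perpetuity\<close>

text \<open>Coordinate versions, on sequences of values of the \<open>g n\<close> (left summand) and \<open>u n\<close> (right summand),
  of the product \<open>P n\<close> and of the contribution of the first \<open>n\<close> points to the Laplace functional.\<close>

definition Pf :: "nat \<Rightarrow> (nat + nat \<Rightarrow> real) \<Rightarrow> real" where
  "Pf n y = (\<Prod>i<n. y (Inr i))"

definition Hf :: "(real \<Rightarrow> real) \<Rightarrow> real \<Rightarrow> nat \<Rightarrow> (nat + nat \<Rightarrow> real) \<Rightarrow> real" where
  "Hf q s n y = (\<Prod>j<n. q (s * (y (Inl j) * Pf j y)))"

abbreviation z :: "'b \<Rightarrow> nat + nat \<Rightarrow> real" where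
  "z \<omega> \<equiv> (\<lambda>i. case_sum g u i \<omega>)"

lemma Pf_z: "Pf n (z \<omega>) = P n \<omega>"
  by (simp add: Pf_def P_def)

lemma Pf_restrict: "Pf n (restrict y ({..<m} <+> {..<n})) = Pf n y"
  unfolding Pf_def by (rule prod.cong) auto

lemma Hf_restrict:
  assumes "m \<le> Suc n"
  shows "Hf q s m (restrict y ({..<m} <+> {..<n})) = Hf q s m y"
  unfolding Hf_def
proof (rule prod.cong[OF refl])
  fix j assume j: "j \<in> {..<m}"
  have "Pf j (restrict y ({..<m} <+> {..<n})) = Pf j y"
    unfolding Pf_def using j assms by (intro prod.cong) auto
  moreover have "restrict y ({..<m} <+> {..<n}) (Inl j) = y (Inl j)"
    using j by auto
  ultimately show "q (s * (restrict y ({..<m} <+> {..<n}) (Inl j) * Pf j (restrict y ({..<m} <+> {..<n})))) =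
      q (s * (y (Inl j) * Pf j y))" by (simp only:)
qed

lemma Pf_measurable:
  "(\<lambda>x. Pf n (fst x)) \<in> borel_measurable (Pi\<^sub>M ({..<m} <+> {..<n}) (\<lambda>_. borel) \<Otimes>\<^sub>M (borel :: real measure))"
  unfolding Pf_def
  by (intro borel_measurable_prod measurable_compose[OF measurable_fst measurable_component_singleton]) auto

lemma Hf_measurable:
  assumes "m \<le> Suc n" and q: "q \<in> borel_measurable borel"
  shows "(\<lambda>x. Hf q s m (fst x)) \<in>
    borel_measurable (Pi\<^sub>M ({..<m} <+> {..<n}) (\<lambda>_. borel) \<Otimes>\<^sub>M (borel :: real measure))"
  unfolding Hf_def Pf_def using assms(1)
  by (intro borel_measurable_prod measurable_compose[OF _ q] borel_measurable_times borel_measurable_const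
      measurable_compose[OF measurable_fst measurable_component_singleton]) auto

lemma laplace_X:
  assumes f [measurable]: "f \<in> borel_measurable borel" and \<epsilon>: "0 < \<epsilon>" "\<And>x. x \<le> \<epsilon> \<Longrightarrow> f x = 0"
    and s: "0 < s" "s \<le> 1"
  shows "expectation (\<lambda>\<omega>. nexp (\<integral>\<^sup>+x. f (s * x) \<partial>X \<omega>)) =
    laplace_test.kk \<alpha> (\<lambda>x. nexp (f x)) s * laplace_test.gg \<alpha> (\<lambda>x. nexp (f x)) (\<theta> + \<alpha>) s"
proof -
  define q where "q x = nexp (f x)" for x
  have q [measurable]: "q \<in> borel_measurable borel" unfolding q_def[abs_def] by measurable
  interpret T: laplace_test \<alpha> \<epsilon> q
    by unfold_locales (use \<alpha> \<epsilon> in \<open>auto simp: q_def\<close>)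
  have q01: "0 \<le> q x" "q x \<le> 1" for x by (auto simp: q_def)
  define H where "H n \<omega> = Hf q s n (z \<omega>)" for n \<omega>
  have H_eq: "H n \<omega> = (\<Prod>j<n. q (s * (g j \<omega> * P j \<omega>)))" for n \<omega>
    by (simp add: H_def Hf_def Pf_z)
  have H01: "0 \<le> H n \<omega>" "H n \<omega> \<le> 1" for n \<omega>
    unfolding H_eq using q01 by (auto intro!: prod_nonneg prod_le_1)
  have H_meas [measurable]: "H n \<in> borel_measurable B" for n
    unfolding H_eq[abs_def] by measurable
  have kg: "0 \<le> T.kk x * T.gg b x" for x b by (simp add: T.kk_nonneg T.gg_nonneg)
  \<comment> \<open>Integrating out \<open>g n\<close> and then \<open>u n\<close> leaves the expectation of
    \<open>H n * kk (s P n) * gg (a n) (s P n)\<close> constant in \<open>n\<close>; at \<open>n = 0\<close> it is the claimed value.\<close>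
  have stepG: "(\<integral>\<^sup>+\<omega>. ennreal (H (Suc n) \<omega>) * ennreal (T.gg (a n) (s * P n \<omega>)) \<partial>B) =
      (\<integral>\<^sup>+\<omega>. ennreal (H n \<omega>) * ennreal (T.kk (s * P n \<omega>) * T.gg (a n) (s * P n \<omega>)) \<partial>B)" for n
  proof -
    let ?J = "{..<n} <+> {..<n} :: (nat + nat) set"
    let ?F = "\<lambda>x. ennreal (Hf q s n (fst x)) * ennreal (T.gg (a n) (s * Pf n (fst x))) *
      ennreal (q (s * Pf n (fst x) * snd x))"
    note [measurable] = Pf_measurable[of n n] Hf_measurable[of n n q s, OF _ q, simplified]
    have F: "?F \<in> borel_measurable (Pi\<^sub>M ?J (\<lambda>_. borel) \<Otimes>\<^sub>M borel)"
      by measurable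
    have F_eq: "?F (restrict (z \<omega>) ?J, x) =
        ennreal (H n \<omega>) * ennreal (T.gg (a n) (s * P n \<omega>)) * ennreal (q (s * P n \<omega> * x))" for \<omega> x
      by (simp only: fst_conv snd_conv Hf_restrict[of n n, simplified] Pf_restrict Pf_z H_def)
    have "(\<integral>\<^sup>+\<omega>. ennreal (H (Suc n) \<omega>) * ennreal (T.gg (a n) (s * P n \<omega>)) \<partial>B) =
        (\<integral>\<^sup>+\<omega>. ?F (restrict (z \<omega>) ?J, case_sum g u (Inl n) \<omega>) \<partial>B)"
      unfolding F_eq H_eq using H01(1)[of n] q01
      by (intro nn_integral_cong) (simp add: ennreal_mult prod_nonneg mult_ac)
    also have "\<dots> = (\<integral>\<^sup>+\<omega>. (\<integral>\<^sup>+x. ?F (restrict (z \<omega>) ?J, x) * ennreal (gamma_density (1 - \<alpha>) x) \<partial>lborel) \<partial>B)"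
      by (rule integrate_out[OF _ _ F]) (auto simp: g_distributed)
    also have "\<dots> = (\<integral>\<^sup>+\<omega>. ennreal (H n \<omega>) * ennreal (T.kk (s * P n \<omega>) * T.gg (a n) (s * P n \<omega>)) \<partial>B)"
      unfolding F_eq
    proof (rule nn_integral_cong)
      fix \<omega>
      let ?c = "ennreal (H n \<omega>) * ennreal (T.gg (a n) (s * P n \<omega>))"
      have "(\<integral>\<^sup>+x. ?c * ennreal (q (s * P n \<omega> * x)) * ennreal (gamma_density (1 - \<alpha>) x) \<partial>lborel) =
          (\<integral>\<^sup>+x. ?c * (ennreal (q (s * P n \<omega> * x)) * ennreal (gamma_density (1 - \<alpha>) x)) \<partial>lborel)"
        by (simp only: mult.assoc)
      also have "\<dots> = ?c * ennreal (T.kk (s * P n \<omega>))"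
        by (subst nn_integral_cmult) (simp_all add: T.nn_integral_kk)
      also have "\<dots> = ennreal (H n \<omega>) * ennreal (T.kk (s * P n \<omega>) * T.gg (a n) (s * P n \<omega>))"
        by (simp add: ennreal_mult T.kk_nonneg T.gg_nonneg mult_ac)
      finally show "(\<integral>\<^sup>+x. ?c * ennreal (q (s * P n \<omega> * x)) * ennreal (gamma_density (1 - \<alpha>) x) \<partial>lborel) =
          ennreal (H n \<omega>) * ennreal (T.kk (s * P n \<omega>) * T.gg (a n) (s * P n \<omega>))" .
    qed
    finally show ?thesis .
  qed
  have stepU: "(\<integral>\<^sup>+\<omega>. ennreal (H (Suc n) \<omega>) * ennreal (T.kk (s * P (Suc n) \<omega>) * T.gg (a (Suc n)) (s * P (Suc n) \<omega>)) \<partial>B) =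
      (\<integral>\<^sup>+\<omega>. ennreal (H (Suc n) \<omega>) * ennreal (T.gg (a n) (s * P n \<omega>)) \<partial>B)" for n
  proof -
    let ?J = "{..<Suc n} <+> {..<n} :: (nat + nat) set"
    let ?F = "\<lambda>x. ennreal (Hf q s (Suc n) (fst x)) *
      ennreal (T.kk (s * Pf n (fst x) * snd x) * T.gg (a n + \<alpha>) (s * Pf n (fst x) * snd x))"
    note [measurable] = Pf_measurable[of n "Suc n"] Hf_measurable[of "Suc n" n q s, OF _ q, simplified]
    have F: "?F \<in> borel_measurable (Pi\<^sub>M ?J (\<lambda>_. borel) \<Otimes>\<^sub>M borel)"
      by measurable
    have F_eq: "?F (restrict (z \<omega>) ?J, x) =
        ennreal (H (Suc n) \<omega>) * ennreal (T.kk (s * P n \<omega> * x) * T.gg (a n + \<alpha>) (s * P n \<omega> * x))" for \<omega> x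
      by (simp only: fst_conv snd_conv Hf_restrict[of "Suc n" n, simplified] Pf_restrict Pf_z H_def)
    have "(\<integral>\<^sup>+\<omega>. ennreal (H (Suc n) \<omega>) * ennreal (T.kk (s * P (Suc n) \<omega>) * T.gg (a (Suc n)) (s * P (Suc n) \<omega>)) \<partial>B) =
        (\<integral>\<^sup>+\<omega>. ?F (restrict (z \<omega>) ?J, case_sum g u (Inr n) \<omega>) \<partial>B)"
      unfolding F_eq by (intro nn_integral_cong) (simp add: P_def a_Suc mult.assoc)
    also have "\<dots> = (\<integral>\<^sup>+\<omega>. (\<integral>\<^sup>+x. ?F (restrict (z \<omega>) ?J, x) * ennreal (beta_density (a n) 1 x) \<partial>lborel) \<partial>B)"
      by (rule integrate_out[OF _ _ F]) (auto simp: u_distributed)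
    also have "\<dots> = (\<integral>\<^sup>+\<omega>. ennreal (H (Suc n) \<omega>) * ennreal (T.gg (a n) (s * P n \<omega>)) \<partial>B)"
    proof (rule nn_integral_cong_AE)
      show "AE \<omega> in B. (\<integral>\<^sup>+x. ?F (restrict (z \<omega>) ?J, x) * ennreal (beta_density (a n) 1 x) \<partial>lborel) =
          ennreal (H (Suc n) \<omega>) * ennreal (T.gg (a n) (s * P n \<omega>))"
        using P_bounds
      proof eventually_elim
        case (elim \<omega>)
        then have "0 < s * P n \<omega>" using s by simp
        from T.gg_step[OF a_pos this, of n] show ?case
          unfolding F_eq mult.assoc[of "ennreal (H (Suc n) \<omega>)"]
          by (subst nn_integral_cmult) simp_all
      qed
    qed
    finally show ?thesis .
  qed
  have const: "(\<integral>\<^sup>+\<omega>. ennreal (H n \<omega>) * ennreal (T.kk (s * P n \<omega>) * T.gg (a n) (s * P n \<omega>)) \<partial>B) =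
      ennreal (T.kk s * T.gg (\<theta> + \<alpha>) s)" for n
  proof (induction n)
    case 0
    then show ?case by (simp add: H_eq P_def a_def emeasure_space_1)
  next
    case (Suc n)
    then show ?case by (simp only: stepU stepG)
  qed
  have gg01: "AE \<omega> in B. 0 \<le> T.gg (a n) (s * P n \<omega>) \<and> T.gg (a n) (s * P n \<omega>) \<le> 1 \<and>
      1 - T.gg (a n) (s * P n \<omega>) \<le> a n * T.K * P n \<omega>" for n
    using P_bounds
  proof eventually_elim
    case (elim \<omega>)
    then have P: "0 < P n \<omega>" "P n \<omega> \<le> 1" by auto
    have sP: "0 < s * P n \<omega>" "s * P n \<omega> \<le> 1" "s * P n \<omega> \<le> P n \<omega>"
      using P s by (auto intro: mult_le_one mult_left_le_one_le)
    have "1 - T.gg (a n) (s * P n \<omega>) \<le> a n * T.K * (s * P n \<omega>)"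
      using T.gg_ge[OF a_pos sP(1,2), of n] by simp
    also have "\<dots> \<le> a n * T.K * P n \<omega>"
      using sP(3) a_pos[of n] T.K_nonneg by (intro mult_left_mono) auto
    finally show ?case using T.gg_nonneg T.gg_le_1[OF a_pos sP(1)] by auto
  qed
  have P_int: "integrable B (P n)" and P_exp: "expectation (P n) = p n" for n
  proof -
    have "AE \<omega> in B. 0 \<le> P n \<omega>" using P_bounds by eventually_elim (auto intro: less_imp_le)
    then have "has_bochner_integral B (P n) (p n)"
      using p_pos[of n] mean_P[of n] by (intro has_bochner_integral_nn_integral) auto
    then show "integrable B (P n)" "expectation (P n) = p n"
      by (auto simp: has_bochner_integral_iff)
  qed
  have gg_meas [measurable]: "(\<lambda>\<omega>. T.gg (a n) (s * P n \<omega>)) \<in> borel_measurable B" for n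
    by measurable
  have H_int: "integrable B (H n)" for n
    using H01 by (intro integrable_const_bound[where B = 1]) auto
  have Hg_int: "integrable B (\<lambda>\<omega>. H (Suc n) \<omega> * T.gg (a n) (s * P n \<omega>))" for n
  proof (rule integrable_const_bound[where B = 1])
    show "AE \<omega> in B. norm (H (Suc n) \<omega> * T.gg (a n) (s * P n \<omega>)) \<le> 1"
      using gg01[of n] by eventually_elim (use H01 in \<open>auto intro!: mult_le_one simp: abs_mult\<close>)
  qed measurable
  have Hg_exp: "expectation (\<lambda>\<omega>. H (Suc n) \<omega> * T.gg (a n) (s * P n \<omega>)) = T.kk s * T.gg (\<theta> + \<alpha>) s" for n
  proof -
    have "(\<integral>\<^sup>+\<omega>. ennreal (H (Suc n) \<omega> * T.gg (a n) (s * P n \<omega>)) \<partial>B) = ennreal (T.kk s * T.gg (\<theta> + \<alpha>) s)"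
      using stepG[of n] const[of n] by (simp add: ennreal_mult H01 T.gg_nonneg)
    then show ?thesis
      using H01 T.gg_nonneg kg by (subst integral_eq_nn_integral) auto
  qed
  \<comment> \<open>The factor \<open>gg\<close> differs from \<open>1\<close> by at most \<open>a n * K * P n\<close>, whose mean tends to \<open>0\<close>.\<close>
  have bound: "norm (expectation (H (Suc n)) - T.kk s * T.gg (\<theta> + \<alpha>) s) \<le> T.K * (a n * p n)" for n
  proof -
    have "expectation (H (Suc n)) - T.kk s * T.gg (\<theta> + \<alpha>) s =
        expectation (\<lambda>\<omega>. H (Suc n) \<omega> - H (Suc n) \<omega> * T.gg (a n) (s * P n \<omega>))"
      using H_int Hg_int Hg_exp by simp
    moreover have "0 \<le> expectation (\<lambda>\<omega>. H (Suc n) \<omega> - H (Suc n) \<omega> * T.gg (a n) (s * P n \<omega>))"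
    proof (rule integral_nonneg_AE)
      show "AE \<omega> in B. 0 \<le> H (Suc n) \<omega> - H (Suc n) \<omega> * T.gg (a n) (s * P n \<omega>)"
        using gg01[of n] by eventually_elim (use H01 in \<open>auto intro!: mult_left_le\<close>)
    qed
    moreover have "expectation (\<lambda>\<omega>. H (Suc n) \<omega> - H (Suc n) \<omega> * T.gg (a n) (s * P n \<omega>)) \<le>
        expectation (\<lambda>\<omega>. a n * T.K * P n \<omega>)"
    proof (rule integral_mono_AE)
      show "AE \<omega> in B. H (Suc n) \<omega> - H (Suc n) \<omega> * T.gg (a n) (s * P n \<omega>) \<le> a n * T.K * P n \<omega>"
        using gg01[of n]
      proof eventually_elim
        case (elim \<omega>)
        have "H (Suc n) \<omega> * (1 - T.gg (a n) (s * P n \<omega>)) \<le> 1 * (1 - T.gg (a n) (s * P n \<omega>))"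
          using elim H01 by (intro mult_right_mono) auto
        then show ?case using elim by (simp add: algebra_simps)
      qed
    qed (auto intro!: H_int Hg_int P_int)
    ultimately show ?thesis by (simp add: P_exp mult_ac)
  qed
  have "(\<lambda>n. expectation (H (Suc n))) \<longlonglongrightarrow> T.kk s * T.gg (\<theta> + \<alpha>) s"
  proof (rule LIM_zero_cancel, rule Lim_null_comparison)
    show "(\<lambda>n. T.K * (a n * p n)) \<longlonglongrightarrow> 0"
      by (rule tendsto_mult_right_zero[OF a_p_tendsto])
  qed (use bound in \<open>auto intro!: always_eventually\<close>)
  moreover have "(\<lambda>n. expectation (H (Suc n))) \<longlonglongrightarrow> expectation (\<lambda>\<omega>. nexp (\<integral>\<^sup>+x. f (s * x) \<partial>X \<omega>))"
  proof (rule integral_dominated_convergence[where w = "\<lambda>_. 1"])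
    show "AE \<omega> in B. (\<lambda>n. H (Suc n) \<omega>) \<longlonglongrightarrow> nexp (\<integral>\<^sup>+x. f (s * x) \<partial>X \<omega>)"
    proof (rule AE_I2)
      fix \<omega>
      have "(\<integral>\<^sup>+x. f (s * x) \<partial>X \<omega>) = (\<Sum>j. f (s * (g j \<omega> * P j \<omega>)))"
        unfolding X_def by (subst nn_integral_point_measure) auto
      then have "(\<lambda>n. H n \<omega>) \<longlonglongrightarrow> nexp (\<integral>\<^sup>+x. f (s * x) \<partial>X \<omega>)"
        using nexp_suminf[of "\<lambda>j. f (s * (g j \<omega> * P j \<omega>))"] by (simp add: H_eq q_def)
      then show "(\<lambda>n. H (Suc n) \<omega>) \<longlonglongrightarrow> nexp (\<integral>\<^sup>+x. f (s * x) \<partial>X \<omega>)"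
        by (rule LIMSEQ_Suc)
    qed
  qed (auto simp: H01)
  ultimately show ?thesis
    unfolding q_def[symmetric] by (rule LIMSEQ_unique[rotated])
qed

end

section \<open>Comparison of laws\<close>

lemma nn_integral_point_measure_mult:
  fixes I :: "nat set" and v :: "nat \<Rightarrow> real"
  assumes "f \<in> borel_measurable borel"
  shows "(\<integral>\<^sup>+x. f x \<partial>point_measure borel I (\<lambda>i. c * v i)) = (\<integral>\<^sup>+x. f (c * x) \<partial>point_measure borel I v)"
  using assms by (subst (1 2) nn_integral_point_measure) auto

lemma normalisable_point_measureD:
  fixes I :: "nat set" and v :: "nat \<Rightarrow> real"
  assumes pos: "\<And>i. i \<in> I \<Longrightarrow> 0 < v i" and n: "normalisable (point_measure borel I v)"
  shows "I \<noteq> {}" and "summable (\<lambda>i. if i \<in> I then v i else 0)"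
proof -
  have fm: "first_moment (point_measure borel I v) = (\<Sum>i. ennreal (if i \<in> I then v i else 0))"
    unfolding first_moment_def
    by (subst nn_integral_point_measure) (auto intro!: suminf_cong)
  show "I \<noteq> {}" using n fm by (auto simp: normalisable_def)
  show "summable (\<lambda>i. if i \<in> I then v i else 0)"
    using n fm pos by (intro summable_suminf_not_top) (auto simp: normalisable_def intro: less_imp_le)
qed

lemma emeasure_point_measure_nonpos:
  fixes I :: "nat set"
  assumes "\<And>i. i \<in> I \<Longrightarrow> 0 < v i"
  shows "emeasure (point_measure borel I v) {..0::real} = 0"
proof -
  have "emeasure (point_measure borel I v) {..0} = (\<Sum>i. if i \<in> I then indicator {..0} (v i) else 0)"
    by (subst emeasure_point_measure) auto
  also have "\<dots> = (\<Sum>i. 0)"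
    using assms by (intro suminf_cong) (force simp: indicator_def)
  finally show ?thesis by simp
qed

text \<open>Two random measures on \<open>(0,\<infinity>)\<close> with the same Laplace functional have the same law, hence so do
  their normalisations; and if one of them can be normalised almost surely, then so can the other.\<close>

lemma normalised_laws_eq:
  assumes M: "prob_space M" and N: "prob_space N"
    and X [measurable]: "X \<in> M \<rightarrow>\<^sub>M measure_algebra borel" and Y [measurable]: "Y \<in> N \<rightarrow>\<^sub>M measure_algebra borel"
    and X0: "AE \<omega> in M. emeasure (X \<omega>) {..0::real} = 0" and Yn: "AE \<omega> in N. normalisable (Y \<omega>)"
    and eq: "\<And>f \<epsilon>. f \<in> borel_measurable borel \<Longrightarrow> 0 < \<epsilon> \<Longrightarrow> (\<And>x. x \<le> \<epsilon> \<Longrightarrow> f x = 0) \<Longrightarrow>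
      (\<integral>\<omega>. nexp (\<integral>\<^sup>+x. f x \<partial>X \<omega>) \<partial>M) = (\<integral>\<omega>. nexp (\<integral>\<^sup>+x. f x \<partial>Y \<omega>) \<partial>N)"
  shows "AE \<omega> in M. normalisable (X \<omega>)"
    and "distr M (measure_algebra borel) (\<lambda>\<omega>. normalise (X \<omega>)) =
      distr N (measure_algebra borel) (\<lambda>\<omega>. normalise (Y \<omega>))"
proof -
  interpret M: prob_space M by fact
  interpret N: prob_space N by fact
  let ?A = "measure_algebra (borel :: real measure)"
  have laws: "distr M ?A X = distr N ?A Y"
  proof (rule laplace_functional_unique)
    show "prob_space (distr M ?A X)" by (rule M.prob_space_distr) fact
    show "prob_space (distr N ?A Y)" by (rule N.prob_space_distr) fact
    have set: "{m \<in> space ?A. emeasure m {..0::real} = 0} \<in> sets ?A" by measurable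
    show "AE m in distr M ?A X. emeasure m {..0} = 0"
      by (subst AE_distr_iff[OF X]) (use set X0 in simp_all)
    have "AE \<omega> in N. emeasure (Y \<omega>) {..0} = 0"
      using Yn by eventually_elim (simp add: normalisable_def)
    then show "AE m in distr N ?A Y. emeasure m {..0} = 0"
      by (subst AE_distr_iff[OF Y]) (use set in simp_all)
    show "(\<integral>m. nexp (\<integral>\<^sup>+x. f x \<partial>m) \<partial>distr M ?A X) = (\<integral>m. nexp (\<integral>\<^sup>+x. f x \<partial>m) \<partial>distr N ?A Y)"
      if [measurable]: "f \<in> borel_measurable borel" and "0 < \<epsilon>" "\<And>x. x \<le> \<epsilon> \<Longrightarrow> f x = 0" for f \<epsilon>
      using eq[OF that] by (subst (1 2) integral_distr) auto
  qed simp_all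
  have n: "{m \<in> space ?A. normalisable m} \<in> sets ?A" by measurable
  have "AE m in distr M ?A X. normalisable m"
    unfolding laws by (subst AE_distr_iff[OF Y n]) fact
  then show "AE \<omega> in M. normalisable (X \<omega>)"
    by (subst (asm) AE_distr_iff[OF X n])
  have "distr (distr M ?A X) ?A normalise = distr (distr N ?A Y) ?A normalise"
    by (simp only: laws)
  then show "distr M ?A (\<lambda>\<omega>. normalise (X \<omega>)) = distr N ?A (\<lambda>\<omega>. normalise (Y \<omega>))"
    by (simp add: distr_distr comp_def)
qed

context perpetuity
begin

lemma perpetuity_partition_measurable [measurable]:
  "perpetuity_partition G U \<in> B \<rightarrow>\<^sub>M measure_algebra borel"
proof -
  have "perpetuity_partition G U =
      (\<lambda>\<omega>. point_measure borel UNIV (\<lambda>n. g n \<omega> * P n \<omega> / (\<Sum>n. g n \<omega> * P n \<omega>)))"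
    unfolding perpetuity_partition_def point_measure_shift perpetuity_sum_def
    by (simp add: Pi_prod_eq g_def fun_eq_iff)
  moreover have "\<dots> \<in> B \<rightarrow>\<^sub>M measure_algebra borel"
    by (rule measurable_point_measure) measurable
  ultimately show ?thesis by simp
qed

lemma distr_perpetuity_partition:
  "distr B (measure_algebra borel) (perpetuity_partition G U) =
    distr B (measure_algebra borel) (\<lambda>\<omega>. normalise (X \<omega>))"
  using normalise_X by (intro distr_cong_AE) (auto elim: eventually_mono)

subsection \<open>The gamma process and index zero\<close>

lemma PD0_law_eq:
  assumes \<alpha>0: "\<alpha> = 0" and PD: "PD0_process \<theta> M Q"
  shows "PD0_law M Q = distr B (measure_algebra borel) (perpetuity_partition G U)"
proof -
  let ?A = "measure_algebra (borel :: real measure)"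
  define N where "N \<omega> = point_measure borel UNIV (\<lambda>i. Q i \<omega>)" for \<omega>
  have \<theta>_pos: "0 < \<theta>" using \<theta> \<alpha>0 by simp
  have Q_meas [measurable]: "Q i \<in> borel_measurable M" for i
    using PD by (simp add: PD0_process_def)
  have Q_pos: "0 < Q i \<omega>" if "\<omega> \<in> space M" for i \<omega>
    using PD that by (simp add: PD0_process_def)
  have pp: "poisson_process M (intensity0 \<theta>) N"
    using PD by (simp add: PD0_process_def N_def[abs_def])
  interpret M: prob_space M using pp by (rule poisson_process_prob_space)
  have N_meas [measurable]: "N \<in> M \<rightarrow>\<^sub>M ?A"
    unfolding N_def[abs_def] by (rule measurable_point_measure) measurable
  \<comment> \<open>The Poisson process has the law of \<open>U\<^sub>0 X\<close>, where \<open>U\<^sub>0\<close> is independent of \<open>X\<close> with density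
    \<open>beta(\<theta>,1)\<close>; the factor \<open>U\<^sub>0\<close> disappears in the normalisation.\<close>
  define D where "D = density lborel (\<lambda>t. ennreal (beta_density \<theta> 1 t))"
  interpret D: prob_space D
    by (rule prob_spaceI) (simp add: D_def emeasure_density nn_integral_beta_density \<theta>_pos)
  have [measurable_cong]: "sets D = sets borel" by (simp add: D_def)
  interpret DB: pair_prob_space D B ..
  define Y where "Y x = point_measure borel UNIV (\<lambda>n. fst x * (g n (snd x) * P n (snd x)))" for x :: "real \<times> 'b"
  have Y_meas [measurable]: "Y \<in> D \<Otimes>\<^sub>M B \<rightarrow>\<^sub>M ?A"
    unfolding Y_def[abs_def] by (rule measurable_point_measure) measurable
  have D_pos: "AE t in D. 0 < t \<and> t < 1"
    unfolding D_def by (subst AE_density) (auto simp: beta_density_def)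
  have snd_law: "distr (D \<Otimes>\<^sub>M B) B snd = B"
  proof (rule measure_eqI)
    fix A assume "A \<in> sets (distr (D \<Otimes>\<^sub>M B) B snd)"
    then have A: "A \<in> sets B" by simp
    then have "snd -` A \<inter> space (D \<Otimes>\<^sub>M B) = space D \<times> A"
      using sets.sets_into_space[OF A] by (auto simp: space_pair_measure)
    then show "emeasure (distr (D \<Otimes>\<^sub>M B) B snd) A = emeasure B A"
      using A by (simp add: emeasure_distr emeasure_pair_measure_Times D.emeasure_space_1)
  qed simp
  have Y_norm: "AE x in D \<Otimes>\<^sub>M B. normalisable (Y x) \<and> normalise (Y x) = normalise (X (snd x))"
  proof -
    have 1: "AE x in D \<Otimes>\<^sub>M B. 0 < fst x"
      by (rule DB.AE_pair_measure) (use D_pos in \<open>auto elim: eventually_mono\<close>)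
    have 2: "AE x in D \<Otimes>\<^sub>M B. summable (\<lambda>n. g n (snd x) * P n (snd x)) \<and> (\<forall>n. 0 < g n (snd x)) \<and> (\<forall>n. 0 < P n (snd x))"
    proof -
      have "AE \<omega> in B. summable (\<lambda>n. g n \<omega> * P n \<omega>) \<and> (\<forall>n. 0 < g n \<omega>) \<and> (\<forall>n. 0 < P n \<omega>)"
        using summable_gP g_pos P_bounds by eventually_elim auto
      then show ?thesis
        by (intro AE_distrD[OF measurable_snd[of D B]]) (simp only: snd_law)
    qed
    from 1 2 show ?thesis
    proof eventually_elim
      case (elim x)
      have pos: "0 < g n (snd x) * P n (snd x)" for n using elim by simp
      have "normalise (Y x) = normalise (X (snd x))"
        unfolding Y_def X_def using elim pos
        by (subst normalise_point_measure_mult, simp_all, subst normalise_point_measure, simp_all)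
      moreover have "normalisable (Y x)"
        unfolding Y_def using elim pos
        by (intro normalise_point_measure) (auto intro: summable_mult)
      ultimately show ?case by simp
    qed
  qed
  have main: "AE \<omega> in M. normalisable (N \<omega>)"
    "distr M ?A (\<lambda>\<omega>. normalise (N \<omega>)) = distr (D \<Otimes>\<^sub>M B) ?A (\<lambda>x. normalise (Y x))"
  proof -
    have N0: "AE \<omega> in M. emeasure (N \<omega>) {..0} = 0"
      using Q_pos by (intro AE_I2) (simp add: N_def emeasure_point_measure_nonpos)
    have Yn: "AE x in D \<Otimes>\<^sub>M B. normalisable (Y x)"
      using Y_norm by eventually_elim simp
    have eq: "(\<integral>\<omega>. nexp (\<integral>\<^sup>+x. f x \<partial>N \<omega>) \<partial>M) = (\<integral>x. nexp (\<integral>\<^sup>+y. f y \<partial>Y x) \<partial>(D \<Otimes>\<^sub>M B))"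
      if f [measurable]: "f \<in> borel_measurable borel" and \<epsilon>: "0 < \<epsilon>" "\<And>x. x \<le> \<epsilon> \<Longrightarrow> f x = 0" for f \<epsilon>
    proof -
      define q where "q x = nexp (f x)" for x
      have q [measurable]: "q \<in> borel_measurable borel" unfolding q_def[abs_def] by measurable
      interpret T: laplace_test \<alpha> \<epsilon> q
        by unfold_locales (use \<alpha> \<epsilon> in \<open>auto simp: q_def\<close>)
      have dl1_eq: "(\<integral>\<^sup>+x. ennreal (1 - nexp (f x)) \<partial>intensity0 \<theta>) = ennreal (\<theta> * T.dl 1)"
      proof -
        have int: "integrable lborel (\<lambda>v. T.rho v * exp (- v))"
          using T.rho_integrable[of 1 0] by simp
        have "(\<integral>\<^sup>+x. ennreal (1 - nexp (f x)) \<partial>intensity0 \<theta>) =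
            (\<integral>\<^sup>+x. ennreal (\<theta> / x * exp (- x)) * indicator {0<..} x * ennreal (1 - nexp (f x)) \<partial>lborel)"
          unfolding intensity0_def by (subst nn_integral_density) auto
        also have "\<dots> = (\<integral>\<^sup>+x. ennreal \<theta> * ennreal (T.rho x * exp (- x)) \<partial>lborel)"
        proof (intro nn_integral_cong)
          fix x :: real
          show "ennreal (\<theta> / x * exp (- x)) * indicator {0<..} x * ennreal (1 - nexp (f x)) =
              ennreal \<theta> * ennreal (T.rho x * exp (- x))"
          proof (cases "0 < x")
            case True
            have "T.rho x = (1 - q x) / x"
              using True \<alpha>0 unfolding T.rho_def by (simp add: powr_minus_divide)
            then show ?thesis
              using True \<theta>_pos T.q_le_1[of x] by (simp add: q_def ennreal_mult[symmetric] mult_ac)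
          next
            case False
            then have "T.rho x = 0" using \<epsilon> by (intro T.rho_0) simp
            then show ?thesis using False by simp
          qed
        qed
        also have "\<dots> = ennreal \<theta> * (\<integral>\<^sup>+x. ennreal (T.rho x * exp (- x)) \<partial>lborel)"
          by (rule nn_integral_cmult) simp
        also have "(\<integral>\<^sup>+x. ennreal (T.rho x * exp (- x)) \<partial>lborel) = ennreal (T.dl 1)"
          using nn_integral_eq_integral[OF int] T.rho_nonneg by (simp add: T.dl_def)
        also have "ennreal \<theta> * ennreal (T.dl 1) = ennreal (\<theta> * T.dl 1)"
          using \<theta>_pos T.dl_nonneg[of 1] by (simp add: ennreal_mult)
        finally show ?thesis .
      qed
      have "sigma_finite_measure (intensity0 \<theta>)"
        unfolding intensity0_def
        by (subst sigma_finite_measure.sigma_finite_iff_density_finite[OF sigma_finite_lborel])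
          (auto simp: indicator_def)
      then have "(\<integral>\<omega>. nexp (\<integral>\<^sup>+x. f x \<partial>N \<omega>) \<partial>M) = nexp (ennreal (\<theta> * T.dl 1))"
        using poisson_laplace[OF pp] dl1_eq by (simp add: intensity0_def)
      also have "\<dots> = T.gg \<theta> 1"
        using \<theta>_pos T.dl_nonneg[of 1] by (simp add: nexp_ennreal T.gg_def T.hfun_0[OF \<alpha>0])
      finally have lhs: "(\<integral>\<omega>. nexp (\<integral>\<^sup>+x. f x \<partial>N \<omega>) \<partial>M) = T.gg \<theta> 1" .
      have Ym: "(\<lambda>x. nexp (\<integral>\<^sup>+y. f y \<partial>Y x)) \<in> borel_measurable (D \<Otimes>\<^sub>M B)" by measurable
      have "(\<integral>\<^sup>+x. ennreal (nexp (\<integral>\<^sup>+y. f y \<partial>Y x)) \<partial>(D \<Otimes>\<^sub>M B)) =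
          (\<integral>\<^sup>+t. (\<integral>\<^sup>+\<omega>. ennreal (nexp (\<integral>\<^sup>+y. f y \<partial>Y (t, \<omega>))) \<partial>B) \<partial>D)"
        using Ym by (subst nn_integral_fst[symmetric]) auto
      also have "\<dots> = (\<integral>\<^sup>+t. ennreal (T.kk t * T.gg \<theta> t) \<partial>D)"
      proof (rule nn_integral_cong_AE)
        show "AE t in D. (\<integral>\<^sup>+\<omega>. ennreal (nexp (\<integral>\<^sup>+y. f y \<partial>Y (t, \<omega>))) \<partial>B) = ennreal (T.kk t * T.gg \<theta> t)"
          using D_pos
        proof eventually_elim
          case (elim t)
          have "(\<integral>\<^sup>+\<omega>. ennreal (nexp (\<integral>\<^sup>+y. f y \<partial>Y (t, \<omega>))) \<partial>B) =
              (\<integral>\<^sup>+\<omega>. ennreal (nexp (\<integral>\<^sup>+x. f (t * x) \<partial>X \<omega>)) \<partial>B)"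
            by (simp add: Y_def X_def nn_integral_point_measure_mult[OF f])
          also have "\<dots> = ennreal (expectation (\<lambda>\<omega>. nexp (\<integral>\<^sup>+x. f (t * x) \<partial>X \<omega>)))"
            by (intro nn_integral_eq_integral integrable_const_bound[where B = 1]) auto
          also have "\<dots> = ennreal (T.kk t * T.gg \<theta> t)"
            using laplace_X[OF f \<epsilon>, of t] elim \<alpha>0 by (simp add: q_def[abs_def])
          finally show ?case .
        qed
      qed
      also have "\<dots> = (\<integral>\<^sup>+t. ennreal (beta_density \<theta> 1 t) * ennreal (T.kk t * T.gg \<theta> t) \<partial>lborel)"
        unfolding D_def by (rule nn_integral_density) auto
      also have "\<dots> = ennreal (T.gg \<theta> 1)"
        using T.gg_step[OF \<theta>_pos, of 1] \<alpha>0 by (simp add: mult.commute)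
      finally have "(\<integral>x. nexp (\<integral>\<^sup>+y. f y \<partial>Y x) \<partial>(D \<Otimes>\<^sub>M B)) = T.gg \<theta> 1"
        by (subst integral_eq_nn_integral) (auto simp: T.gg_nonneg)
      with lhs show ?thesis by simp
    qed
    show "AE \<omega> in M. normalisable (N \<omega>)"
      by (rule normalised_laws_eq(1)[OF M.prob_space_axioms DB.prob_space_axioms N_meas Y_meas N0 Yn eq])
    show "distr M ?A (\<lambda>\<omega>. normalise (N \<omega>)) = distr (D \<Otimes>\<^sub>M B) ?A (\<lambda>x. normalise (Y x))"
      by (rule normalised_laws_eq(2)[OF M.prob_space_axioms DB.prob_space_axioms N_meas Y_meas N0 Yn eq])
  qed
  have "PD0_law M Q = distr M ?A (\<lambda>\<omega>. normalise (N \<omega>))"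
    unfolding PD0_law_def
  proof (rule distr_cong_AE[OF refl refl])
    show "AE \<omega> in M. point_measure borel UNIV (\<lambda>i. Q i \<omega> / (\<Sum>j. Q j \<omega>)) = normalise (N \<omega>)"
      using main(1) AE_space
    proof eventually_elim
      case (elim \<omega>)
      then have pos: "\<And>i. i \<in> UNIV \<Longrightarrow> 0 < Q i \<omega>" using Q_pos by simp
      have "summable (\<lambda>i. if i \<in> UNIV then Q i \<omega> else 0)"
        using normalisable_point_measureD(2)[of UNIV "\<lambda>i. Q i \<omega>"] elim pos by (simp add: N_def)
      then show ?case
        using normalise_point_measure(1)[of UNIV "\<lambda>i. Q i \<omega>"] pos by (simp add: N_def)
    qed
    show "(\<lambda>\<omega>. point_measure borel UNIV (\<lambda>i. Q i \<omega> / (\<Sum>j. Q j \<omega>))) \<in> M \<rightarrow>\<^sub>M ?A"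
      by (rule measurable_point_measure) measurable
  qed measurable
  also have "\<dots> = distr (D \<Otimes>\<^sub>M B) ?A (\<lambda>x. normalise (Y x))" by (rule main(2))
  also have "\<dots> = distr (D \<Otimes>\<^sub>M B) ?A (\<lambda>x. normalise (X (snd x)))"
    using Y_norm by (intro distr_cong_AE) (auto elim: eventually_mono)
  also have "\<dots> = distr (distr (D \<Otimes>\<^sub>M B) B snd) ?A (\<lambda>\<omega>. normalise (X \<omega>))"
    by (subst distr_distr) (auto simp: comp_def)
  finally show ?thesis by (simp add: distr_perpetuity_partition snd_law)
qed

end

section \<open>Existence of gamma and beta sequences\<close>

lemma gamma_beta_variables_exist:
  fixes b :: "nat \<Rightarrow> real"
  assumes c: "0 < c" and b: "\<And>n. 1 \<le> n \<Longrightarrow> 0 < b n"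
  obtains M :: "(nat + nat \<Rightarrow> real) measure" and G U where "gamma_beta_variables c b (\<lambda>_. 1) M G U"
proof -
  \<comment> \<open>Nothing is known about \<open>b 0\<close>, so that it is replaced by \<open>1\<close>.\<close>
  define d :: "nat + nat \<Rightarrow> real \<Rightarrow> real" where "d = case_sum (\<lambda>_. gamma_density c) (\<lambda>n. beta_density (if n = 0 then 1 else b n) 1)"
  define L where "L i = density lborel (\<lambda>x. ennreal (d i x))" for i :: "nat + nat"
  have d_meas [measurable]: "d i \<in> borel_measurable borel" for i
    by (cases i) (simp_all add: d_def)
  have L: "prob_space (L i)" for i
    unfolding L_def using b
    by (intro prob_spaceI) (cases i; simp add: d_def emeasure_density nn_integral_gamma_density[OF c]
        nn_integral_beta_density)
  interpret product_prob_space L UNIV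
    using L by (simp add: product_prob_space_def product_prob_space_axioms_def product_sigma_finite_def
        prob_space_imp_sigma_finite)
  let ?M = "Pi\<^sub>M UNIV L"
  interpret P: prob_space ?M by (rule prob_space_PiM) (rule L)
  have dist: "distributed ?M lborel (\<lambda>\<omega>. \<omega> i) (\<lambda>x. ennreal (d i x))" for i
  proof -
    have "distr ?M lborel (\<lambda>\<omega>. \<omega> i) = distr ?M (L i) (\<lambda>\<omega>. \<omega> i)"
      by (rule distr_cong) (simp_all add: L_def)
    also have "\<dots> = L i" by (rule PiM_component) simp
    finally have "distr ?M lborel (\<lambda>\<omega>. \<omega> i) = density lborel (\<lambda>x. ennreal (d i x))" by (simp add: L_def)
    moreover have "(\<lambda>\<omega>. \<omega> i) \<in> ?M \<rightarrow>\<^sub>M lborel"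
      using measurable_component_singleton[of i UNIV L] by (simp add: L_def)
    ultimately show ?thesis by (auto simp: distributed_def)
  qed
  have ind: "P.indep_vars (\<lambda>_. borel) (\<lambda>i \<omega>. \<omega> i) UNIV"
  proof -
    have "P.indep_vars L (\<lambda>i \<omega>. \<omega> i) UNIV"
      by (subst P.indep_vars_iff_distr_eq_PiM) (simp_all add: PiM_component restrict_UNIV distr_id)
    then show ?thesis
      unfolding P.indep_vars_def by (simp add: L_def)
  qed
  have "gamma_beta_variables c b (\<lambda>_. 1) ?M (\<lambda>n \<omega>. \<omega> (Inl n)) (\<lambda>n \<omega>. \<omega> (Inr n))"
    unfolding gamma_beta_variables_def
  proof (intro conjI allI impI)
    show "prob_space ?M" by (rule P.prob_space_axioms)
    show "distributed ?M lborel (\<lambda>\<omega>. \<omega> (Inl n)) (\<lambda>x. ennreal (gamma_density c x))" for n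
      using dist[of "Inl n"] by (simp add: d_def)
    show "distributed ?M lborel (\<lambda>\<omega>. \<omega> (Inr n)) (\<lambda>x. ennreal (beta_density (b n) 1 x))" if "1 \<le> n" for n
      using dist[of "Inr n"] that by (simp add: d_def)
    have "case_sum (\<lambda>n \<omega>. \<omega> (Inl n)) (\<lambda>n \<omega>. \<omega> (Inr n)) = (\<lambda>i (\<omega> :: nat + nat \<Rightarrow> real). \<omega> i)"
      by (auto simp: fun_eq_iff split: sum.split)
    then show "P.indep_vars (\<lambda>_. borel) (case_sum (\<lambda>n \<omega>. \<omega> (Inl n)) (\<lambda>n \<omega>. \<omega> (Inr n))) ({1..} <+> {1..})"
      using P.indep_vars_subset[OF ind] by simp
  qed
  then show ?thesis by (rule that)
qed

section \<open>Integrals against the stable intensity\<close>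

lemma sets_stable_measure [simp, measurable_cong]: "sets (stable_measure \<alpha>) = sets borel"
  by (simp add: stable_measure_def)

lemma space_stable_measure [simp]: "space (stable_measure \<alpha>) = UNIV"
  by (simp add: stable_measure_def)

lemma sigma_finite_stable_measure: "sigma_finite_measure (stable_measure \<alpha>)"
  unfolding stable_measure_def
  by (subst sigma_finite_measure.sigma_finite_iff_density_finite[OF sigma_finite_lborel])
    (auto simp: indicator_def)

text \<open>The density of the stable intensity as a real function on the whole line.\<close>

definition stable_density :: "real \<Rightarrow> real \<Rightarrow> real" where
  "stable_density \<alpha> u = indicator {0<..} u * (\<alpha> / Gamma (1 - \<alpha>) * u powr (- \<alpha> - 1))"

lemma nn_integral_stable_measure:
  assumes [measurable]: "f \<in> borel_measurable borel"
  shows "(\<integral>\<^sup>+u. f u \<partial>stable_measure \<alpha>) = (\<integral>\<^sup>+u. ennreal (stable_density \<alpha> u) * f u \<partial>lborel)"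
  unfolding stable_measure_def
  by (subst nn_integral_density) (auto simp: stable_density_def indicator_def intro!: nn_integral_cong)

context
  fixes \<alpha> :: real
  assumes \<alpha>: "0 < \<alpha>" "\<alpha> < 1"
begin

lemma stable_density_nonneg: "0 \<le> stable_density \<alpha> u"
  using \<alpha> Gamma_real_pos[of "1 - \<alpha>"] by (simp add: stable_density_def)

lemma stable_density_measurable [measurable]: "stable_density \<alpha> \<in> borel_measurable borel"
  unfolding stable_density_def[abs_def] by measurable

lemma nn_integral_stable_scale:
  assumes f [measurable]: "f \<in> borel_measurable borel" and z: "0 < z"
  shows "(\<integral>\<^sup>+u. f (z * u) \<partial>stable_measure \<alpha>) = ennreal (z powr \<alpha>) * (\<integral>\<^sup>+u. f u \<partial>stable_measure \<alpha>)"
proof -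
  have "(\<integral>\<^sup>+u. f u \<partial>stable_measure \<alpha>) = (\<integral>\<^sup>+u. ennreal (stable_density \<alpha> u) * f u \<partial>lborel)"
    by (rule nn_integral_stable_measure) fact
  also have "\<dots> = ennreal z * (\<integral>\<^sup>+u. ennreal (stable_density \<alpha> (z * u)) * f (z * u) \<partial>lborel)"
    using z by (subst nn_integral_real_affine[of _ z 0]) auto
  also have "\<dots> = (\<integral>\<^sup>+u. ennreal z * (ennreal (stable_density \<alpha> (z * u)) * f (z * u)) \<partial>lborel)"
    by (rule nn_integral_cmult[symmetric]) simp
  also have "\<dots> = (\<integral>\<^sup>+u. ennreal (z powr (- \<alpha>)) * (ennreal (stable_density \<alpha> u) * f (z * u)) \<partial>lborel)"
  proof (intro nn_integral_cong)
    fix u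
    have "z * stable_density \<alpha> (z * u) = z powr (- \<alpha>) * stable_density \<alpha> u"
      using z by (auto simp: stable_density_def indicator_def zero_less_mult_iff powr_mult powr_diff)
    then have "ennreal z * ennreal (stable_density \<alpha> (z * u)) =
        ennreal (z powr (- \<alpha>)) * ennreal (stable_density \<alpha> u)"
      using z by (simp add: ennreal_mult[symmetric] stable_density_nonneg)
    then show "ennreal z * (ennreal (stable_density \<alpha> (z * u)) * f (z * u)) =
        ennreal (z powr (- \<alpha>)) * (ennreal (stable_density \<alpha> u) * f (z * u))"
      by (simp only: mult.assoc[symmetric])
  qed
  also have "\<dots> = ennreal (z powr (- \<alpha>)) * (\<integral>\<^sup>+u. ennreal (stable_density \<alpha> u) * f (z * u) \<partial>lborel)"
    by (rule nn_integral_cmult) simp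
  also have "(\<integral>\<^sup>+u. ennreal (stable_density \<alpha> u) * f (z * u) \<partial>lborel) = (\<integral>\<^sup>+u. f (z * u) \<partial>stable_measure \<alpha>)"
    by (rule nn_integral_stable_measure[symmetric]) simp
  finally have "ennreal (z powr \<alpha>) * (\<integral>\<^sup>+u. f u \<partial>stable_measure \<alpha>) =
      (ennreal (z powr \<alpha>) * ennreal (z powr (- \<alpha>))) * (\<integral>\<^sup>+u. f (z * u) \<partial>stable_measure \<alpha>)"
    by (simp add: mult.assoc)
  also have "ennreal (z powr \<alpha>) * ennreal (z powr (- \<alpha>)) = 1"
    using z by (simp add: ennreal_mult[symmetric] powr_add[symmetric])
  finally show ?thesis by simp
qed

lemma nn_integral_stable_mean:
  assumes y: "0 < y"
  shows "(\<integral>\<^sup>+u. ennreal (u * exp (- y * u)) \<partial>stable_measure \<alpha>) = ennreal (\<alpha> * y powr (\<alpha> - 1))"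
proof -
  have "(\<integral>\<^sup>+u. ennreal (u * exp (- u)) \<partial>stable_measure \<alpha>) =
      (\<integral>\<^sup>+u. ennreal (stable_density \<alpha> u) * ennreal (u * exp (- u)) \<partial>lborel)"
    by (rule nn_integral_stable_measure) simp
  also have "\<dots> = (\<integral>\<^sup>+u. ennreal \<alpha> * ennreal (gamma_density (1 - \<alpha>) u) \<partial>lborel)"
  proof (intro nn_integral_cong)
    fix u :: real
    show "ennreal (stable_density \<alpha> u) * ennreal (u * exp (- u)) = ennreal \<alpha> * ennreal (gamma_density (1 - \<alpha>) u)"
    proof (cases "0 < u")
      case True
      have "stable_density \<alpha> u * (u * exp (- u)) = \<alpha> * gamma_density (1 - \<alpha>) u"
        using True by (simp add: stable_density_def gamma_density_def powr_diff)
      then show ?thesis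
        using True \<alpha> stable_density_nonneg[of u] gamma_density_nonneg[of "1 - \<alpha>" u]
        by (simp add: ennreal_mult[symmetric])
    qed (simp add: stable_density_def gamma_density_def)
  qed
  also have "\<dots> = ennreal \<alpha>"
    using nn_integral_gamma_density[of "1 - \<alpha>"] \<alpha> by (simp add: nn_integral_cmult)
  finally have 1: "(\<integral>\<^sup>+u. ennreal (u * exp (- u)) \<partial>stable_measure \<alpha>) = ennreal \<alpha>" .
  have "(\<integral>\<^sup>+u. ennreal (u * exp (- y * u)) \<partial>stable_measure \<alpha>) =
      (\<integral>\<^sup>+u. ennreal (1 / y) * ennreal (y * u * exp (- (y * u))) \<partial>stable_measure \<alpha>)"
    using y by (intro nn_integral_cong) (simp add: ennreal_mult'[symmetric])
  also have "\<dots> = ennreal (1 / y) * (\<integral>\<^sup>+u. ennreal (y * u * exp (- (y * u))) \<partial>stable_measure \<alpha>)"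
    by (rule nn_integral_cmult) simp
  also have "\<dots> = ennreal (1 / y) * (ennreal (y powr \<alpha>) * ennreal \<alpha>)"
    using nn_integral_stable_scale[of "\<lambda>v. ennreal (v * exp (- v))" y] y 1 by simp
  also have "\<dots> = ennreal (\<alpha> * y powr (\<alpha> - 1))"
    using y \<alpha> by (simp add: ennreal_mult[symmetric] powr_diff mult_ac)
  finally show ?thesis .
qed

lemma nn_integral_stable_one_minus_exp:
  assumes c: "0 < c"
  shows "(\<integral>\<^sup>+u. ennreal (1 - exp (- c * u)) \<partial>stable_measure \<alpha>) = ennreal (c powr \<alpha>)"
proof -
  interpret S: sigma_finite_measure "stable_measure \<alpha>" by (rule sigma_finite_stable_measure)
  interpret pair_sigma_finite lborel "stable_measure \<alpha>"
    by (intro pair_sigma_finite.intro sigma_finite_lborel sigma_finite_stable_measure)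
  \<comment> \<open>For \<open>c = 1\<close>, write \<open>1 - exp (- u)\<close> as the integral of \<open>u exp (- y u)\<close> over \<open>0 \<le> y \<le> 1\<close>.\<close>
  have "(\<integral>\<^sup>+u. ennreal (1 - exp (- u)) \<partial>stable_measure \<alpha>) =
      (\<integral>\<^sup>+u. (\<integral>\<^sup>+y. ennreal (u * exp (- y * u)) * indicator {0..1} y \<partial>lborel) \<partial>stable_measure \<alpha>)"
  proof (rule nn_integral_cong_AE)
    have "AE u in stable_measure \<alpha>. 0 < u"
      unfolding stable_measure_def by (subst AE_density) (auto simp: indicator_def)
    then show "AE u in stable_measure \<alpha>. ennreal (1 - exp (- u)) =
        (\<integral>\<^sup>+y. ennreal (u * exp (- y * u)) * indicator {0..1} y \<partial>lborel)"
    proof eventually_elim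
      case (elim u)
      have "((\<lambda>y. u * exp (- y * u)) has_integral (- exp (- 1 * u) - - exp (- 0 * u))) {0..1}"
        by (rule fundamental_theorem_of_calculus)
          (auto simp: has_real_derivative_iff_has_vector_derivative[symmetric] intro!: derivative_eq_intros)
      from nn_integral_has_integral_lebesgue'[OF _ this] elim show ?case by simp
    qed
  qed
  also have "\<dots> = (\<integral>\<^sup>+y. (\<integral>\<^sup>+u. ennreal (u * exp (- y * u)) * indicator {0..1} y \<partial>stable_measure \<alpha>) \<partial>lborel)"
    by (rule Fubini') measurable
  also have "\<dots> = (\<integral>\<^sup>+y. ennreal (beta_density \<alpha> 1 y) \<partial>lborel)"
    using AE_lborel_singleton[of "0::real"] AE_lborel_singleton[of "1::real"]
  proof (intro nn_integral_cong_AE, eventually_elim)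
    case (elim y)
    show ?case
    proof (cases "0 < y \<and> y < 1")
      case True
      then show ?thesis
        using nn_integral_stable_mean[of y] \<alpha> by (simp add: beta_density_1)
    qed (use elim \<alpha> in \<open>auto simp: beta_density_1 indicator_def\<close>)
  qed
  also have "\<dots> = 1" using \<alpha> by (intro nn_integral_beta_density) auto
  finally have 1: "(\<integral>\<^sup>+u. ennreal (1 - exp (- u)) \<partial>stable_measure \<alpha>) = 1" .
  show ?thesis
    using nn_integral_stable_scale[of "\<lambda>u. ennreal (1 - exp (- u))" c] c 1 by simp
qed

text \<open>The substitution \<open>y = A z powr \<alpha>\<close> in the Gamma integral.\<close>

lemma nn_integral_weibull:
  assumes c: "0 < c" and A: "0 < A"
  shows "(\<integral>\<^sup>+z. ennreal (\<alpha> * z powr (\<alpha> * c - 1) * exp (- A * z powr \<alpha>)) * indicator {0<..} z \<partial>lborel) =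
    ennreal (Gamma c * A powr (- c))"
proof -
  have H: "((\<lambda>t. t powr (c - 1) / exp t) has_integral Gamma c) {0..}"
    using c by (rule Gamma_integral_real)
  have N1: "negligible {t \<in> {0..} - {0<..}. t powr (c - 1) / exp t \<noteq> 0}"
    by (rule negligible_subset[of "{0}"]) auto
  have N2: "negligible {t \<in> {0<..} - {0..}. t powr (c - 1) / exp t \<noteq> 0}"
    by (rule negligible_subset[of "{0}"]) auto
  have G: "((\<lambda>t. t powr (c - 1) / exp t) has_integral Gamma c) {0<..}"
    by (rule has_integral_spike_set_eq[OF N1 N2, THEN iffD1, OF H])
  define f where "f t = t powr (c - 1) / exp t" for t :: real
  define \<psi> where "\<psi> z = A * z powr \<alpha>" for z
  define \<psi>' where "\<psi>' z = A * (\<alpha> * z powr (\<alpha> - 1))" for z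
  have image: "\<psi> ` {0<..} = {0<..}"
  proof (intro equalityI subsetI)
    fix y :: real assume "y \<in> {0<..}"
    then have "\<psi> ((y / A) powr (1 / \<alpha>)) = y" "0 < (y / A) powr (1 / \<alpha>)"
      using A \<alpha> by (simp_all add: \<psi>_def powr_powr)
    then show "y \<in> \<psi> ` {0<..}" by (metis greaterThan_iff imageI)
  qed (use A in \<open>auto simp: \<psi>_def\<close>)
  have "f absolutely_integrable_on (\<psi> ` {0<..}) \<and> integral (\<psi> ` {0<..}) f = Gamma c"
    unfolding image using G
    by (auto simp: f_def[abs_def] integral_unique has_integral_integrable
        intro!: nonnegative_absolutely_integrable_1)
  moreover have "(\<psi> has_real_derivative \<psi>' x) (at x within {0<..})" if "x \<in> {0<..}" for x
    unfolding \<psi>_def[abs_def] \<psi>'_def using that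
    by (intro DERIV_cmult has_field_derivative_at_within[OF has_real_derivative_powr]) auto
  moreover have "inj_on \<psi> {0<..}"
  proof (rule inj_onI)
    fix x y :: real assume "x \<in> {0<..}" "y \<in> {0<..}" "\<psi> x = \<psi> y"
    then have "(x powr \<alpha>) powr (1 / \<alpha>) = (y powr \<alpha>) powr (1 / \<alpha>)" "0 < x" "0 < y"
      using A by (auto simp: \<psi>_def)
    then show "x = y" using \<alpha> by (simp add: powr_powr)
  qed
  ultimately have "(\<lambda>z. \<bar>\<psi>' z\<bar> * f (\<psi> z)) absolutely_integrable_on {0<..} \<and>
      integral {0<..} (\<lambda>z. \<bar>\<psi>' z\<bar> * f (\<psi> z)) = Gamma c"
    using has_absolute_integral_change_of_variables_1'[of "{0<..}" \<psi> \<psi>' f "Gamma c"] by simp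
  then have I: "((\<lambda>z. \<bar>\<psi>' z\<bar> * f (\<psi> z)) has_integral Gamma c) {0<..}"
    by (auto simp: has_integral_iff dest: set_lebesgue_integral_eq_integral(1))
  have "(\<integral>\<^sup>+z. ennreal (\<bar>\<psi>' z\<bar> * f (\<psi> z)) * indicator {0<..} z \<partial>lborel) = ennreal (Gamma c)"
    by (rule nn_integral_has_integral_lebesgue'[OF _ I]) (simp add: f_def)
  moreover have "ennreal (\<bar>\<psi>' z\<bar> * f (\<psi> z)) * indicator {0<..} z =
      ennreal (A powr c) * (ennreal (\<alpha> * z powr (\<alpha> * c - 1) * exp (- A * z powr \<alpha>)) * indicator {0<..} z)" for z
  proof (cases "0 < z")
    case True
    have "\<bar>\<psi>' z\<bar> * f (\<psi> z) = A powr c * (\<alpha> * z powr (\<alpha> * c - 1) * exp (- A * z powr \<alpha>))"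
    proof -
      have "z powr (\<alpha> - 1) * (z powr \<alpha>) powr (c - 1) = z powr (\<alpha> * c - 1)"
        using True by (simp add: powr_powr powr_add[symmetric] algebra_simps)
      moreover have "A * A powr (c - 1) = A powr c"
        using A by (simp add: powr_diff)
      moreover have "\<bar>\<psi>' z\<bar> * f (\<psi> z) = \<alpha> * (A * A powr (c - 1)) *
          (z powr (\<alpha> - 1) * (z powr \<alpha>) powr (c - 1)) * exp (- A * z powr \<alpha>)"
        using A \<alpha> True by (simp add: \<psi>'_def \<psi>_def f_def powr_mult exp_minus divide_inverse abs_mult)
      ultimately show ?thesis by simp
    qed
    then show ?thesis using True \<alpha> by (simp add: ennreal_mult[symmetric])
  qed simp
  ultimately have "ennreal (A powr c) * (\<integral>\<^sup>+z. ennreal (\<alpha> * z powr (\<alpha> * c - 1) * exp (- A * z powr \<alpha>)) * indicator {0<..} z \<partial>lborel) =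
      ennreal (Gamma c)"
    by (simp add: nn_integral_cmult)
  note eq = this
  have one: "ennreal (A powr (- c)) * ennreal (A powr c) = 1"
    using A by (simp add: ennreal_mult[symmetric] powr_add[symmetric])
  have "(\<integral>\<^sup>+z. ennreal (\<alpha> * z powr (\<alpha> * c - 1) * exp (- A * z powr \<alpha>)) * indicator {0<..} z \<partial>lborel) =
      ennreal (A powr (- c)) * ennreal (Gamma c)"
    unfolding eq[symmetric] mult.assoc[symmetric] one by simp
  also have "\<dots> = ennreal (Gamma c * A powr (- c))"
    using Gamma_real_pos[OF c] by (subst mult.commute) (simp add: ennreal_mult')
  finally show ?thesis .
qed

end

context laplace_test
begin

text \<open>Both terms of \<open>1 - exp (- c v) q v = (1 - exp (- c v)) + exp (- c v) (1 - q v)\<close>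
  are integrated separately.\<close>

lemma nn_integral_stable_theta:
  assumes \<alpha>0: "0 < \<alpha>" and c: "0 < c"
  shows "(\<integral>\<^sup>+v. ennreal (1 - exp (- c * v) * q v) \<partial>stable_measure \<alpha>) = ennreal (c powr \<alpha> + \<alpha> * dl c)"
proof -
  have pos: "AE v in stable_measure \<alpha>. 0 < v"
    unfolding stable_measure_def by (subst AE_density) (auto simp: indicator_def)
  have "(\<integral>\<^sup>+v. ennreal (1 - exp (- c * v) * q v) \<partial>stable_measure \<alpha>) =
      (\<integral>\<^sup>+v. ennreal (1 - exp (- c * v)) + ennreal (exp (- c * v) * (1 - q v)) \<partial>stable_measure \<alpha>)"
    using pos
  proof (intro nn_integral_cong_AE, eventually_elim)
    case (elim v)
    then show ?case
      using c q_le_1[of v] by (subst ennreal_plus[symmetric]) (auto simp: algebra_simps)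
  qed
  also have "\<dots> = (\<integral>\<^sup>+v. ennreal (1 - exp (- c * v)) \<partial>stable_measure \<alpha>) +
      (\<integral>\<^sup>+v. ennreal (exp (- c * v) * (1 - q v)) \<partial>stable_measure \<alpha>)"
    by (rule nn_integral_add) auto
  also have "(\<integral>\<^sup>+v. ennreal (1 - exp (- c * v)) \<partial>stable_measure \<alpha>) = ennreal (c powr \<alpha>)"
    using nn_integral_stable_one_minus_exp[OF \<alpha>0 \<alpha>(2) c] .
  also have "(\<integral>\<^sup>+v. ennreal (exp (- c * v) * (1 - q v)) \<partial>stable_measure \<alpha>) = ennreal (\<alpha> * dl c)"
  proof -
    have int: "integrable lborel (\<lambda>v. rho v * exp (- c * v))"
      using rho_integrable[OF c, of 0] by simp
    have "(\<integral>\<^sup>+v. ennreal (exp (- c * v) * (1 - q v)) \<partial>stable_measure \<alpha>) =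
        (\<integral>\<^sup>+v. ennreal (stable_density \<alpha> v) * ennreal (exp (- c * v) * (1 - q v)) \<partial>lborel)"
      by (rule nn_integral_stable_measure) simp
    also have "\<dots> = (\<integral>\<^sup>+v. ennreal \<alpha> * ennreal (rho v * exp (- c * v)) \<partial>lborel)"
    proof (intro nn_integral_cong)
      fix v :: real
      show "ennreal (stable_density \<alpha> v) * ennreal (exp (- c * v) * (1 - q v)) =
          ennreal \<alpha> * ennreal (rho v * exp (- c * v))"
      proof (cases "0 < v")
        case True
        have "stable_density \<alpha> v * (exp (- c * v) * (1 - q v)) = \<alpha> * (rho v * exp (- c * v))"
          using True by (simp add: stable_density_def rho_def)
        then show ?thesis
          using \<alpha>0 \<alpha> stable_density_nonneg[OF \<alpha>0 \<alpha>(2)] rho_nonneg[of v] q_le_1[of v]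
          by (simp add: ennreal_mult[symmetric])
      next
        case False
        then have "rho v = 0" using \<epsilon> by (intro rho_0) simp
        then show ?thesis using False by (simp add: stable_density_def)
      qed
    qed
    also have "\<dots> = ennreal \<alpha> * (\<integral>\<^sup>+v. ennreal (rho v * exp (- c * v)) \<partial>lborel)"
      by (rule nn_integral_cmult) simp
    also have "(\<integral>\<^sup>+v. ennreal (rho v * exp (- c * v)) \<partial>lborel) = ennreal (dl c)"
      using nn_integral_eq_integral[OF int] rho_nonneg by (simp add: dl_def)
    finally show ?thesis using \<alpha>0 dl_nonneg[of c] by (simp add: ennreal_mult)
  qed
  finally show ?thesis using \<alpha>0 dl_nonneg[of c] by (simp add: ennreal_plus)
qed

lemma theta_deriv: "((\<lambda>w. w powr \<alpha> + \<alpha> * dl w) has_real_derivative \<alpha> * kk 1) (at 1)"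
proof -
  have "((\<lambda>w. w powr \<alpha> + \<alpha> * dl w) has_real_derivative \<alpha> * 1 powr (\<alpha> - 1) + \<alpha> * - dl1 1) (at 1)"
    by (intro DERIV_add DERIV_cmult dl_deriv has_real_derivative_powr) auto
  moreover have "\<alpha> * 1 powr (\<alpha> - 1) + \<alpha> * - dl1 1 = \<alpha> * kk 1"
    using kk_eq[of 1] by (simp add: right_diff_distrib)
  ultimately show ?thesis by (simp only:)
qed

end

section \<open>The marked stable process\<close>

lemma enn2real_INF_eq:
  fixes r :: "nat \<Rightarrow> real"
  assumes J: "J \<noteq> {}" and r: "\<And>i. i \<in> J \<Longrightarrow> 0 \<le> r i"
  shows "enn2real (INF i. if i \<in> J then ennreal (r i) else \<top>) = (INF i\<in>J. r i)"
proof -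
  let ?Z = "INF i\<in>J. r i"
  have bdd: "bdd_below (r ` J)" using r by (auto intro!: bdd_belowI[of _ 0])
  have Z: "0 \<le> ?Z" using J r by (intro cINF_greatest) auto
  have "(INF i. if i \<in> J then ennreal (r i) else \<top>) = ennreal ?Z"
  proof (rule antisym)
    show "ennreal ?Z \<le> (INF i. if i \<in> J then ennreal (r i) else \<top>)"
      using bdd by (intro INF_greatest) (auto intro!: ennreal_leI cINF_lower)
    show "(INF i. if i \<in> J then ennreal (r i) else \<top>) \<le> ennreal ?Z"
    proof (rule ennreal_le_epsilon)
      fix e :: real assume e: "0 < e"
      then have "Inf (r ` J) < ?Z + e" by simp
      then obtain i where i: "i \<in> J" "r i < ?Z + e"
        using J cInf_lessD[of "r ` J" "?Z + e"] by auto
      have "(INF i. if i \<in> J then ennreal (r i) else \<top>) \<le> ennreal (r i)"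
        by (rule INF_lower2[of i]) (use i in auto)
      also have "\<dots> \<le> ennreal (?Z + e)" using i by (intro ennreal_leI) simp
      also have "\<dots> = ennreal ?Z + ennreal e" using Z e by simp
      finally show "(INF i. if i \<in> J then ennreal (r i) else \<top>) \<le> ennreal ?Z + ennreal e" .
    qed
  qed
  then show ?thesis using Z by simp
qed

text \<open>The Poisson process with its exponential marks.\<close>

locale stable_marked =
  fixes \<alpha> \<theta> :: real and M :: "'m measure" and T P E :: "nat \<Rightarrow> 'm \<Rightarrow> real"
  assumes \<alpha>: "0 < \<alpha>" "\<alpha> < 1" and \<theta>: "- \<alpha> < \<theta>"
    and process: "stable_process \<alpha> M T P E"
begin

lemma poisson:
  "poisson_process M (density lborel (indicator {0<..}) \<Otimes>\<^sub>M stable_measure \<alpha>)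
    (\<lambda>\<omega>. point_measure (borel \<Otimes>\<^sub>M borel) UNIV (\<lambda>i. (T i \<omega>, P i \<omega>)))"
  using process by (simp add: stable_process_def)

sublocale prob_space M
  using poisson by (rule poisson_process_prob_space)

lemma T_measurable [measurable]: "T i \<in> borel_measurable M"
  using process by (simp add: stable_process_def)

lemma P_measurable [measurable]: "P i \<in> borel_measurable M"
  using process by (simp add: stable_process_def)

lemma P_pos: "\<omega> \<in> space M \<Longrightarrow> 0 < P i \<omega>"
  using process by (simp add: stable_process_def)

lemma E_distributed: "distributed M lborel (E i) (\<lambda>x. ennreal (exponential_density 1 x))"
  using process by (simp add: stable_process_def)

lemma E_measurable [measurable]: "E i \<in> borel_measurable M"
  using distributed_measurable[OF E_distributed] by simp

lemma E_indep: "indep_vars (\<lambda>_. borel) E UNIV"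
  using process by (simp add: stable_process_def)

text \<open>\<open>xi\<close> is the point measure of the masses \<open>P i\<close> with \<open>T i \<le> 1\<close>; its total mass is \<open>tau\<close>, a value in
  \<open>[0,\<infinity>]\<close>, and \<open>t\<close> as a real number.\<close>

definition J :: "'m \<Rightarrow> nat set" where "J \<omega> = {i. T i \<omega> \<le> 1}"

definition xi :: "'m \<Rightarrow> real measure" where
  "xi \<omega> = point_measure borel (J \<omega>) (\<lambda>i. P i \<omega>)"

definition tau :: "'m \<Rightarrow> ennreal" where "tau \<omega> = first_moment (xi \<omega>)"

lemma xi_measurable [measurable]: "xi \<in> M \<rightarrow>\<^sub>M measure_algebra borel"
  unfolding xi_def[abs_def] J_def by (rule measurable_point_measure) measurable

lemma nn_integral_xi:
  "f \<in> borel_measurable borel \<Longrightarrow> (\<integral>\<^sup>+x. f x \<partial>xi \<omega>) = (\<Sum>i. if T i \<omega> \<le> 1 then f (P i \<omega>) else 0)"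
  unfolding xi_def by (subst nn_integral_point_measure) (auto simp: J_def)

lemma tau_eq: "tau \<omega> = (\<Sum>i. if T i \<omega> \<le> 1 then ennreal (P i \<omega>) else 0)"
  unfolding tau_def first_moment_def by (rule nn_integral_xi) simp

lemma tau_measurable [measurable]: "tau \<in> borel_measurable M"
  unfolding tau_def[abs_def] by measurable

subsection \<open>The Laplace functional of the points with \<open>T i \<le> 1\<close>\<close>

lemma laplace_xi:
  assumes f [measurable]: "f \<in> borel_measurable borel"
  shows "expectation (\<lambda>\<omega>. nexp (\<integral>\<^sup>+x. f x \<partial>xi \<omega>)) =
    nexp (\<integral>\<^sup>+u. ennreal (1 - nexp (f u)) \<partial>stable_measure \<alpha>)"
proof -
  let ?L = "density lborel (indicator {0<..} :: real \<Rightarrow> ennreal)"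
  let ?\<nu> = "?L \<Otimes>\<^sub>M stable_measure \<alpha>"
  have L: "sigma_finite_measure ?L"
    by (subst sigma_finite_measure.sigma_finite_iff_density_finite[OF sigma_finite_lborel])
      (auto simp: indicator_def)
  interpret S: sigma_finite_measure "stable_measure \<alpha>" by (rule sigma_finite_stable_measure)
  interpret \<nu>: pair_sigma_finite ?L "stable_measure \<alpha>"
    by (intro pair_sigma_finite.intro L sigma_finite_stable_measure)
  define F where "F x = (if fst x \<le> 1 then f (snd x) else 0)" for x :: "real \<times> real"
  have F_borel [measurable]: "F \<in> borel_measurable (borel \<Otimes>\<^sub>M borel)"
    unfolding F_def[abs_def] by measurable
  have F: "F \<in> borel_measurable ?\<nu>"
    using F_borel by (simp cong: measurable_cong_sets)
  have "(\<integral>\<^sup>+x. F x \<partial>point_measure (borel \<Otimes>\<^sub>M borel) UNIV (\<lambda>i. (T i \<omega>, P i \<omega>))) = (\<integral>\<^sup>+x. f x \<partial>xi \<omega>)" for \<omega>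
    unfolding nn_integral_xi[OF f]
    by (subst nn_integral_point_measure) (auto simp: F_def space_pair_measure intro!: suminf_cong)
  then have "expectation (\<lambda>\<omega>. nexp (\<integral>\<^sup>+x. f x \<partial>xi \<omega>)) =
      nexp (\<integral>\<^sup>+x. ennreal (1 - nexp (F x)) \<partial>?\<nu>)"
    using poisson_laplace[OF poisson \<nu>.sigma_finite_measure_axioms F] by simp
  also have "(\<integral>\<^sup>+x. ennreal (1 - nexp (F x)) \<partial>?\<nu>) =
      (\<integral>\<^sup>+t. (\<integral>\<^sup>+u. ennreal (1 - nexp (F (t, u))) \<partial>stable_measure \<alpha>) \<partial>?L)"
    using F by (subst S.nn_integral_fst[symmetric]) auto
  also have "\<dots> = (\<integral>\<^sup>+t. (\<integral>\<^sup>+u. ennreal (1 - nexp (f u)) \<partial>stable_measure \<alpha>) * indicator {..1} t \<partial>?L)"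
    by (intro nn_integral_cong) (auto simp: F_def split: split_indicator)
  also have "\<dots> = (\<integral>\<^sup>+u. ennreal (1 - nexp (f u)) \<partial>stable_measure \<alpha>) * emeasure ?L {..1}"
    by (subst nn_integral_cmult_indicator) auto
  also have "emeasure ?L {..1} = 1"
  proof -
    have "emeasure ?L {..1} = (\<integral>\<^sup>+t. indicator {0<..} t * indicator {..1::real} t \<partial>lborel)"
      by (rule emeasure_density) auto
    also have "\<dots> = (\<integral>\<^sup>+t. indicator {0<..1::real} t \<partial>lborel)"
      by (intro nn_integral_cong) (auto split: split_indicator)
    also have "\<dots> = emeasure lborel {0<..1::real}"
      by (rule nn_integral_indicator) simp
    finally show ?thesis by simp
  qed
  finally show ?thesis by simp
qed

text \<open>Let \<open>c \<rightarrow> 0\<close> and \<open>c \<rightarrow> \<infinity>\<close> in \<open>E exp (- c \<tau>) = exp (- c powr \<alpha>)\<close>.\<close>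

lemma tau_pos_finite: "AE \<omega> in M. tau \<omega> \<noteq> 0 \<and> tau \<omega> \<noteq> \<top>"
proof -
  have lap: "expectation (\<lambda>\<omega>. nexp (ennreal c * tau \<omega>)) = exp (- (c powr \<alpha>))" if c: "0 < c" for c
  proof -
    have "AE u in stable_measure \<alpha>. 0 < u"
      unfolding stable_measure_def by (subst AE_density) (auto simp: indicator_def)
    then have "(\<integral>\<^sup>+u. ennreal (1 - nexp (ennreal c * ennreal u)) \<partial>stable_measure \<alpha>) =
        (\<integral>\<^sup>+u. ennreal (1 - exp (- c * u)) \<partial>stable_measure \<alpha>)"
      using c by (intro nn_integral_cong_AE)
        (auto elim!: eventually_mono simp: ennreal_mult'[symmetric] nexp_ennreal)
    also have "\<dots> = ennreal (c powr \<alpha>)"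
      by (rule nn_integral_stable_one_minus_exp[OF \<alpha> c])
    finally have "expectation (\<lambda>\<omega>. nexp (\<integral>\<^sup>+u. ennreal c * ennreal u \<partial>xi \<omega>)) = exp (- (c powr \<alpha>))"
      by (subst laplace_xi) (simp_all add: nexp_ennreal)
    moreover have "(\<integral>\<^sup>+u. ennreal c * ennreal u \<partial>xi \<omega>) = ennreal c * tau \<omega>" for \<omega>
      unfolding tau_def first_moment_def by (rule nn_integral_cmult) (simp add: xi_def)
    ultimately show ?thesis by simp
  qed
  have "AE \<omega> in M. tau \<omega> \<noteq> \<top>"
  proof -
    have "(\<lambda>n. expectation (\<lambda>\<omega>. nexp (ennreal (1 / real (Suc n)) * tau \<omega>))) \<longlonglongrightarrow>
        expectation (\<lambda>\<omega>. indicator {\<omega>. tau \<omega> \<noteq> \<top>} \<omega>)"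
    proof (rule integral_dominated_convergence[where w = "\<lambda>_. 1"])
      show "AE \<omega> in M. (\<lambda>n. nexp (ennreal (1 / real (Suc n)) * tau \<omega>)) \<longlonglongrightarrow> indicator {\<omega>. tau \<omega> \<noteq> \<top>} \<omega>"
      proof (rule AE_I2)
        fix \<omega>
        show "(\<lambda>n. nexp (ennreal (1 / real (Suc n)) * tau \<omega>)) \<longlonglongrightarrow> indicator {\<omega>. tau \<omega> \<noteq> \<top>} \<omega>"
        proof (cases "tau \<omega>")
          case (real r)
          have "(\<lambda>n. exp (- (1 / real (Suc n) * r))) \<longlonglongrightarrow> exp (- (0 * r))"
            by (intro tendsto_intros LIMSEQ_Suc[OF lim_1_over_n])
          then show ?thesis using real
            by (simp add: ennreal_mult[symmetric] nexp_ennreal)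
        next
          case top
          then show ?thesis by (simp add: ennreal_mult_top)
        qed
      qed
    qed auto
    moreover have "(\<lambda>n. expectation (\<lambda>\<omega>. nexp (ennreal (1 / real (Suc n)) * tau \<omega>))) \<longlonglongrightarrow> 1"
    proof -
      have "(\<lambda>n. exp (- ((1 / real (Suc n)) powr \<alpha>))) \<longlonglongrightarrow> exp (- 0)"
        by (intro tendsto_intros tendsto_zero_powrI[where b = \<alpha>] LIMSEQ_Suc[OF lim_1_over_n]) (use \<alpha> in auto)
      then show ?thesis by (subst lap) auto
    qed
    ultimately have "expectation (\<lambda>\<omega>. indicator {\<omega>. tau \<omega> \<noteq> \<top>} \<omega>) = (1::real)"
      by (rule LIMSEQ_unique)
    moreover have "expectation (\<lambda>\<omega>. indicator {\<omega>. tau \<omega> \<noteq> \<top>} \<omega>) = prob {\<omega> \<in> space M. tau \<omega> \<noteq> \<top>}"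
      by (subst Bochner_Integration.integral_cong[OF refl, of M _ "indicator {\<omega> \<in> space M. tau \<omega> \<noteq> \<top>}"])
        (auto simp: indicator_def)
    ultimately show ?thesis by (subst prob_Collect_eq_1[symmetric]) auto
  qed
  moreover have "AE \<omega> in M. tau \<omega> \<noteq> 0"
  proof -
    have "(\<lambda>n. expectation (\<lambda>\<omega>. nexp (ennreal (real (Suc n)) * tau \<omega>))) \<longlonglongrightarrow>
        expectation (\<lambda>\<omega>. indicator {\<omega>. tau \<omega> = 0} \<omega>)"
    proof (rule integral_dominated_convergence[where w = "\<lambda>_. 1"])
      show "AE \<omega> in M. (\<lambda>n. nexp (ennreal (real (Suc n)) * tau \<omega>)) \<longlonglongrightarrow> indicator {\<omega>. tau \<omega> = 0} \<omega>"
      proof (rule AE_I2)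
        fix \<omega>
        show "(\<lambda>n. nexp (ennreal (real (Suc n)) * tau \<omega>)) \<longlonglongrightarrow> indicator {\<omega>. tau \<omega> = 0} \<omega>"
        proof (cases "tau \<omega>")
          case (real r)
          show ?thesis
          proof (cases "r = 0")
            case False
            then have r: "0 < r" using real by simp
            have "(\<lambda>n. exp (- (r * real n))) \<longlonglongrightarrow> 0"
              using r by (intro filterlim_compose[OF exp_at_bot] filterlim_uminus_at_top[THEN iffD1]
                filterlim_tendsto_pos_mult_at_top[OF tendsto_const] filterlim_real_sequentially)
            from LIMSEQ_Suc[OF this] show ?thesis
              using real r by (simp add: ennreal_mult[symmetric] nexp_ennreal mult.commute del: of_nat_Suc)
          qed (use real in simp)
        next
          case top
          then show ?thesis by (simp add: ennreal_mult_top)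
        qed
      qed
    qed auto
    moreover have "(\<lambda>n. expectation (\<lambda>\<omega>. nexp (ennreal (real (Suc n)) * tau \<omega>))) \<longlonglongrightarrow> 0"
    proof -
      have "(\<lambda>n. exp (- (real n powr \<alpha>))) \<longlonglongrightarrow> 0"
      proof (rule Lim_null_comparison)
        show "(\<lambda>n. real n powr (- \<alpha>)) \<longlonglongrightarrow> 0"
          using \<alpha> by (intro tendsto_neg_powr filterlim_real_sequentially) auto
        show "\<forall>\<^sub>F n in sequentially. norm (exp (- (real n powr \<alpha>))) \<le> real n powr (- \<alpha>)"
          using eventually_gt_at_top[of 0]
        proof eventually_elim
          case (elim n)
          have "real n powr \<alpha> \<le> exp (real n powr \<alpha>)"
            using exp_ge_add_one_self[of "real n powr \<alpha>"] by linarith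
          then show ?case
            using elim by (simp add: exp_minus powr_minus le_imp_inverse_le)
        qed
      qed
      from LIMSEQ_Suc[OF this] show ?thesis by (subst lap) auto
    qed
    ultimately have "expectation (\<lambda>\<omega>. indicator {\<omega>. tau \<omega> = 0} \<omega>) = (0::real)"
      by (rule LIMSEQ_unique)
    moreover have "expectation (\<lambda>\<omega>. indicator {\<omega>. tau \<omega> = 0} \<omega>) = prob {\<omega> \<in> space M. tau \<omega> = 0}"
      by (subst Bochner_Integration.integral_cong[OF refl, of M _ "indicator {\<omega> \<in> space M. tau \<omega> = 0}"])
        (auto simp: indicator_def)
    ultimately show ?thesis by (subst prob_Collect_eq_0[symmetric]) auto
  qed
  ultimately show ?thesis by eventually_elim simp
qed

definition t :: "'m \<Rightarrow> real" where "t \<omega> = enn2real (tau \<omega>)"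

lemma t_measurable [measurable]: "t \<in> borel_measurable M"
  unfolding t_def[abs_def] by measurable

lemma t_pos: "AE \<omega> in M. 0 < t \<omega> \<and> tau \<omega> = ennreal (t \<omega>)"
  using tau_pos_finite by eventually_elim (auto simp: t_def enn2real_positive_iff less_top zero_less_iff_neq_zero)

text \<open>The Laplace functional at \<open>u \<mapsto> c z u + f (z u)\<close> is \<open>exp (- z powr \<alpha> \<Theta>(c))\<close> with
  \<open>\<Theta>(c) = c powr \<alpha> + \<alpha> dl(c)\<close>. Its derivative at \<open>c = 1\<close> is the Campbell formula for the total mass.\<close>

lemma campbell:
  assumes f [measurable]: "f \<in> borel_measurable borel" and \<epsilon>: "0 < \<epsilon>" "\<And>x. x \<le> \<epsilon> \<Longrightarrow> f x = 0"
    and z: "0 < z"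
  shows "(\<integral>\<^sup>+\<omega>. ennreal (t \<omega> * exp (- z * t \<omega>) * nexp (\<integral>\<^sup>+x. f (z * x) \<partial>xi \<omega>)) \<partial>M) =
    ennreal (z powr (\<alpha> - 1) * (\<alpha> * laplace_test.kk \<alpha> (\<lambda>x. nexp (f x)) 1) *
      exp (- (z powr \<alpha> * (1 + \<alpha> * laplace_test.dl \<alpha> (\<lambda>x. nexp (f x)) 1))))"
proof -
  define q where "q x = nexp (f x)" for x
  have q [measurable]: "q \<in> borel_measurable borel" unfolding q_def[abs_def] by measurable
  interpret L: laplace_test \<alpha> \<epsilon> q
    by unfold_locales (use \<alpha> \<epsilon> in \<open>auto simp: q_def\<close>)
  define R where "R \<omega> = nexp (\<integral>\<^sup>+x. f (z * x) \<partial>xi \<omega>)" for \<omega>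
  have [measurable]: "R \<in> borel_measurable M" unfolding R_def[abs_def] by measurable
  have R01: "0 \<le> R \<omega>" "R \<omega> \<le> 1" for \<omega> by (simp_all add: R_def)
  define \<Theta> where "\<Theta> c = c powr \<alpha> + \<alpha> * L.dl c" for c
  have \<Theta>_nonneg: "0 \<le> \<Theta> c" for c using L.dl_nonneg[of c] \<alpha> by (simp add: \<Theta>_def)
  have lap: "expectation (\<lambda>\<omega>. exp (- (c * z * t \<omega>)) * R \<omega>) = exp (- (z powr \<alpha> * \<Theta> c))" if c: "0 < c" for c
  proof -
    have "AE u in stable_measure \<alpha>. 0 < u"
      unfolding stable_measure_def by (subst AE_density) (auto simp: indicator_def)
    then have "(\<integral>\<^sup>+u. ennreal (1 - nexp (ennreal (c * z) * ennreal u + f (z * u))) \<partial>stable_measure \<alpha>) =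
        (\<integral>\<^sup>+u. ennreal (1 - exp (- c * (z * u)) * q (z * u)) \<partial>stable_measure \<alpha>)"
      using c z by (intro nn_integral_cong_AE)
        (auto elim!: eventually_mono simp: ennreal_mult'[symmetric] nexp_ennreal nexp_add q_def mult.assoc)
    also have "\<dots> = ennreal (z powr \<alpha>) * (\<integral>\<^sup>+u. ennreal (1 - exp (- c * u) * q u) \<partial>stable_measure \<alpha>)"
      by (rule nn_integral_stable_scale[OF \<alpha> _ z]) simp
    also have "\<dots> = ennreal (z powr \<alpha> * \<Theta> c)"
      unfolding L.nn_integral_stable_theta[OF \<alpha>(1) c] using \<Theta>_nonneg[of c]
      by (simp add: \<Theta>_def ennreal_mult)
    finally have 1: "expectation (\<lambda>\<omega>. nexp (\<integral>\<^sup>+u. ennreal (c * z) * ennreal u + f (z * u) \<partial>xi \<omega>)) =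
        exp (- (z powr \<alpha> * \<Theta> c))"
      using \<Theta>_nonneg[of c] by (subst laplace_xi) (simp_all add: nexp_ennreal)
    have "expectation (\<lambda>\<omega>. exp (- (c * z * t \<omega>)) * R \<omega>) =
        expectation (\<lambda>\<omega>. nexp (\<integral>\<^sup>+u. ennreal (c * z) * ennreal u + f (z * u) \<partial>xi \<omega>))"
    proof (rule integral_cong_AE)
      show "AE \<omega> in M. exp (- (c * z * t \<omega>)) * R \<omega> =
          nexp (\<integral>\<^sup>+u. ennreal (c * z) * ennreal u + f (z * u) \<partial>xi \<omega>)"
        using t_pos
      proof eventually_elim
        case (elim \<omega>)
        have "(\<integral>\<^sup>+u. ennreal (c * z) * ennreal u + f (z * u) \<partial>xi \<omega>) =
            (\<integral>\<^sup>+u. ennreal (c * z) * ennreal u \<partial>xi \<omega>) + (\<integral>\<^sup>+u. f (z * u) \<partial>xi \<omega>)"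
          by (rule nn_integral_add) (simp_all add: xi_def)
        also have "(\<integral>\<^sup>+u. ennreal (c * z) * ennreal u \<partial>xi \<omega>) = ennreal (c * z) * tau \<omega>"
          unfolding tau_def first_moment_def by (rule nn_integral_cmult) (simp add: xi_def)
        also have "\<dots> = ennreal (c * z * t \<omega>)"
          using elim c z by (simp add: ennreal_mult)
        finally show ?case using elim c z by (simp add: nexp_add nexp_ennreal R_def)
      qed
    qed measurable
    with 1 show ?thesis by simp
  qed
  define h where "h n = 1 / real (Suc n)" for n
  have h: "0 < h n" for n by (simp add: h_def)
  have h0: "h \<longlonglongrightarrow> 0" unfolding h_def[abs_def] by (rule LIMSEQ_Suc[OF lim_1_over_n])
  let ?F = "\<lambda>c. exp (- (z powr \<alpha> * \<Theta> c))"
  have bnd_int: "integrable M (\<lambda>\<omega>. exp (- (c * z * t \<omega>)) * R \<omega>)" if "0 < c" for c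
  proof (rule integrable_const_bound[where B = 1])
    show "AE \<omega> in M. norm (exp (- (c * z * t \<omega>)) * R \<omega>) \<le> 1"
      using t_pos by eventually_elim (use R01 z that in \<open>auto simp: abs_mult intro!: mult_le_one\<close>)
  qed measurable
  define D where "D n \<omega> = (exp (- (1 * z * t \<omega>)) * R \<omega> - exp (- ((1 + h n) * z * t \<omega>)) * R \<omega>) / h n" for n \<omega>
  have expD: "expectation (D n) = - ((?F (1 + h n) - ?F 1) / h n)" for n
    using lap[of 1] lap[of "1 + h n"] h[of n] bnd_int[of 1] bnd_int[of "1 + h n"]
    unfolding D_def by (simp add: field_simps)
  have lim': "(\<lambda>n. expectation (D n)) \<longlonglongrightarrow> - (?F 1 * - (z powr \<alpha> * (\<alpha> * L.kk 1)))"
  proof -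
    have "(?F has_real_derivative (?F 1 * - (z powr \<alpha> * (\<alpha> * L.kk 1)))) (at 1)"
      unfolding \<Theta>_def
      by (intro DERIV_chain2[OF DERIV_exp] DERIV_minus DERIV_cmult L.theta_deriv)
    then have "((\<lambda>h. (?F (1 + h) - ?F 1) / h) \<longlongrightarrow> ?F 1 * - (z powr \<alpha> * (\<alpha> * L.kk 1))) (at 0)"
      by (rule DERIV_D)
    then have "(\<lambda>n. (?F (1 + h n) - ?F 1) / h n) \<longlonglongrightarrow> ?F 1 * - (z powr \<alpha> * (\<alpha> * L.kk 1))"
      by (rule filterlim_compose) (use h0 h in \<open>auto simp: filterlim_at less_imp_neq[symmetric]\<close>)
    then show ?thesis unfolding expD by (rule tendsto_minus)
  qed
  have lim: "(\<lambda>n. expectation (D n)) \<longlonglongrightarrow> expectation (\<lambda>\<omega>. z * t \<omega> * exp (- (z * t \<omega>)) * R \<omega>)"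
    and int: "integrable M (\<lambda>\<omega>. z * t \<omega> * exp (- (z * t \<omega>)) * R \<omega>)"
  proof -
    have D_lim: "(\<lambda>n. D n \<omega>) \<longlonglongrightarrow> z * t \<omega> * exp (- (z * t \<omega>)) * R \<omega>" for \<omega>
    proof -
      have "((\<lambda>c. exp (- (c * z * t \<omega>)) * R \<omega>) has_real_derivative
          exp (- (1 * z * t \<omega>)) * - (1 * z * t \<omega>) * R \<omega>) (at 1)"
        by (auto intro!: derivative_eq_intros)
      then have "((\<lambda>h. (exp (- ((1 + h) * z * t \<omega>)) * R \<omega> - exp (- (1 * z * t \<omega>)) * R \<omega>) / h) \<longlongrightarrow>
          exp (- (1 * z * t \<omega>)) * - (1 * z * t \<omega>) * R \<omega>) (at 0)"
        by (rule DERIV_D)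
      then have "(\<lambda>n. (exp (- ((1 + h n) * z * t \<omega>)) * R \<omega> - exp (- (1 * z * t \<omega>)) * R \<omega>) / h n) \<longlonglongrightarrow>
          exp (- (1 * z * t \<omega>)) * - (1 * z * t \<omega>) * R \<omega>"
        by (rule filterlim_compose) (use h0 h in \<open>auto simp: filterlim_at less_imp_neq[symmetric]\<close>)
      from tendsto_minus[OF this] show ?thesis
        by (simp add: D_def minus_divide_left mult_ac)
    qed
    have dom: "AE \<omega> in M. norm (D n \<omega>) \<le> 1" for n
      using t_pos
    proof eventually_elim
      case (elim \<omega>)
      define x where "x = z * t \<omega>"
      have x: "0 < x" using elim z by (simp add: x_def)
      define y where "y = (1 - exp (- (h n * x))) / h n"
      have D_eq: "D n \<omega> = exp (- x) * R \<omega> * y"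
        by (simp add: y_def D_def x_def algebra_simps exp_add[symmetric] diff_divide_distrib)
      have y: "0 \<le> y" "y \<le> x"
        using h[of n] x exp_ge_add_one_self[of "- (h n * x)"]
        by (simp_all add: y_def divide_le_eq mult.commute)
      have "exp (- x) * x \<le> 1"
      proof -
        have "x \<le> exp x" using exp_ge_add_one_self[of x] by linarith
        then show ?thesis by (simp add: exp_minus field_simps)
      qed
      moreover have "0 \<le> D n \<omega>"
        unfolding D_eq using y R01[of \<omega>] by simp
      moreover have "D n \<omega> \<le> exp (- x) * 1 * x"
        unfolding D_eq using y R01[of \<omega>] by (intro mult_mono) auto
      ultimately show ?case by simp
    qed
    show "(\<lambda>n. expectation (D n)) \<longlonglongrightarrow> expectation (\<lambda>\<omega>. z * t \<omega> * exp (- (z * t \<omega>)) * R \<omega>)"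
      by (rule integral_dominated_convergence[where w = "\<lambda>_. 1"])
        (use D_lim dom in \<open>auto simp: D_def[abs_def]\<close>)
    show "integrable M (\<lambda>\<omega>. z * t \<omega> * exp (- (z * t \<omega>)) * R \<omega>)"
      by (rule integrable_dominated_convergence[where w = "\<lambda>_. 1" and s = D])
        (use D_lim dom in \<open>auto simp: D_def[abs_def]\<close>)
  qed
  have eq: "expectation (\<lambda>\<omega>. z * t \<omega> * exp (- (z * t \<omega>)) * R \<omega>) =
      z powr \<alpha> * (\<alpha> * L.kk 1) * ?F 1"
    unfolding LIMSEQ_unique[OF lim lim'] by (simp only: mult_minus_right minus_minus mult.commute)
  have nn: "AE \<omega> in M. 0 \<le> z * t \<omega> * exp (- (z * t \<omega>)) * R \<omega>"
    using t_pos by eventually_elim (use z R01 in auto)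
  have "(\<integral>\<^sup>+\<omega>. ennreal (t \<omega> * exp (- z * t \<omega>) * R \<omega>) \<partial>M) =
      (\<integral>\<^sup>+\<omega>. ennreal (1 / z) * ennreal (z * t \<omega> * exp (- (z * t \<omega>)) * R \<omega>) \<partial>M)"
    using z by (intro nn_integral_cong) (simp add: ennreal_mult'[symmetric] mult.assoc)
  also have "\<dots> = ennreal (1 / z) * ennreal (z powr \<alpha> * (\<alpha> * L.kk 1) * ?F 1)"
    using nn_integral_eq_integral[OF int nn] eq by (subst nn_integral_cmult) simp_all
  also have "\<dots> = ennreal (z powr (\<alpha> - 1) * (\<alpha> * L.kk 1) * ?F 1)"
    using z by (simp add: ennreal_mult'[symmetric] powr_diff)
  finally show ?thesis by (simp add: R_def \<Theta>_def q_def[abs_def])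
qed

end

context stable_marked
begin

subsection \<open>The conditional law of the smallest mark\<close>

text \<open>The sequences \<open>Y\<close> of points and \<open>EE\<close> of marks are independent random elements of the sequence
  spaces \<open>S\<close> and \<open>R\<close>.\<close>

abbreviation S :: "(nat \<Rightarrow> real \<times> real) measure" where
  "S \<equiv> Pi\<^sub>M UNIV (\<lambda>_. borel \<Otimes>\<^sub>M borel)"

abbreviation R :: "(nat \<Rightarrow> real) measure" where
  "R \<equiv> Pi\<^sub>M UNIV (\<lambda>_. borel)"

definition Y :: "'m \<Rightarrow> nat \<Rightarrow> real \<times> real" where
  "Y \<omega> = (\<lambda>i. (T i \<omega>, P i \<omega>))"

definition EE :: "'m \<Rightarrow> nat \<Rightarrow> real" where
  "EE \<omega> = (\<lambda>i. E i \<omega>)"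

lemma Y_measurable [measurable]: "Y \<in> M \<rightarrow>\<^sub>M S"
  unfolding Y_def by (rule measurable_PiM_single') (auto simp: space_pair_measure)

lemma EE_measurable [measurable]: "EE \<in> M \<rightarrow>\<^sub>M R"
  unfolding EE_def by (rule measurable_PiM_single') auto

lemma joint_law: "distr M S Y \<Otimes>\<^sub>M distr M R EE = distr M (S \<Otimes>\<^sub>M R) (\<lambda>\<omega>. (Y \<omega>, EE \<omega>))"
proof (rule pair_measure_eqI)
  show "sigma_finite_measure (distr M S Y)"
    by (rule prob_space_imp_sigma_finite, rule prob_space_distr) simp
  show "sigma_finite_measure (distr M R EE)"
    by (rule prob_space_imp_sigma_finite, rule prob_space_distr) simp
  show "sets (distr M S Y \<Otimes>\<^sub>M distr M R EE) = sets (distr M (S \<Otimes>\<^sub>M R) (\<lambda>\<omega>. (Y \<omega>, EE \<omega>)))"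
    by (simp cong: sets_pair_measure_cong)
  fix A C assume "A \<in> sets (distr M S Y)" "C \<in> sets (distr M R EE)"
  then have A [measurable]: "A \<in> sets S" and C [measurable]: "C \<in> sets R" by simp_all
  have ind: "indep_set {Y -` X \<inter> space M | X. X \<in> sets S} {EE -` X \<inter> space M | X. X \<in> sets R}"
    using process by (simp add: stable_process_def Y_def[abs_def] EE_def[abs_def])
  have "prob ((Y -` A \<inter> space M) \<inter> (EE -` C \<inter> space M)) =
      prob (Y -` A \<inter> space M) * prob (EE -` C \<inter> space M)"
    by (rule indep_setD[OF ind]) (use A C in blast)+
  moreover have "(\<lambda>\<omega>. (Y \<omega>, EE \<omega>)) -` (A \<times> C) \<inter> space M =
      (Y -` A \<inter> space M) \<inter> (EE -` C \<inter> space M)" by auto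
  ultimately show "emeasure (distr M S Y) A * emeasure (distr M R EE) C =
      emeasure (distr M (S \<Otimes>\<^sub>M R) (\<lambda>\<omega>. (Y \<omega>, EE \<omega>))) (A \<times> C)"
    by (simp add: emeasure_distr emeasure_eq_measure ennreal_mult[symmetric])
qed

text \<open>The infimum of the ratios \<open>E i / P i\<close> as a function of the points and marks. It is taken in \<open>[0,\<infinity>]\<close>
  because there a countable infimum is measurable without any condition; \<open>Z\<close> agrees with \<^const>\<open>Z1\<close> almost
  surely.\<close>

definition Zf :: "(nat \<Rightarrow> real \<times> real) \<Rightarrow> (nat \<Rightarrow> real) \<Rightarrow> real" where
  "Zf y e = enn2real (INF i. if fst (y i) \<le> 1 then ennreal (e i / snd (y i)) else \<top>)"

definition Z :: "'m \<Rightarrow> real" where "Z \<omega> = Zf (Y \<omega>) (EE \<omega>)"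

lemma Zf_measurable [measurable]: "(\<lambda>x. Zf (fst x) (snd x)) \<in> borel_measurable (S \<Otimes>\<^sub>M R)"
proof -
  have [measurable]: "(\<lambda>x. fst x i) \<in> S \<Otimes>\<^sub>M R \<rightarrow>\<^sub>M borel \<Otimes>\<^sub>M borel" for i
    by (rule measurable_compose[OF measurable_fst measurable_component_singleton]) simp
  have [measurable]: "(\<lambda>x. snd x i) \<in> S \<Otimes>\<^sub>M R \<rightarrow>\<^sub>M borel" for i
    by (rule measurable_compose[OF measurable_snd measurable_component_singleton]) simp
  show ?thesis unfolding Zf_def by measurable
qed

lemma Zf_measurable2 [measurable]: "Zf y \<in> borel_measurable R"
  using measurable_compose[OF measurable_Pair1'[of y S R] Zf_measurable] by (simp add: space_PiM space_pair_measure)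

lemma Z_measurable [measurable]: "Z \<in> borel_measurable M"
  unfolding Z_def[abs_def] using measurable_compose[OF measurable_Pair[OF Y_measurable EE_measurable] Zf_measurable]
  by simp

lemma prob_marks_gt:
  assumes p: "\<And>i. 0 < p i" and tt: "(\<Sum>i. if i \<in> I then ennreal (p i) else 0) = ennreal l" "0 \<le> l" and a: "0 \<le> a"
  shows "prob {\<omega> \<in> space M. \<forall>i\<in>I. a * p i < E i \<omega>} = exp (- a * l)"
proof -
  define X where "X i \<omega> = (if i \<in> I then indicator {a * p i<..} (E i \<omega>) else 1 :: real)" for i \<omega>
  define d where "d i = (if i \<in> I then p i else 0)" for i
  have X_int: "expectation (X i) = exp (- a * d i)" for i
  proof (cases "i \<in> I")
    case True
    have "expectation (X i) = expectation (indicator {\<omega> \<in> space M. a * p i < E i \<omega>})"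
      using True by (intro Bochner_Integration.integral_cong) (auto simp: X_def indicator_def)
    also have "\<dots> = prob {\<omega> \<in> space M. a * p i < E i \<omega>}" by simp
    also have "\<dots> = exp (- (a * p i) * 1)"
      using a p[of i] by (intro exponential_distributedD_gt[OF E_distributed]) auto
    finally show ?thesis using True by (simp add: d_def)
  next
    case False
    then have "X i = (\<lambda>_. 1)" by (simp add: X_def fun_eq_iff)
    then show ?thesis using False by (simp add: d_def prob_space)
  qed
  have "indep_vars (\<lambda>_. borel) (\<lambda>i \<omega>. (\<lambda>x. if i \<in> I then indicator {a * p i<..} x else 1 :: real) (E i \<omega>)) UNIV"
    using E_indep by (rule indep_vars_compose2) auto
  then have X_indep: "indep_vars (\<lambda>_. borel) X UNIV" by (simp add: X_def[abs_def])
  have X_meas [measurable]: "X i \<in> borel_measurable M" for i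
    unfolding X_def[abs_def] by measurable
  have X01: "0 \<le> X i \<omega>" "X i \<omega> \<le> 1" for i \<omega> by (auto simp: X_def indicator_def)
  have fin: "expectation (\<lambda>\<omega>. \<Prod>i<n. X i \<omega>) = exp (- a * (\<Sum>i<n. d i))" for n
  proof -
    have "expectation (\<lambda>\<omega>. \<Prod>i<n. X i \<omega>) = (\<Prod>i<n. expectation (X i))"
      using indep_vars_subset[OF X_indep, of "{..<n}"] X01
      by (intro indep_vars_lebesgue_integral) (auto intro!: integrable_const_bound[where B = 1])
    then show ?thesis by (simp add: X_int exp_sum[symmetric] sum_distrib_left)
  qed
  have "(\<lambda>n. expectation (\<lambda>\<omega>. \<Prod>i<n. X i \<omega>)) \<longlonglongrightarrow>
      expectation (\<lambda>\<omega>. indicator {\<omega> \<in> space M. \<forall>i\<in>I. a * p i < E i \<omega>} \<omega>)"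
  proof (rule integral_dominated_convergence[where w = "\<lambda>_. 1"])
    show "AE \<omega> in M. norm (\<Prod>i<n. X i \<omega>) \<le> 1" for n
      using X01 by (auto simp: abs_prod intro!: prod_le_1 AE_I2)
    show "AE \<omega> in M. (\<lambda>n. \<Prod>i<n. X i \<omega>) \<longlonglongrightarrow> indicator {\<omega> \<in> space M. \<forall>i\<in>I. a * p i < E i \<omega>} \<omega>"
    proof (rule AE_I2)
      fix \<omega> assume \<omega>: "\<omega> \<in> space M"
      show "(\<lambda>n. \<Prod>i<n. X i \<omega>) \<longlonglongrightarrow> indicator {\<omega> \<in> space M. \<forall>i\<in>I. a * p i < E i \<omega>} \<omega>"
      proof (cases "\<forall>i\<in>I. a * p i < E i \<omega>")
        case True
        then have "X i \<omega> = 1" for i by (auto simp: X_def)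
        then show ?thesis using True \<omega> by simp
      next
        case False
        then obtain i where i: "i \<in> I" "\<not> a * p i < E i \<omega>" by auto
        then have Xi: "X i \<omega> = 0" by (simp add: X_def)
        have "\<forall>\<^sub>F n in sequentially. (\<Prod>i<n. X i \<omega>) = 0"
          using eventually_gt_at_top[of i] by eventually_elim (use Xi in \<open>auto intro!: prod_zero\<close>)
        then show ?thesis using False by (simp add: tendsto_eventually)
      qed
    qed
    show "(\<lambda>\<omega>. indicator {\<omega> \<in> space M. \<forall>i\<in>I. a * p i < E i \<omega>} \<omega> :: real) \<in> borel_measurable M"
      by measurable
  qed simp_all
  moreover have "(\<lambda>n. expectation (\<lambda>\<omega>. \<Prod>i<n. X i \<omega>)) \<longlonglongrightarrow> exp (- a * l)"
  proof -
    have "(\<Sum>i. ennreal (d i)) = ennreal l"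
      unfolding tt(1)[symmetric] by (intro suminf_cong) (simp add: d_def)
    moreover have "(\<lambda>n. \<Sum>i<n. ennreal (d i)) \<longlonglongrightarrow> (\<Sum>i. ennreal (d i))"
      by (rule summable_LIMSEQ) simp
    moreover have dn: "0 \<le> d i" for i using p[of i] by (simp add: d_def)
    ultimately have "(\<lambda>n. ennreal (\<Sum>i<n. d i)) \<longlonglongrightarrow> ennreal l" by (simp add: sum_ennreal)
    then have "(\<lambda>n. \<Sum>i<n. d i) \<longlonglongrightarrow> l"
      using dn tt(2) by (subst (asm) tendsto_ennreal_iff) (auto intro!: always_eventually sum_nonneg)
    then show ?thesis unfolding fin by (intro tendsto_intros)
  qed
  ultimately have "expectation (\<lambda>\<omega>. indicator {\<omega> \<in> space M. \<forall>i\<in>I. a * p i < E i \<omega>} \<omega>) = exp (- a * l)"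
    by (rule LIMSEQ_unique)
  then show ?thesis by simp
qed

lemma E_nonneg: "AE \<omega> in M. \<forall>i. 0 \<le> E i \<omega>"
proof -
  have "AE \<omega> in M. 0 \<le> E i \<omega>" for i
  proof (rule distributed_AE2[OF E_distributed, THEN iffD2])
    show "AE x in lborel. 0 < ennreal (exponential_density 1 x) \<longrightarrow> 0 \<le> x"
      by (auto simp: exponential_density_def)
  qed measurable
  then show ?thesis by (simp add: AE_all_countable)
qed

lemma Zf_distributed:
  assumes y: "\<And>i. 0 < snd (y i)"
    and l: "(\<Sum>i. if fst (y i) \<le> 1 then ennreal (snd (y i)) else 0) = ennreal l" "0 < l"
  shows "distributed M lborel (\<lambda>\<omega>. Zf y (EE \<omega>)) (\<lambda>x. ennreal (exponential_density l x))"
proof -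
  define I where "I = {i. fst (y i) \<le> 1}"
  have I: "I \<noteq> {}"
  proof
    assume "I = {}"
    then have "\<And>i. \<not> fst (y i) \<le> 1" by (auto simp: I_def)
    then show False using l by simp
  qed
  let ?W = "\<lambda>\<omega>. Zf y (EE \<omega>)"
  have [measurable]: "?W \<in> borel_measurable M"
    by (rule measurable_compose[OF EE_measurable Zf_measurable2])
  have W_eq: "AE \<omega> in M. ?W \<omega> = (INF i\<in>I. E i \<omega> / snd (y i)) \<and> (\<forall>i. 0 \<le> E i \<omega>)"
    using E_nonneg
  proof eventually_elim
    case (elim \<omega>)
    then show ?case
      using enn2real_INF_eq[OF I, of "\<lambda>i. E i \<omega> / snd (y i)"] y
      by (simp add: Zf_def EE_def I_def less_imp_le)
  qed
  have p: "prob {\<omega> \<in> space M. \<forall>i\<in>I. a * snd (y i) < E i \<omega>} = exp (- a * l)" if "0 \<le> a" for a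
    using prob_marks_gt[of "\<lambda>i. snd (y i)" I l a] y l that by (simp add: I_def)
  \<comment> \<open>If the infimum exceeds \<open>a\<close>, then so do all ratios, which has probability \<open>exp (- a l)\<close>; conversely, if
    all ratios exceed \<open>a + 1 / (n + 1)\<close>, then the infimum exceeds \<open>a\<close>.\<close>
  have gt: "prob {\<omega> \<in> space M. a < ?W \<omega>} = exp (- a * l)" if a: "0 \<le> a" for a
  proof (rule antisym)
    have "AE \<omega> in M. \<omega> \<in> {\<omega> \<in> space M. a < ?W \<omega>} \<longrightarrow> \<omega> \<in> {\<omega> \<in> space M. \<forall>i\<in>I. a * snd (y i) < E i \<omega>}"
      using W_eq
    proof (eventually_elim, safe)
      fix \<omega> i assume "a < ?W \<omega>" "?W \<omega> = (INF i\<in>I. E i \<omega> / snd (y i))" "\<forall>i. 0 \<le> E i \<omega>" "i \<in> I"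
      moreover have "(INF i\<in>I. E i \<omega> / snd (y i)) \<le> E i \<omega> / snd (y i)"
        using \<open>\<forall>i. 0 \<le> E i \<omega>\<close> \<open>i \<in> I\<close> y
        by (intro cINF_lower bdd_belowI[of _ 0]) (auto intro!: divide_nonneg_pos)
      ultimately have "a < E i \<omega> / snd (y i)" by linarith
      then show "a * snd (y i) < E i \<omega>" using y[of i] by (simp add: pos_less_divide_eq)
    qed
    then have "prob {\<omega> \<in> space M. a < ?W \<omega>} \<le> prob {\<omega> \<in> space M. \<forall>i\<in>I. a * snd (y i) < E i \<omega>}"
      by (rule finite_measure_mono_AE) measurable
    then show "prob {\<omega> \<in> space M. a < ?W \<omega>} \<le> exp (- a * l)" using p[OF a] by simp
  next
    have "exp (- (a + 1 / real (Suc n)) * l) \<le> prob {\<omega> \<in> space M. a < ?W \<omega>}" for n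
    proof -
      let ?a = "a + 1 / real (Suc n)"
      have "AE \<omega> in M. \<omega> \<in> {\<omega> \<in> space M. \<forall>i\<in>I. ?a * snd (y i) < E i \<omega>} \<longrightarrow> \<omega> \<in> {\<omega> \<in> space M. a < ?W \<omega>}"
        using W_eq
      proof (eventually_elim, safe)
        fix \<omega> assume *: "\<forall>i\<in>I. ?a * snd (y i) < E i \<omega>" "?W \<omega> = (INF i\<in>I. E i \<omega> / snd (y i))"
        have "?a \<le> (INF i\<in>I. E i \<omega> / snd (y i))"
        proof (rule cINF_greatest[OF I])
          fix i assume "i \<in> I"
          then have "?a * snd (y i) < E i \<omega>" using * by blast
          then show "?a \<le> E i \<omega> / snd (y i)" using y[of i] by (simp only: pos_le_divide_eq less_imp_le)
        qed
        moreover have "0 < 1 / real (Suc n)" by simp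
        ultimately show "a < ?W \<omega>" unfolding *(2) by linarith
      qed
      then have "prob {\<omega> \<in> space M. \<forall>i\<in>I. ?a * snd (y i) < E i \<omega>} \<le> prob {\<omega> \<in> space M. a < ?W \<omega>}"
        by (rule finite_measure_mono_AE) measurable
      then show ?thesis using p[of ?a] a by simp
    qed
    moreover have "(\<lambda>n. exp (- (a + 1 / real (Suc n)) * l)) \<longlonglongrightarrow> exp (- (a + 0) * l)"
      by (intro tendsto_intros LIMSEQ_Suc[OF lim_1_over_n])
    ultimately show "exp (- a * l) \<le> prob {\<omega> \<in> space M. a < ?W \<omega>}"
      by (intro LIMSEQ_le_const2) auto
  qed
  show ?thesis
  proof (subst exponential_distributed_iff[OF l(2)], intro conjI allI impI)
    fix a :: real assume a: "0 \<le> a"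
    have "{\<omega> \<in> space M. ?W \<omega> \<le> a} = space M - {\<omega> \<in> space M. a < ?W \<omega>}" by auto
    then show "prob {\<omega> \<in> space M. ?W \<omega> \<le> a} = 1 - exp (- a * l)"
      using gt[OF a] by (simp add: prob_compl)
  qed measurable
qed

lemma Z1_eq: "AE \<omega> in M. Z1 T P E \<omega> = Z \<omega>"
proof -
  show ?thesis
    using E_nonneg tau_pos_finite AE_space
  proof eventually_elim
    case (elim \<omega>)
    have J: "{i. T i \<omega> \<le> 1} \<noteq> {}"
    proof
      assume "{i. T i \<omega> \<le> 1} = {}"
      then have "\<And>i. \<not> T i \<omega> \<le> 1" by auto
      then show False using elim by (simp add: tau_eq)
    qed
    show ?case
      using enn2real_INF_eq[OF J, of "\<lambda>i. E i \<omega> / P i \<omega>"] elim P_pos[of \<omega>]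
      by (simp add: Z1_def Z_def Zf_def Y_def EE_def less_imp_le)
  qed
qed

text \<open>Conditionally on the points, \<open>Z\<close> is exponential with rate \<open>t\<close>.\<close>

lemma nn_integral_Z:
  assumes \<Psi> [measurable]: "\<Psi> \<in> borel_measurable (S \<Otimes>\<^sub>M borel)"
  shows "(\<integral>\<^sup>+\<omega>. \<Psi> (Y \<omega>, Z \<omega>) \<partial>M) =
    (\<integral>\<^sup>+\<omega>. (\<integral>\<^sup>+z. ennreal (exponential_density (t \<omega>) z) * \<Psi> (Y \<omega>, z) \<partial>lborel) \<partial>M)"
proof -
  interpret EE: prob_space "distr M R EE" by (rule prob_space_distr) simp
  have [measurable]: "(\<lambda>x. \<Psi> (fst x, Zf (fst x) (snd x))) \<in> borel_measurable (S \<Otimes>\<^sub>M R)"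
    by measurable
  have "(\<integral>\<^sup>+\<omega>. \<Psi> (Y \<omega>, Z \<omega>) \<partial>M) =
      (\<integral>\<^sup>+x. \<Psi> (fst x, Zf (fst x) (snd x)) \<partial>distr M (S \<Otimes>\<^sub>M R) (\<lambda>\<omega>. (Y \<omega>, EE \<omega>)))"
    by (subst nn_integral_distr) (auto simp: Z_def)
  also have "\<dots> = (\<integral>\<^sup>+x. \<Psi> (fst x, Zf (fst x) (snd x)) \<partial>(distr M S Y \<Otimes>\<^sub>M distr M R EE))"
    by (simp only: joint_law)
  also have "\<dots> = (\<integral>\<^sup>+y. (\<integral>\<^sup>+e. \<Psi> (y, Zf y e) \<partial>distr M R EE) \<partial>distr M S Y)"
    by (subst EE.nn_integral_fst[symmetric]) (auto cong: measurable_cong_sets)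
  also have "\<dots> = (\<integral>\<^sup>+\<omega>. (\<integral>\<^sup>+e. \<Psi> (Y \<omega>, Zf (Y \<omega>) e) \<partial>distr M R EE) \<partial>M)"
    by (subst nn_integral_distr) auto
  also have "\<dots> = (\<integral>\<^sup>+\<omega>. (\<integral>\<^sup>+z. ennreal (exponential_density (t \<omega>) z) * \<Psi> (Y \<omega>, z) \<partial>lborel) \<partial>M)"
  proof (rule nn_integral_cong_AE)
    show "AE \<omega> in M. (\<integral>\<^sup>+e. \<Psi> (Y \<omega>, Zf (Y \<omega>) e) \<partial>distr M R EE) =
        (\<integral>\<^sup>+z. ennreal (exponential_density (t \<omega>) z) * \<Psi> (Y \<omega>, z) \<partial>lborel)"
      using t_pos AE_space
    proof eventually_elim
      case (elim \<omega>)
      have YS [measurable]: "Y \<omega> \<in> space S" using measurable_space[OF Y_measurable] elim by simp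
      have \<Psi>Y: "(\<lambda>z. \<Psi> (Y \<omega>, z)) \<in> borel_measurable borel"
        using YS by measurable
      have D: "distributed M lborel (\<lambda>\<omega>'. Zf (Y \<omega>) (EE \<omega>')) (\<lambda>x. ennreal (exponential_density (t \<omega>) x))"
        using elim P_pos tau_eq[of \<omega>] by (intro Zf_distributed) (auto simp: Y_def cong: if_cong)
      have "(\<integral>\<^sup>+e. \<Psi> (Y \<omega>, Zf (Y \<omega>) e) \<partial>distr M R EE) = (\<integral>\<^sup>+\<omega>'. \<Psi> (Y \<omega>, Zf (Y \<omega>) (EE \<omega>')) \<partial>M)"
        using measurable_compose[OF Zf_measurable2 \<Psi>Y] by (subst nn_integral_distr) auto
      also have "\<dots> = (\<integral>\<^sup>+z. ennreal (exponential_density (t \<omega>) z) * \<Psi> (Y \<omega>, z) \<partial>lborel)"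
        using \<Psi>Y by (intro distributed_nn_integral[OF D, symmetric]) simp
      finally show ?case .
    qed
  qed
  finally show ?thesis .
qed

end

text \<open>No measurability is required of the two functions; this is applied to \<^const>\<open>Z1\<close>.\<close>

lemma density_cong_AE:
  assumes "AE x in M. f x = g x"
  shows "density M f = density M g"
  unfolding density_def using assms
  by (intro arg_cong[where f = "measure_of (space M) (sets M)"] ext nn_integral_cong_AE)
    (auto elim: eventually_mono)

context stable_marked
begin

lemma Z_pos: "AE \<omega> in M. 0 < Z \<omega>"
proof -
  have "(\<integral>\<^sup>+\<omega>. indicator {..0} (Z \<omega>) \<partial>M) =
      (\<integral>\<^sup>+\<omega>. (\<integral>\<^sup>+z. ennreal (exponential_density (t \<omega>) z) * indicator {..0} z \<partial>lborel) \<partial>M)"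
    using nn_integral_Z[of "\<lambda>x. indicator {..0} (snd x)"] by simp
  also have "\<dots> = (\<integral>\<^sup>+\<omega>. (\<integral>\<^sup>+z. 0 \<partial>(lborel :: real measure)) \<partial>M)"
  proof (rule nn_integral_cong, rule nn_integral_cong_AE)
    fix \<omega>
    show "AE z in lborel. ennreal (exponential_density (t \<omega>) z) * indicator {..0} z = 0"
      using AE_lborel_singleton[of "0::real"]
      by eventually_elim (auto simp: exponential_density_def indicator_def)
  qed
  finally have "(\<integral>\<^sup>+\<omega>. indicator {..0} (Z \<omega>) \<partial>M) = 0" by simp
  then have "AE \<omega> in M. indicator {..0} (Z \<omega>) = (0 :: ennreal)"
    by (subst (asm) nn_integral_0_iff_AE) auto
  then show ?thesis by eventually_elim (auto simp: indicator_def split: if_splits)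
qed

text \<open>The Laplace functional of \<open>Z \<xi>\<close> under the density proportional to \<open>Z powr \<theta>\<close>: condition on the points,
  interchange the integrals, and apply the Campbell formula for each value of \<open>Z\<close>.\<close>

lemma weighted_laplace:
  assumes f [measurable]: "f \<in> borel_measurable borel" and \<epsilon>: "0 < \<epsilon>" "\<And>x. x \<le> \<epsilon> \<Longrightarrow> f x = 0"
  shows "(\<integral>\<^sup>+\<omega>. ennreal (Z \<omega> powr \<theta> * nexp (\<integral>\<^sup>+x. f (Z \<omega> * x) \<partial>xi \<omega>)) \<partial>M) =
    ennreal (Gamma (\<theta> / \<alpha> + 1) *
      (laplace_test.kk \<alpha> (\<lambda>x. nexp (f x)) 1 * laplace_test.gg \<alpha> (\<lambda>x. nexp (f x)) (\<theta> + \<alpha>) 1))"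
proof -
  define q where "q x = nexp (f x)" for x
  have q [measurable]: "q \<in> borel_measurable borel" unfolding q_def[abs_def] by measurable
  interpret L: laplace_test \<alpha> \<epsilon> q
    by unfold_locales (use \<alpha> \<epsilon> in \<open>auto simp: q_def\<close>)
  define A where "A = 1 + \<alpha> * L.dl 1"
  have A: "0 < A" using L.dl_nonneg[of 1] \<alpha> by (simp add: A_def add_pos_nonneg)
  define c where "c = \<theta> / \<alpha> + 1"
  have c: "0 < c" "\<alpha> * c - 1 = \<theta> + \<alpha> - 1" "c = (\<theta> + \<alpha>) / \<alpha>"
    using \<alpha> \<theta> by (simp_all add: c_def field_simps)
  have f_eq: "(\<integral>\<^sup>+x. f (z * x) \<partial>xi \<omega>) = (\<Sum>i. if fst (Y \<omega> i) \<le> 1 then f (z * snd (Y \<omega> i)) else 0)" for z \<omega>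
    by (subst nn_integral_xi) (auto simp: Y_def intro!: suminf_cong)
  define \<Psi> where "\<Psi> x = ennreal (snd x powr \<theta> *
    nexp (\<Sum>i. if fst (fst x i) \<le> 1 then f (snd x * snd (fst x i)) else 0))" for x :: "(nat \<Rightarrow> real \<times> real) \<times> real"
  have [measurable]: "(\<lambda>x. fst x i) \<in> S \<Otimes>\<^sub>M borel \<rightarrow>\<^sub>M borel \<Otimes>\<^sub>M borel" for i
    by (rule measurable_compose[OF measurable_fst measurable_component_singleton]) simp
  have \<Psi>_meas [measurable]: "\<Psi> \<in> borel_measurable (S \<Otimes>\<^sub>M borel)"
    unfolding \<Psi>_def[abs_def] by measurable
  have \<Psi>_eq: "\<Psi> (Y \<omega>, z) = ennreal (z powr \<theta> * nexp (\<integral>\<^sup>+x. f (z * x) \<partial>xi \<omega>))" for \<omega> z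
    by (simp add: \<Psi>_def f_eq cong: if_cong)
  interpret LM: pair_sigma_finite lborel M
    by (intro pair_sigma_finite.intro sigma_finite_lborel sigma_finite_measure_axioms)
  have [measurable]: "(\<lambda>x. exponential_density (t (snd x)) (fst x)) \<in> borel_measurable (lborel \<Otimes>\<^sub>M M)"
    unfolding exponential_density_def by measurable
  have "(\<integral>\<^sup>+\<omega>. ennreal (Z \<omega> powr \<theta> * nexp (\<integral>\<^sup>+x. f (Z \<omega> * x) \<partial>xi \<omega>)) \<partial>M) = (\<integral>\<^sup>+\<omega>. \<Psi> (Y \<omega>, Z \<omega>) \<partial>M)"
    by (simp only: \<Psi>_eq)
  also have "\<dots> = (\<integral>\<^sup>+\<omega>. (\<integral>\<^sup>+z. ennreal (exponential_density (t \<omega>) z) * \<Psi> (Y \<omega>, z) \<partial>lborel) \<partial>M)"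
    by (rule nn_integral_Z) simp
  also have "\<dots> = (\<integral>\<^sup>+z. (\<integral>\<^sup>+\<omega>. ennreal (exponential_density (t \<omega>) z) * \<Psi> (Y \<omega>, z) \<partial>M) \<partial>lborel)"
    by (rule LM.Fubini') (simp add: case_prod_beta)
  also have "\<dots> = (\<integral>\<^sup>+z. ennreal (L.kk 1) *
      (ennreal (\<alpha> * z powr (\<alpha> * c - 1) * exp (- A * z powr \<alpha>)) * indicator {0<..} z) \<partial>lborel)"
  proof (rule nn_integral_cong_AE)
    show "AE z in lborel. (\<integral>\<^sup>+\<omega>. ennreal (exponential_density (t \<omega>) z) * \<Psi> (Y \<omega>, z) \<partial>M) =
        ennreal (L.kk 1) * (ennreal (\<alpha> * z powr (\<alpha> * c - 1) * exp (- A * z powr \<alpha>)) * indicator {0<..} z)"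
      using AE_lborel_singleton[of "0::real"]
    proof eventually_elim
      case (elim z)
      show ?case
      proof (cases "0 < z")
        case True
        have t_nn: "0 \<le> t \<omega>" for \<omega> by (simp add: t_def)
        have "(\<integral>\<^sup>+\<omega>. ennreal (exponential_density (t \<omega>) z) * \<Psi> (Y \<omega>, z) \<partial>M) =
            (\<integral>\<^sup>+\<omega>. ennreal (z powr \<theta>) *
              ennreal (t \<omega> * exp (- z * t \<omega>) * nexp (\<integral>\<^sup>+x. f (z * x) \<partial>xi \<omega>)) \<partial>M)"
          unfolding \<Psi>_eq using True t_nn
          by (intro nn_integral_cong)
            (simp add: exponential_density_def ennreal_mult[symmetric] mult_ac)
        also have "\<dots> = ennreal (z powr \<theta>) *
            (\<integral>\<^sup>+\<omega>. ennreal (t \<omega> * exp (- z * t \<omega>) * nexp (\<integral>\<^sup>+x. f (z * x) \<partial>xi \<omega>)) \<partial>M)"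
          by (rule nn_integral_cmult) measurable
        also have "\<dots> = ennreal (z powr \<theta>) *
            ennreal (z powr (\<alpha> - 1) * (\<alpha> * L.kk 1) * exp (- (z powr \<alpha> * A)))"
          using campbell[OF f \<epsilon> True] by (simp add: A_def q_def[abs_def])
        also have "\<dots> = ennreal (L.kk 1 * (\<alpha> * z powr (\<alpha> * c - 1) * exp (- A * z powr \<alpha>)))"
        proof -
          have "z powr (\<alpha> * c - 1) = z powr \<theta> * z powr (\<alpha> - 1)"
            using True unfolding c(2) by (simp add: powr_add[symmetric] algebra_simps)
          then show ?thesis by (simp add: ennreal_mult'[symmetric] mult_ac)
        qed
        finally show ?thesis using True L.kk_nonneg[of 1] by (simp add: ennreal_mult')
      qed (use elim in \<open>auto simp: exponential_density_def\<close>)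
    qed
  qed
  also have "\<dots> = ennreal (L.kk 1) *
      (\<integral>\<^sup>+z. ennreal (\<alpha> * z powr (\<alpha> * c - 1) * exp (- A * z powr \<alpha>)) * indicator {0<..} z \<partial>lborel)"
    by (rule nn_integral_cmult) measurable
  also have "\<dots> = ennreal (L.kk 1) * ennreal (Gamma c * A powr (- c))"
    by (simp only: nn_integral_weibull[OF \<alpha> c(1) A])
  also have "A powr (- c) = L.gg (\<theta> + \<alpha>) 1"
    using \<alpha> by (simp add: L.gg_def L.hfun_def A_def c(3))
  finally show ?thesis
    using L.kk_nonneg[of 1] by (simp add: ennreal_mult'[symmetric] c_def q_def[abs_def] mult_ac)
qed

lemma PD_stable_law_eq:
  assumes "perpetuity B \<alpha> \<theta> G U"
  shows "PD_stable_law \<alpha> \<theta> M T P E = distr B (measure_algebra borel) (perpetuity_partition G U)"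
proof -
  interpret B: perpetuity B \<alpha> \<theta> G U by fact
  let ?A = "measure_algebra (borel :: real measure)"
  let ?g = "Gamma (\<theta> / \<alpha> + 1)"
  have g: "0 < ?g"
    using \<alpha> \<theta> by (intro Gamma_real_pos) (simp add: field_simps)
  define N where "N = density M (\<lambda>\<omega>. ennreal (Z \<omega> powr \<theta> / ?g))"
  have N_eq: "density M (\<lambda>\<omega>. ennreal (Z1 T P E \<omega> powr \<theta> / ?g)) = N"
    unfolding N_def using Z1_eq by (intro density_cong_AE) (auto elim: eventually_mono)
  have [measurable_cong]: "sets N = sets M" by (simp add: N_def)
  have AE_N: "AE \<omega> in N. Q \<omega>" if "AE \<omega> in M. Q \<omega>" for Q
    unfolding N_def using that by (subst AE_density) auto
  define X where "X \<omega> = point_measure borel (J \<omega>) (\<lambda>i. Z \<omega> * P i \<omega>)" for \<omega>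
  have X_meas [measurable]: "X \<in> N \<rightarrow>\<^sub>M ?A"
    unfolding X_def[abs_def] J_def by (rule measurable_point_measure) measurable
  have X_measM: "X \<in> M \<rightarrow>\<^sub>M ?A" using X_meas by (simp cong: measurable_cong_sets)
  have lap: "(\<integral>\<^sup>+\<omega>. ennreal (nexp (\<integral>\<^sup>+x. f x \<partial>X \<omega>)) \<partial>N) = ennreal (B.expectation (\<lambda>\<omega>. nexp (\<integral>\<^sup>+x. f x \<partial>B.X \<omega>)))"
    if f [measurable]: "f \<in> borel_measurable borel" and \<epsilon>: "0 < \<epsilon>" "\<And>x. x \<le> \<epsilon> \<Longrightarrow> f x = 0" for f \<epsilon>
  proof -
    note [measurable] = X_measM
    have "(\<integral>\<^sup>+\<omega>. ennreal (nexp (\<integral>\<^sup>+x. f x \<partial>X \<omega>)) \<partial>N) =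
        (\<integral>\<^sup>+\<omega>. ennreal (Z \<omega> powr \<theta> / ?g) * ennreal (nexp (\<integral>\<^sup>+x. f x \<partial>X \<omega>)) \<partial>M)"
      unfolding N_def by (rule nn_integral_density) measurable
    also have "\<dots> = (\<integral>\<^sup>+\<omega>. ennreal (1 / ?g) * ennreal (Z \<omega> powr \<theta> * nexp (\<integral>\<^sup>+x. f (Z \<omega> * x) \<partial>xi \<omega>)) \<partial>M)"
      unfolding X_def nn_integral_point_measure_mult[OF f] xi_def[symmetric] using g
      by (intro nn_integral_cong) (simp add: ennreal_mult[symmetric])
    also have "\<dots> = ennreal (1 / ?g) * (\<integral>\<^sup>+\<omega>. ennreal (Z \<omega> powr \<theta> * nexp (\<integral>\<^sup>+x. f (Z \<omega> * x) \<partial>xi \<omega>)) \<partial>M)"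
    proof (rule nn_integral_cmult)
      have "(\<lambda>\<omega>. ennreal (Z \<omega> powr \<theta> * nexp (\<integral>\<^sup>+x. f x \<partial>X \<omega>))) \<in> borel_measurable M" by measurable
      then show "(\<lambda>\<omega>. ennreal (Z \<omega> powr \<theta> * nexp (\<integral>\<^sup>+x. f (Z \<omega> * x) \<partial>xi \<omega>))) \<in> borel_measurable M"
        unfolding X_def nn_integral_point_measure_mult[OF f] xi_def[symmetric] .
    qed
    also have "\<dots> = ennreal (laplace_test.kk \<alpha> (\<lambda>x. nexp (f x)) 1 * laplace_test.gg \<alpha> (\<lambda>x. nexp (f x)) (\<theta> + \<alpha>) 1)"
      using weighted_laplace[OF f \<epsilon>] g by (simp add: ennreal_mult'[symmetric])
    also have "\<dots> = ennreal (B.expectation (\<lambda>\<omega>. nexp (\<integral>\<^sup>+x. f x \<partial>B.X \<omega>)))"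
      using B.laplace_X[OF f \<epsilon>, of 1] by simp
    finally show ?thesis .
  qed
  have N_prob: "prob_space N"
  proof (rule prob_spaceI)
    have "emeasure N (space N) = (\<integral>\<^sup>+\<omega>. ennreal (nexp (\<integral>\<^sup>+x. 0 \<partial>X \<omega>)) \<partial>N)" by simp
    also have "\<dots> = 1" by (subst lap[of "\<lambda>_. 0" 1]) (simp_all add: B.prob_space)
    finally show "emeasure N (space N) = 1" .
  qed
  have good: "AE \<omega> in N. 0 < Z \<omega> \<and> J \<omega> \<noteq> {} \<and> summable (\<lambda>i. if i \<in> J \<omega> then P i \<omega> else 0) \<and> \<omega> \<in> space M"
  proof (rule AE_N)
    show "AE \<omega> in M. 0 < Z \<omega> \<and> J \<omega> \<noteq> {} \<and> summable (\<lambda>i. if i \<in> J \<omega> then P i \<omega> else 0) \<and> \<omega> \<in> space M"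
      using Z_pos tau_pos_finite AE_space
    proof eventually_elim
      case (elim \<omega>)
      have "normalisable (xi \<omega>)"
        using elim P_pos emeasure_point_measure_nonpos[of "J \<omega>" "\<lambda>i. P i \<omega>"]
        by (simp add: normalisable_def tau_def xi_def)
      then have "J \<omega> \<noteq> {}" "summable (\<lambda>i. if i \<in> J \<omega> then P i \<omega> else 0)"
        using normalisable_point_measureD[of "J \<omega>" "\<lambda>i. P i \<omega>"] P_pos elim by (simp_all add: xi_def)
      with elim show ?case by simp
    qed
  qed
  have X0: "AE \<omega> in N. emeasure (X \<omega>) {..0} = 0"
    using good by eventually_elim (use P_pos in \<open>auto simp: X_def intro!: emeasure_point_measure_nonpos\<close>)
  have Yn: "AE \<omega> in B. normalisable (B.X \<omega>)"
    using B.normalise_X by eventually_elim simp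
  have "PD_stable_law \<alpha> \<theta> M T P E = distr N ?A (\<lambda>\<omega>. normalise (X \<omega>))"
    unfolding PD_stable_law_def N_eq
  proof (rule distr_cong_AE[OF refl refl])
    show "AE \<omega> in N. point_measure borel {i. T i \<omega> \<le> 1} (\<lambda>i. P i \<omega> / tau1 T P \<omega>) = normalise (X \<omega>)"
      using good
    proof eventually_elim
      case (elim \<omega>)
      then show ?case
        using normalise_point_measure_mult[of "J \<omega>" "\<lambda>i. P i \<omega>" "Z \<omega>"] P_pos
        by (simp add: X_def J_def tau1_def)
    qed
    show "(\<lambda>\<omega>. point_measure borel {i. T i \<omega> \<le> 1} (\<lambda>i. P i \<omega> / tau1 T P \<omega>)) \<in> N \<rightarrow>\<^sub>M ?A"
      unfolding tau1_def by (rule measurable_point_measure) measurable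
  qed measurable
  also have "\<dots> = distr B ?A (\<lambda>\<omega>. normalise (B.X \<omega>))"
  proof (rule normalised_laws_eq(2)[OF N_prob B.prob_space_axioms X_meas B.X_measurable X0 Yn])
    show "(\<integral>\<omega>. nexp (\<integral>\<^sup>+x. f x \<partial>X \<omega>) \<partial>N) = B.expectation (\<lambda>\<omega>. nexp (\<integral>\<^sup>+x. f x \<partial>B.X \<omega>))"
      if f [measurable]: "f \<in> borel_measurable borel" and \<epsilon>: "0 < \<epsilon>" "\<And>x. x \<le> \<epsilon> \<Longrightarrow> f x = 0" for f :: "real \<Rightarrow> ennreal" and \<epsilon>
      using lap[OF that] by (subst integral_eq_nn_integral) (auto intro!: integral_nonneg_AE)
  qed
  finally show ?thesis by (simp add: B.distr_perpetuity_partition)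
qed

end

section \<open>Poisson-Dirichlet laws as laws of normalised perpetuities\<close>

lemma perpetuityI:
  assumes "0 \<le> \<alpha>" "\<alpha> < 1" "- \<alpha> < \<theta>"
    and "gamma_beta_variables (1 - \<alpha>) (\<lambda>n. \<theta> + real n * \<alpha>) (\<lambda>_. 1) B G U"
  shows "perpetuity B \<alpha> \<theta> G U"
  using assms by (auto simp: perpetuity_def perpetuity_axioms_def gamma_beta_variables_def)

lemma is_PD_eq:
  assumes "0 \<le> \<alpha>" "\<alpha> < 1" "- \<alpha> < \<theta>" and PD: "is_PD \<alpha> \<theta> L"
    and gbv: "gamma_beta_variables (1 - \<alpha>) (\<lambda>n. \<theta> + real n * \<alpha>) (\<lambda>_. 1) B G U"
  shows "L = distr B (measure_algebra borel) (perpetuity_partition G U)"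
proof -
  interpret B: perpetuity B \<alpha> \<theta> G U using assms by (intro perpetuityI)
  from PD show ?thesis
    unfolding is_PD_def
  proof (elim disjE conjE exE)
    fix M :: "(nat \<Rightarrow> real) measure" and P
    assume "\<alpha> = 0" "PD0_process \<theta> M P" "L = PD0_law M P"
    then show ?thesis using B.PD0_law_eq by simp
  next
    fix M :: "(nat \<Rightarrow> real \<times> real \<times> real) measure" and T P E
    assume a: "0 < \<alpha>" "stable_process \<alpha> M T P E" "L = PD_stable_law \<alpha> \<theta> M T P E"
    interpret M: stable_marked \<alpha> \<theta> M T P E by unfold_locales (use assms a in auto)
    show ?thesis using M.PD_stable_law_eq[OF B.perpetuity_axioms] a by simp
  qed
qed

theorem proposition2p2:
  fixes \<alpha> \<theta> :: real and L :: "real measure measure"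
  assumes "0 \<le> \<alpha>" and "\<alpha> < 1" and "- \<alpha> < \<theta>"
    and "is_PD \<alpha> \<theta> L"
  shows "(\<forall>(A :: 'a measure) \<xi> (B :: 'b measure) G U.
            random_mass_partition A \<xi> \<and> distr A (measure_algebra borel) \<xi> = L \<and>
            gamma_beta_variables (1 - \<alpha>) (\<lambda>n. \<theta> + real n * \<alpha>) (\<lambda>_. 1) B G U \<longrightarrow>
            distr A (measure_algebra borel) \<xi> =
              distr B (measure_algebra borel) (perpetuity_partition G U))
         \<and> beta_gamma_family L"
proof (intro conjI allI impI; (elim conjE)?)
  fix A :: "'a measure" and \<xi> and B :: "'b measure" and G U
  assume "distr A (measure_algebra borel) \<xi> = L"
    "gamma_beta_variables (1 - \<alpha>) (\<lambda>n. \<theta> + real n * \<alpha>) (\<lambda>_. 1) B G U"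
  then show "distr A (measure_algebra borel) \<xi> = distr B (measure_algebra borel) (perpetuity_partition G U)"
    using is_PD_eq[OF assms] by blast
next
  have a: "0 < \<theta> + real n * \<alpha>" if "1 \<le> n" for n
  proof -
    have "1 * \<alpha> \<le> real n * \<alpha>" using that assms(1) by (intro mult_right_mono) auto
    then show ?thesis using assms(3) by simp
  qed
  obtain M :: "(nat + nat \<Rightarrow> real) measure" and G U
    where gbv: "gamma_beta_variables (1 - \<alpha>) (\<lambda>n. \<theta> + real n * \<alpha>) (\<lambda>_. 1) M G U"
    using gamma_beta_variables_exist[of "1 - \<alpha>" "\<lambda>n. \<theta> + real n * \<alpha>"] a assms(2) by auto
  interpret M: perpetuity M \<alpha> \<theta> G U using assms gbv by (intro perpetuityI)
  have "AE \<omega> in M. summable (\<lambda>j. G (Suc j) \<omega> * Pi_prod U (Suc j) \<omega>)"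
    using M.summable_gP by (simp add: M.Pi_prod_eq M.g_def)
  moreover have "L = distr M (measure_algebra borel) (perpetuity_partition G U)"
    by (rule is_PD_eq[OF assms gbv])
  ultimately show "beta_gamma_family L"
    unfolding beta_gamma_family_def using gbv a assms(2)
    by (intro exI[of _ "1 - \<alpha>"] exI[of _ "\<lambda>n. \<theta> + real n * \<alpha>"] exI[of _ "\<lambda>_. 1"] exI[of _ M]
        exI[of _ G] exI[of _ U]) simp
qed

end
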